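(* Let $n\geqslant 3$, $0<\alpha\leqslant 2$, let $A$ be a closed proper subset of $\mathbb R^n$ with $c_\alpha(A)>0$, and let $\mu\in\mathcal E^+$. Then there exists $\mu^A\in\mathcal E^+_A$ such that $$U^{\mu^A}=U^\mu\ \text{ n.e. on }A,\tag{1}$$ $$U^{\mu^A}\leqslant U^\mu\ \text{ on }\mathbb R^n.\tag{2}$$ This $\mu^A$ is the orthogonal projection of $\mu$ in the pre-Hilbert space $\mathcal E$ onto the convex cone $\mathcal E^+_A$, and it is determined uniquely within $\mathcal E^+_A$ by (1).
   Context: For a Radon measure $\nu$ on $\mathbb R^n$, the potential is $U^\nu(x)=\int|x-y|^{\alpha-n}\,d\nu(y)$; the mutual energy is $E(\nu,\nu_1)=\int|x-y|^{\alpha-n}\,d(\nu\otimes\nu_1)(x,y)$ and the energy is $E(\nu)=E(\nu,\nu)$. The signed Radon measures of finite energy form a pre-Hilbert space $\mathcal E$ with inner product $E(\nu,\nu_1)$ and norm $\|\nu\|=\sqrt{E(\nu)}$. $\mathcal E^+$ is the cone of positive measures in $\mathcal E$. For $Q\subset\mathbb R^n$, $\mathcal E^+_Q$ is the cone of all $\nu\in\mathcal E^+$ carried by $Q$, i.e. such that $Q$ is $\nu$-measurable and $Q^c$ is $\nu$-negligible. The inner capacity is $c_\alpha(Q)=1/\inf E(\nu)$, where $\nu$ ranges over all $\nu\in\mathcal E^+_Q$ with $\nu(\mathbb R^n)=1$ ($\inf\varnothing=+\infty$, $1/(+\infty)=0$, $1/0=+\infty$). An assertion holds n.e. (nearly everywhere)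 on $Q$ if the set of points of $Q$ where it fails has zero inner capacity. The orthogonal projection of $\mu$ onto $\mathcal E^+_A$ is the unique element of $\mathcal E^+_A$ at which $\min_{\nu\in\mathcal E^+_A}\|\mu-\nu\|$ is attained. *)

theory Defs
  imports "HOL-Analysis.Analysis"
begin

text \<open>A positive Radon measure on a Euclidean space is the same thing as a Borel measure that is
  finite on compact sets.\<close>

definition radon :: "'a::euclidean_space measure \<Rightarrow> bool" where
  "radon \<nu> \<longleftrightarrow> sets \<nu> = sets borel \<and> (\<forall>K. compact K \<longrightarrow> emeasure \<nu> K < \<infinity>)"

text \<open>The value on the diagonal is explicit because \<open>0 powr a = 0\<close>; the kernel is only
  used for \<open>\<alpha>\<close> below the dimension.\<close>

definition riesz_kernel :: "real \<Rightarrow> 'a::euclidean_space \<Rightarrow> 'a \<Rightarrow> ennreal" where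
  "riesz_kernel \<alpha> x y =
     (if x = y then \<infinity> else ennreal (norm (x - y) powr (\<alpha> - real DIM('a))))"

definition potential :: "real \<Rightarrow> 'a::euclidean_space measure \<Rightarrow> 'a \<Rightarrow> ennreal" where
  "potential \<alpha> \<nu> x = (\<integral>\<^sup>+ y. riesz_kernel \<alpha> x y \<partial>\<nu>)"

definition mutual_energy ::
    "real \<Rightarrow> 'a::euclidean_space measure \<Rightarrow> 'a measure \<Rightarrow> ennreal" where
  "mutual_energy \<alpha> \<nu> \<nu>1 = (\<integral>\<^sup>+ z. riesz_kernel \<alpha> (fst z) (snd z) \<partial>(\<nu> \<Otimes>\<^sub>M \<nu>1))"

definition energy :: "real \<Rightarrow> 'a::euclidean_space measure \<Rightarrow> ennreal" where
  "energy \<alpha> \<nu> = mutual_energy \<alpha> \<nu> \<nu>"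

definition energy_cone :: "real \<Rightarrow> 'a::euclidean_space measure set" where
  "energy_cone \<alpha> = {\<nu>. radon \<nu> \<and> energy \<alpha> \<nu> < \<infinity>}"

text \<open>Measurability and negligibility with respect to a Radon measure refer to its completion.\<close>

definition carried_by :: "'a::euclidean_space measure \<Rightarrow> 'a set \<Rightarrow> bool" where
  "carried_by \<nu> Q \<longleftrightarrow> Q \<in> sets (completion \<nu>) \<and> - Q \<in> null_sets (completion \<nu>)"

definition energy_cone_on :: "real \<Rightarrow> 'a::euclidean_space set \<Rightarrow> 'a measure set" where
  "energy_cone_on \<alpha> Q = {\<nu> \<in> energy_cone \<alpha>. carried_by \<nu> Q}"

definition inner_capacity :: "real \<Rightarrow> 'a::euclidean_space set \<Rightarrow> ennreal" where
  "inner_capacity \<alpha> Q =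
     1 / (INF \<nu> \<in> {\<nu> \<in> energy_cone_on \<alpha> Q. emeasure \<nu> UNIV = 1}. energy \<alpha> \<nu>)"

definition nearly_everywhere_on ::
    "real \<Rightarrow> 'a::euclidean_space set \<Rightarrow> ('a \<Rightarrow> bool) \<Rightarrow> bool" where
  "nearly_everywhere_on \<alpha> Q P \<longleftrightarrow> inner_capacity \<alpha> {x \<in> Q. \<not> P x} = 0"

text \<open>A signed Radon measure may have infinite positive and negative mass, so it need not be a set
  function on all Borel sets. It is encoded by its values on the bounded Borel sets, extended by
  \<open>0\<close>; sums and differences of signed measures are then those of functions.\<close>

definition charge :: "'a::euclidean_space measure \<Rightarrow> 'a set \<Rightarrow> real" where
  "charge \<nu> B = (if B \<in> sets borel \<and> bounded B then measure \<nu> B else 0)"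

definition signed_radon :: "('a::euclidean_space set \<Rightarrow> real) set" where
  "signed_radon = {charge p - charge q | p q. radon p \<and> radon q}"

text \<open>Hahn--Jordan decomposition: \<open>\<sigma>\<^sup>+(B)\<close> is the supremum of \<open>\<sigma>(C)\<close> over the bounded Borel
  subsets \<open>C\<close> of \<open>B\<close>, and \<open>\<sigma>\<^sup>- = (-\<sigma>)\<^sup>+\<close>. Since \<open>C = {}\<close> is admissible, the truncation of negative
  values by \<open>ennreal\<close> does not affect the supremum.\<close>

definition pos_var :: "('a::euclidean_space set \<Rightarrow> real) \<Rightarrow> 'a measure" where
  "pos_var \<sigma> = measure_of UNIV (sets borel)
     (\<lambda>B. SUP C \<in> {C \<in> sets borel. bounded C \<and> C \<subseteq> B}. ennreal (\<sigma> C))"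

definition neg_var :: "('a::euclidean_space set \<Rightarrow> real) \<Rightarrow> 'a measure" where
  "neg_var \<sigma> = pos_var (- \<sigma>)"

text \<open>The energy of a signed measure is well defined and finite exactly if the kernel is integrable
  against each of the products of its positive and negative parts.\<close>

definition energy_space :: "real \<Rightarrow> ('a::euclidean_space set \<Rightarrow> real) set" where
  "energy_space \<alpha> = {\<sigma> \<in> signed_radon.
     energy \<alpha> (pos_var \<sigma>) < \<infinity> \<and> energy \<alpha> (neg_var \<sigma>) < \<infinity> \<and>
     mutual_energy \<alpha> (pos_var \<sigma>) (neg_var \<sigma>) < \<infinity>}"

text \<open>The integral of the kernel against \<open>\<sigma> \<otimes> \<tau>\<close>, by bilinearity over the Hahn--Jordan
  decompositions; meaningful for \<open>\<sigma>\<close>, \<open>\<tau>\<close> in \<^const>\<open>energy_space\<close>.\<close>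

definition energy_inner ::
    "real \<Rightarrow> ('a::euclidean_space set \<Rightarrow> real) \<Rightarrow> ('a set \<Rightarrow> real) \<Rightarrow> real" where
  "energy_inner \<alpha> \<sigma> \<tau> =
     enn2real (mutual_energy \<alpha> (pos_var \<sigma>) (pos_var \<tau>))
     - enn2real (mutual_energy \<alpha> (pos_var \<sigma>) (neg_var \<tau>))
     - enn2real (mutual_energy \<alpha> (neg_var \<sigma>) (pos_var \<tau>))
     + enn2real (mutual_energy \<alpha> (neg_var \<sigma>) (neg_var \<tau>))"

definition energy_norm :: "real \<Rightarrow> ('a::euclidean_space set \<Rightarrow> real) \<Rightarrow> real" where
  "energy_norm \<alpha> \<sigma> = sqrt (energy_inner \<alpha> \<sigma> \<sigma>)"

definition orthogonal_projection_onto ::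
    "real \<Rightarrow> ('a::euclidean_space set \<Rightarrow> real) set \<Rightarrow> ('a set \<Rightarrow> real) \<Rightarrow> ('a set \<Rightarrow> real) \<Rightarrow> bool" where
  "orthogonal_projection_onto \<alpha> C \<sigma> \<tau> \<longleftrightarrow>
     C \<subseteq> energy_space \<alpha> \<and> \<sigma> \<in> energy_space \<alpha> \<and>
     \<tau> \<in> C \<and> (\<forall>\<rho>\<in>C. energy_norm \<alpha> (\<sigma> - \<tau>) \<le> energy_norm \<alpha> (\<sigma> - \<rho>)) \<and>
     (\<forall>\<tau>'\<in>C. (\<forall>\<rho>\<in>C. energy_norm \<alpha> (\<sigma> - \<tau>') \<le> energy_norm \<alpha> (\<sigma> - \<rho>)) \<longrightarrow> \<tau>' = \<tau>)"

end

theory Submission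
  imports Defs "HOL-Probability.Probability" "HOL-Real_Asymp.Real_Asymp"
begin

text \<open>The Riesz kernel is, up to a constant, the mixture \<open>\<integral>\<^sub>0\<^sup>\<infinity> t\<^bsup>\<alpha>/2-1\<^esup> p\<^sub>t dt\<close> of heat kernels. By
  the semigroup property the energy of a difference is therefore an \<open>L\<^sup>2\<close>-norm,
  \<open>\<parallel>\<mu> - \<nu>\<parallel>\<^sup>2 = c \<integral>\<integral> t\<^bsup>\<alpha>/2-1\<^esup> (p\<^bsub>t/2\<^esub> * \<mu> - p\<^bsub>t/2\<^esub> * \<nu>)\<^sup>2 dz dt\<close>. This gives strict positivity of the energy, and,
  by Fatou's lemma along a vaguely convergent minimising sequence, a measure \<open>\<nu>\<close> in the cone nearest
  to \<open>\<mu>\<close>. Varying \<open>\<nu>\<close> within the cone shows \<open>U\<^sup>\<nu> \<ge> U\<^sup>\<mu>\<close> nearly everywhere on \<open>A\<close>, with equality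
  \<open>\<nu>\<close>-almost everywhere.

  What remains is the domination principle: \<open>u = U\<^sup>\<nu> \<le> v = U\<^sup>\<mu>\<close> \<open>\<nu>\<close>-almost everywhere implies \<open>u \<le> v\<close>
  everywhere. It uses \<open>\<alpha> \<le> 2\<close> through a renewal identity for \<open>t\<^bsup>\<alpha>/2-1\<^esup>\<close>: there is a mixture \<open>Q\<close> of
  heat operators at times at least \<open>r\<close> such that the kernel equals its part with \<open>t \<le> r\<close> plus its image
  under \<open>Q\<close>. Potentials are \<open>Q\<close>-supermedian, hence so is \<open>w = min(u, v)\<close>, and the function
  \<open>w - Qw \<ge> 0\<close> has as potential a mollification of \<open>w\<close>. Comparing its energy with that of
  \<open>u - Qu\<close>, the inequality \<open>\<parallel>(u - Qu) - (w - Qw)\<parallel>\<^sup>2 \<ge> 0\<close> forces \<open>u = w\<close> as \<open>r \<rightarrow> 0\<close>, because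
  \<open>\<integral> (u - w) d\<nu> = 0\<close>.\<close>

section \<open>The heat kernel\<close>

text \<open>Measures of finite energy may have infinite mass, so a minimising sequence is not
  vaguely bounded for free. The potential of a Gaussian is at least a multiple of (1 +
  |x|)^(\<alpha> - n), hence the energy bounds the integral of this weight. Compactness is applied
  to the weighted measures; the heat kernel divided by the weight still vanishes at infinity, so
  heat flows converge pointwise.

  The minimum of two potentials is not known to be the potential of a measure. Subtracting its image
  under Q gives a genuine function b, and the positivity of the energy is needed for functions only.
  All energies compared have order m^2, where m is the mass of the times up to r; after division by
  m^2 the limit r -> 0 is a matter of Fatou's lemma.

  The jump density is a multiple of s^(-1) (s - r)^(-\<alpha>/2): it is integrable at r exactly for
  \<alpha> < 2 and degenerates to a point mass at \<alpha> = 2.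

  Potentials and energies may be infinite and subtraction of extended reals truncates, so
  inequalities such as 2 E(M,N) <= E(M) + E(N) are kept in additive form and finite terms are
  cancelled late.\<close>

lemma nn_integral_lborel_affine:
  fixes f :: "'a::euclidean_space \<Rightarrow> ennreal"
  assumes [measurable]: "f \<in> borel_measurable borel" and "c \<noteq> 0"
  shows "(\<integral>\<^sup>+ x. f x \<partial>lborel) = ennreal (\<bar>c\<bar> ^ DIM('a)) * (\<integral>\<^sup>+ x. f (t + c *\<^sub>R x) \<partial>lborel)"
  by (subst lborel_affine[OF \<open>c \<noteq> 0\<close>, of t], subst nn_integral_density)
     (auto simp: nn_integral_distr nn_integral_cmult)

text \<open>The Gaussian factorises along \<open>Basis\<close>, so the integral is a finite power of
  a one-dimensional one.\<close>

lemma nn_integral_gauss_less_top: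
  "(\<integral>\<^sup>+ y. ennreal (exp (- (norm (y::'a::euclidean_space))\<^sup>2)) \<partial>lborel) < \<infinity>"
proof -
  interpret product_sigma_finite "\<lambda>b::'a. lborel :: real measure" ..
  have one: "(\<integral>\<^sup>+ x. ennreal (exp (- (x::real)\<^sup>2)) \<partial>lborel) < \<infinity>"
  proof -
    have "integrable lborel (\<lambda>x::real. indicat_real {0..} x *\<^sub>R exp (- x\<^sup>2))"
      using gaussian_moment_0 by (auto simp: has_bochner_integral_iff)
    then have fin: "(\<integral>\<^sup>+ x. ennreal (indicat_real {0..} x *\<^sub>R exp (- x\<^sup>2)) \<partial>lborel) < \<infinity>"
      (is "?I < _")
      by (subst (asm) integrable_iff_bounded) (auto simp: abs_mult)
    \<comment> \<open>The known moment covers the half-line; the reflection of x supplies the other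
      half.\<close>
    have "(\<integral>\<^sup>+ x. ennreal (exp (- (x::real)\<^sup>2)) \<partial>lborel)
        \<le> (\<integral>\<^sup>+ x. ennreal (indicat_real {0..} x *\<^sub>R exp (- x\<^sup>2))
              + ennreal (indicat_real {0..} (0 + (-1) * x) *\<^sub>R exp (- (0 + (-1) * x)\<^sup>2)) \<partial>lborel)"
      by (intro nn_integral_mono) (auto simp: indicator_def)
    also have "\<dots> = ?I + ?I"
      using nn_integral_real_affine[of "\<lambda>x. ennreal (indicat_real {0..} x *\<^sub>R exp (- x\<^sup>2))" "-1" 0]
      by (subst nn_integral_add) auto
    also have "\<dots> < \<infinity>" using fin by (simp add: less_top)
    finally show ?thesis .
  qed
  have "(\<integral>\<^sup>+ y. ennreal (exp (- (norm (y::'a))\<^sup>2)) \<partial>lborel)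
      = (\<integral>\<^sup>+ f. (\<Prod>b\<in>(Basis::'a set). ennreal (exp (- (f b)\<^sup>2))) \<partial>(Pi\<^sub>M Basis (\<lambda>b. lborel)))"
  proof (subst lborel_eq, subst nn_integral_distr)
    have "exp (- (norm (\<Sum>b\<in>(Basis::'a set). f b *\<^sub>R b))\<^sup>2) = (\<Prod>b\<in>(Basis::'a set). exp (- (f b)\<^sup>2))" for f :: "'a \<Rightarrow> real"
    proof -
      have "(norm (\<Sum>b\<in>(Basis::'a set). f b *\<^sub>R b))\<^sup>2 = (\<Sum>b\<in>(Basis::'a set). (f b)\<^sup>2)"
        by (subst power2_norm_eq_inner, subst euclidean_inner) (simp add: power2_eq_square)
      then show ?thesis by (simp add: sum_negf[symmetric] exp_sum)
    qed
    then show "(\<integral>\<^sup>+ f. ennreal (exp (- (norm (\<Sum>b\<in>(Basis::'a set). f b *\<^sub>R b))\<^sup>2)) \<partial>(Pi\<^sub>M Basis (\<lambda>b. lborel))) =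
      (\<integral>\<^sup>+ f. (\<Prod>b\<in>(Basis::'a set). ennreal (exp (- (f b)\<^sup>2))) \<partial>(Pi\<^sub>M Basis (\<lambda>b. lborel)))"
      by (simp add: prod_ennreal)
  qed auto
  also have "\<dots> = (\<Prod>b\<in>(Basis::'a set). (\<integral>\<^sup>+ x. ennreal (exp (- x\<^sup>2)) \<partial>lborel))"
    by (rule product_nn_integral_prod) auto
  also have "\<dots> < \<infinity>"
    using one by (simp add: power_less_top_ennreal)
  finally show ?thesis .
qed

text \<open>This is pi^(n/2), kept symbolic as the normalising factor of
  \<open>heat\<close>.\<close>

definition gauss_mass :: "'a::euclidean_space itself \<Rightarrow> real" where
  "gauss_mass _ = enn2real (\<integral>\<^sup>+ y. ennreal (exp (- (norm (y::'a))\<^sup>2)) \<partial>lborel)"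

lemma gauss_mass:
  "(\<integral>\<^sup>+ y. ennreal (exp (- (norm (y::'a::euclidean_space))\<^sup>2)) \<partial>lborel) = ennreal (gauss_mass TYPE('a))"
  using nn_integral_gauss_less_top[where 'a='a] by (simp add: gauss_mass_def less_top[symmetric])

lemma gauss_mass_pos: "0 < gauss_mass TYPE('a::euclidean_space)"
proof -
  have "(\<integral>\<^sup>+ y. ennreal (exp (- (norm (y::'a))\<^sup>2)) \<partial>lborel) \<noteq> 0"
    by (subst nn_integral_0_iff_AE) (auto simp: AE_iff_null null_sets_def)
  then show ?thesis unfolding gauss_mass
    by (metis ennreal_0 gauss_mass_def enn2real_nonneg order_le_less)
qed

text \<open>The usual heat kernel at time t/4. This scaling removes the factor 4 from the exponent
  and leaves the semigroup law in its usual form.\<close>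

definition heat :: "real \<Rightarrow> 'a::euclidean_space \<Rightarrow> real" where
  "heat t x = t powr (- (real DIM('a) / 2)) * exp (- (norm x)\<^sup>2 / t) / gauss_mass TYPE('a)"

lemma heat_pos: "0 < t \<Longrightarrow> 0 < heat t x"
  using gauss_mass_pos[where 'a='a] by (simp add: heat_def)

lemma heat_nonneg [simp]: "0 \<le> heat t x"
  using gauss_mass_pos[where 'a='a] by (simp add: heat_def)

lemma heat_minus_commute: "heat t (x - y) = heat t (y - x)"
  by (simp add: heat_def norm_minus_commute)

lemma borel_measurable_heat [measurable]:
  assumes [measurable]: "f \<in> borel_measurable M" "g \<in> borel_measurable M"
  shows "(\<lambda>w. heat (f w) (g w :: 'a::euclidean_space)) \<in> borel_measurable M"
  unfolding heat_def by measurable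

lemma isCont_heat: "isCont (heat t) x"
  unfolding heat_def[abs_def] divide_inverse by (intro continuous_intros)

lemma nn_integral_exp_quadratic:
  assumes "0 < a"
  shows "(\<integral>\<^sup>+ y. ennreal (exp (- a * (norm (y - w :: 'a::euclidean_space))\<^sup>2)) \<partial>lborel)
    = ennreal (a powr (- (real DIM('a) / 2)) * gauss_mass TYPE('a))"
proof -
  have "(\<integral>\<^sup>+ y. ennreal (exp (- a * (norm (y - w :: 'a))\<^sup>2)) \<partial>lborel) =
     ennreal (\<bar>1 / sqrt a\<bar> ^ DIM('a)) * (\<integral>\<^sup>+ y. ennreal (exp (- a * (norm ((w + (1 / sqrt a) *\<^sub>R y) - w :: 'a))\<^sup>2)) \<partial>lborel)"
    by (rule nn_integral_lborel_affine) (use assms in auto)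
  also have "(\<lambda>y. exp (- a * (norm ((w + (1 / sqrt a) *\<^sub>R y) - w :: 'a))\<^sup>2)) = (\<lambda>y. exp (- (norm y)\<^sup>2))"
    using assms by (auto simp: power_divide)
  also have "\<bar>1 / sqrt a\<bar> ^ DIM('a) = a powr (- (real DIM('a) / 2))"
  proof -
    have "\<bar>1 / sqrt a\<bar> = a powr (- (1/2))"
      using assms by (simp add: powr_half_sqrt powr_minus field_simps)
    then have "\<bar>1 / sqrt a\<bar> ^ DIM('a) = (a powr (- (1/2))) powr real DIM('a)"
      using assms by (simp add: powr_realpow)
    then show ?thesis by (simp add: powr_powr)
  qed
  finally show ?thesis
    by (simp add: gauss_mass ennreal_mult')
qed

lemma nn_integral_heat:
  assumes "0 < t"
  shows "(\<integral>\<^sup>+ y. ennreal (heat t (x - y :: 'a::euclidean_space)) \<partial>lborel) = 1"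
proof -
  let ?c = "t powr (- (real DIM('a) / 2)) / gauss_mass TYPE('a)"
  have "heat t (x - y) = ?c * exp (- (1 / t) * (norm (y - x))\<^sup>2)" for y
    by (simp add: heat_def norm_minus_commute)
  then have "(\<integral>\<^sup>+ y. ennreal (heat t (x - y :: 'a)) \<partial>lborel) =
      ennreal ?c * (\<integral>\<^sup>+ y. ennreal (exp (- (1 / t) * (norm (y - x))\<^sup>2)) \<partial>lborel)"
    using gauss_mass_pos[where 'a='a] by (subst nn_integral_cmult[symmetric]) (auto simp: ennreal_mult'[symmetric])
  also have "\<dots> = ennreal (?c * ((1 / t) powr (- (real DIM('a) / 2)) * gauss_mass TYPE('a)))"
    using assms gauss_mass_pos[where 'a='a] nn_integral_exp_quadratic[of "1 / t" x] by (simp add: ennreal_mult'[symmetric])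
  also have "?c * ((1 / t) powr (- (real DIM('a) / 2)) * gauss_mass TYPE('a)) = 1"
    using assms gauss_mass_pos[where 'a='a] by (simp add: powr_divide powr_minus)
  finally show ?thesis by simp
qed

text \<open>Here P = |p|^2, Q = |q|^2 and R is the inner product of p and q; the first bracket is
  the expanded square of (s/(s+t)) q - (t/(s+t)) p.\<close>

lemma complete_square_aux:
  fixes s t P Q R :: real
  assumes "0 < s" "0 < t"
  shows "P / s + Q / t = ((s + t) / (s * t)) * ((s/(s+t))\<^sup>2 * Q + (t/(s+t))\<^sup>2 * P - 2 * (s/(s+t)) * (t/(s+t)) * R)
        + (P + Q + 2 * R) / (s + t)"
proof -
  define w where "w = s + t"
  have w: "w \<noteq> 0" "t = w - s" "s \<noteq> 0" "w - s \<noteq> 0" using assms by (auto simp: w_def)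
  have "P / s + Q / (w-s) = (w / (s * (w-s))) * ((s/w)\<^sup>2 * Q + ((w-s)/w)\<^sup>2 * P - 2 * (s/w) * ((w-s)/w) * R)
        + (P + Q + 2 * R) / w"
    using w(1,3,4) by (simp add: field_simps power2_eq_square)
  then show ?thesis by (simp add: w_def)
qed
text \<open>Completing the square in y leaves a Gaussian in y, integrated by
  \<open>nn_integral_exp_quadratic\<close>, times a factor in x - z with variance s + t.\<close>

lemma heat_semigroup:
  assumes "0 < s" "0 < t"
  shows "(\<integral>\<^sup>+ y. ennreal (heat s (x - y)) * ennreal (heat t (y - z)) \<partial>lborel)
    = ennreal (heat (s + t) (x - z :: 'a::euclidean_space))"
proof -
  define n where "n = - (real DIM('a) / 2)"
  define Z where "Z = gauss_mass TYPE('a)"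
  have Z: "Z > 0" using gauss_mass_pos[where 'a='a] by (simp add: Z_def)
  \<comment> \<open>The point y at which |x - y|^2 / s + |y - z|^2 / t is smallest.\<close>
  define w where "w = (t / (s + t)) *\<^sub>R x + (s / (s + t)) *\<^sub>R z"
  define a where "a = (s + t) / (s * t)"
  have a: "a > 0" using assms by (simp add: a_def)
  define C where "C = s powr n * t powr n / Z\<^sup>2 * exp (- (norm (x - z))\<^sup>2 / (s + t))"
  have C: "C \<ge> 0" by (simp add: C_def)
  have key: "(norm (x - y))\<^sup>2 / s + (norm (y - z))\<^sup>2 / t = a * (norm (y - w))\<^sup>2 + (norm (x - z))\<^sup>2 / (s + t)" for y
  proof -
    define p where "p = x - y"
    define q where "q = y - z"
    have st: "s + t \<noteq> 0" "s \<noteq> 0" "t \<noteq> 0" using assms by auto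
    have "y = (t / (s + t)) *\<^sub>R y + (s / (s + t)) *\<^sub>R y"
      using st by (simp add: scaleR_left_distrib[symmetric] add_divide_distrib[symmetric] add.commute)
    then have "y - w = (s / (s + t)) *\<^sub>R q - (t / (s + t)) *\<^sub>R p"
      by (simp add: w_def p_def q_def algebra_simps)
    then have 1: "(norm (y - w))\<^sup>2 = (s/(s+t))\<^sup>2 * (q \<bullet> q) + (t/(s+t))\<^sup>2 * (p \<bullet> p) - 2 * (s/(s+t)) * (t/(s+t)) * (p \<bullet> q)"
      by (simp only: power2_norm_eq_inner inner_diff_left inner_diff_right inner_commute inner_scaleR_left inner_scaleR_right)
         (simp add: power2_eq_square inner_commute algebra_simps)
    have 2: "x - z = p + q" by (simp add: p_def q_def)
    have 3: "(norm (x - z))\<^sup>2 = p \<bullet> p + q \<bullet> q + 2 * (p \<bullet> q)"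
      unfolding 2 by (simp add: power2_norm_eq_inner inner_add inner_commute)
    have "(p \<bullet> p) / s + (q \<bullet> q) / t = a * ((s/(s+t))\<^sup>2 * (q \<bullet> q) + (t/(s+t))\<^sup>2 * (p \<bullet> p) - 2 * (s/(s+t)) * (t/(s+t)) * (p \<bullet> q))
        + (p \<bullet> p + q \<bullet> q + 2 * (p \<bullet> q)) / (s + t)"
      unfolding a_def by (rule complete_square_aux) (use assms in auto)
    then show ?thesis unfolding 1 3 by (simp add: p_def q_def power2_norm_eq_inner)
  qed
  have "heat s (x - y) * heat t (y - z) = C * exp (- a * (norm (y - w))\<^sup>2)" for y
  proof -
    have "heat s (x - y) * heat t (y - z) = s powr n * t powr n / Z\<^sup>2 * exp (- ((norm (x - y))\<^sup>2 / s + (norm (y - z))\<^sup>2 / t))"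
      by (simp add: heat_def n_def Z_def power2_eq_square exp_diff exp_minus field_simps)
    then show ?thesis unfolding key C_def by (simp add: exp_diff exp_minus exp_add field_simps)
  qed
  then have "(\<integral>\<^sup>+ y. ennreal (heat s (x - y)) * ennreal (heat t (y - z)) \<partial>lborel) =
     (\<integral>\<^sup>+ y. ennreal C * ennreal (exp (- a * (norm (y - w))\<^sup>2)) \<partial>lborel)"
    using C by (simp add: ennreal_mult'[symmetric])
  also have "\<dots> = ennreal C * (\<integral>\<^sup>+ y. ennreal (exp (- a * (norm (y - w))\<^sup>2)) \<partial>lborel)"
    by (rule nn_integral_cmult) measurable
  also have "\<dots> = ennreal (C * (a powr n * Z))"
    unfolding nn_integral_exp_quadratic[OF a] n_def Z_def using C by (simp add: ennreal_mult'[symmetric])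
  also have "C * (a powr n * Z) = heat (s + t) (x - z)"
    using assms Z unfolding heat_def C_def n_def[symmetric] Z_def[symmetric] a_def
    by (simp add: powr_divide powr_mult power2_eq_square)
  finally show ?thesis .
qed

section \<open>Riesz potentials as mixtures of heat flows\<close>

text \<open>The common class of Radon measures, Lebesgue measure and measures on the time axis
  within which integrals may be exchanged.\<close>

definition sf_borel :: "'a::euclidean_space measure \<Rightarrow> bool" where
  "sf_borel M \<longleftrightarrow> sigma_finite_measure M \<and> sets M = sets borel"

definition riesz_time :: "real \<Rightarrow> real measure" where
  "riesz_time \<alpha> = density lborel (\<lambda>t. ennreal (t powr (\<alpha> / 2 - 1)) * indicator {0<..} t)"

definition heat_flow :: "real \<Rightarrow> 'a::euclidean_space measure \<Rightarrow> 'a \<Rightarrow> ennreal" where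
  "heat_flow t M x = (\<integral>\<^sup>+ y. ennreal (heat t (x - y)) \<partial>M)"

text \<open>The mixture of heat kernels is radial and homogeneous, so its value at one unit vector,
  here an arbitrary basis vector, fixes the normalisation.\<close>

definition riesz_const :: "real \<Rightarrow> 'a::euclidean_space itself \<Rightarrow> ennreal" where
  "riesz_const \<alpha> _ = inverse (\<integral>\<^sup>+ t. ennreal (heat t (SOME b::'a. b \<in> Basis)) \<partial>riesz_time \<alpha>)"

lemma sf_borelD:
  assumes "sf_borel M"
  shows "sigma_finite_measure M" "sets M = sets borel" "space M = UNIV"
  using assms sets_eq_imp_space_eq[of M borel] by (auto simp: sf_borel_def)

lemma sf_borel_lborel [simp]: "sf_borel lborel"
  by (simp add: sf_borel_def lborel.sigma_finite_measure_axioms)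

lemma sets_riesz_time [measurable_cong, simp]: "sets (riesz_time \<alpha>) = sets borel"
  by (simp add: riesz_time_def)

lemma sf_borel_riesz_time [simp]: "sf_borel (riesz_time \<alpha>)"
  unfolding sf_borel_def
proof
  show "sigma_finite_measure (riesz_time \<alpha>)"
    unfolding riesz_time_def
    by (subst sigma_finite_measure.sigma_finite_iff_density_finite[OF lborel.sigma_finite_measure_axioms])
       (auto simp: ennreal_mult_eq_top_iff indicator_def)
qed simp

lemma nn_integral_riesz_time:
  assumes [measurable]: "f \<in> borel_measurable borel"
  shows "(\<integral>\<^sup>+ t. f t \<partial>riesz_time \<alpha>) = (\<integral>\<^sup>+ t. ennreal (t powr (\<alpha> / 2 - 1)) * indicator {0<..} t * f t \<partial>lborel)"
  unfolding riesz_time_def by (rule nn_integral_density) auto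

lemma AE_riesz_time: "AE t in riesz_time \<alpha>. 0 < t"
  unfolding riesz_time_def by (subst AE_density) (auto simp: indicator_def)

lemma nn_integral_riesz_time_cong:
  assumes "\<And>t. 0 < t \<Longrightarrow> f t = g t"
  shows "(\<integral>\<^sup>+ t. f t \<partial>riesz_time \<alpha>) = (\<integral>\<^sup>+ t. g t \<partial>riesz_time \<alpha>)"
  by (rule nn_integral_cong_AE, use AE_riesz_time in eventually_elim) (auto simp: assms)

lemma nn_integral_riesz_time_mono:
  assumes "\<And>t. 0 < t \<Longrightarrow> f t \<le> g t"
  shows "(\<integral>\<^sup>+ t. f t \<partial>riesz_time \<alpha>) \<le> (\<integral>\<^sup>+ t. g t \<partial>riesz_time \<alpha>)"
  by (rule nn_integral_mono_AE, use AE_riesz_time in eventually_elim) (auto simp: assms)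

text \<open>The measure is t^(\<alpha>/2) dt/t, and dt/t is invariant under dilations.\<close>

lemma riesz_time_scale:
  assumes [measurable]: "f \<in> borel_measurable borel" and r: "0 < r"
  shows "(\<integral>\<^sup>+ t. f t \<partial>riesz_time \<alpha>) = ennreal (r powr (\<alpha> / 2)) * (\<integral>\<^sup>+ t. f (r * t) \<partial>riesz_time \<alpha>)"
proof -
  have "(\<integral>\<^sup>+ t. f t \<partial>riesz_time \<alpha>) =
    ennreal \<bar>r\<bar> * (\<integral>\<^sup>+ t. ennreal ((0 + r * t) powr (\<alpha> / 2 - 1)) * indicator {0<..} (0 + r * t) * f (0 + r * t) \<partial>lborel)"
    using r by (subst nn_integral_riesz_time, simp, subst nn_integral_real_affine[where c=r and t=0]) auto
  also have "(\<integral>\<^sup>+ t. ennreal ((0 + r * t) powr (\<alpha> / 2 - 1)) * indicator {0<..} (0 + r * t) * f (0 + r * t) \<partial>lborel)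
     = (\<integral>\<^sup>+ t. ennreal (r powr (\<alpha> / 2 - 1)) * (ennreal (t powr (\<alpha> / 2 - 1)) * indicator {0<..} t * f (r * t)) \<partial>lborel)"
    using r by (intro nn_integral_cong) (auto simp: indicator_def powr_mult ennreal_mult' mult_ac zero_less_mult_iff)
  also have "\<dots> = ennreal (r powr (\<alpha> / 2 - 1)) * (\<integral>\<^sup>+ t. f (r * t) \<partial>riesz_time \<alpha>)"
    by (subst nn_integral_cmult) (auto simp: nn_integral_riesz_time)
  also have "ennreal \<bar>r\<bar> * \<dots> = ennreal (r * r powr (\<alpha> / 2 - 1)) * (\<integral>\<^sup>+ t. f (r * t) \<partial>riesz_time \<alpha>)"
    using r by (simp add: ennreal_mult' mult.assoc)
  also have "r * r powr (\<alpha> / 2 - 1) = r powr (\<alpha> / 2)"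
    using r by (simp add: powr_mult_base)
  finally show ?thesis .
qed

lemma heat_scale:
  assumes "0 < r"
  shows "heat (r\<^sup>2 * t) (x::'a::euclidean_space) = r powr (- real DIM('a)) * heat t (x /\<^sub>R r)"
proof -
  have "(r\<^sup>2) powr (- (real DIM('a) / 2)) = r powr (- real DIM('a))"
    using assms powr_powr[of r 2 "- (real DIM('a) / 2)"] by (simp add: powr_numeral)
  moreover have "(norm x)\<^sup>2 / (r\<^sup>2 * t) = (norm (x /\<^sub>R r))\<^sup>2 / t"
    using assms by (simp add: power_mult_distrib power_divide divide_simps)
  ultimately show ?thesis
    using assms by (simp add: heat_def powr_mult)
qed

lemma heat_cong_norm: "norm (x::'a::euclidean_space) = norm (y::'a) \<Longrightarrow> heat t x = heat t y"
  by (simp add: heat_def)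

text \<open>Near 0 the factor exp(-1/t) beats any power; on [1, infinity) it is at most 1 and p < -1
  suffices.\<close>

lemma nn_integral_powr_exp_less_top:
  assumes n: "n \<ge> 2" and p: "- real n \<le> p" "p < -1"
  shows "(\<integral>\<^sup>+ t. ennreal (t powr p * exp (- 1 / t)) * indicator {0<..} t \<partial>lborel) < \<infinity>"
proof -
  have small: "t powr p * exp (- 1 / t) \<le> real n ^ n" if t: "0 < t" "t \<le> 1" for t :: real
  proof -
    \<comment> \<open>From exp(1/t) >= (1 + 1/(tn))^n it follows that exp(-1/t) <= (tn)^n, which
      cancels t^p up to the factor n^n.\<close>
    have "(1 / (t * n)) ^ n \<le> (1 + (1/t) / n) ^ n"
      using t n by (intro power_mono) (auto simp: field_simps)
    also have "\<dots> \<le> exp (1/t)"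
      using t n by (intro exp_ge_one_plus_x_over_n_power_n) (auto intro: order_trans[of _ 0])
    finally have "(1 / (t * n)) ^ n \<le> exp (1/t)" .
    then have e: "exp (- 1 / t) \<le> (t * n) ^ n"
      using t n by (simp add: exp_minus power_divide field_simps)
    have "t powr p \<le> t powr (- real n)"
      using t p by (intro powr_mono') auto
    then have "t powr p * exp (- 1 / t) \<le> t powr (- real n) * (t * n) ^ n"
      using e by (intro mult_mono) auto
    also have "\<dots> = real n ^ n"
      using t by (simp add: powr_minus powr_realpow power_mult_distrib field_simps)
    finally show ?thesis .
  qed
  have "((\<lambda>x. x powr p) has_integral - (1 powr (p + 1)) / (p + 1)) {1::real..}"
    using p by (intro has_integral_powr_to_inf) auto
  then have "((\<lambda>x. if x \<in> {1::real..} then x powr p else 0) has_integral - (1 powr (p + 1)) / (p + 1)) UNIV"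
    by (simp only: has_integral_restrict_UNIV)
  moreover have "(\<lambda>x. if x \<in> {1::real..} then x powr p else 0) = (\<lambda>x. x powr p * indicator {1..} x)"
    by (auto simp: indicator_def)
  ultimately have "((\<lambda>x. x powr p * indicator {1::real..} x) has_integral - (1 powr (p + 1)) / (p + 1)) UNIV"
    by simp
  then have big: "(\<integral>\<^sup>+ x. ennreal (x powr p * indicator {1::real..} x) \<partial>lborel) < \<infinity>"
    by (subst nn_integral_has_integral_lborel) auto
  have "(\<integral>\<^sup>+ t. ennreal (t powr p * exp (- 1 / t)) * indicator {0<..} t \<partial>lborel)
     \<le> (\<integral>\<^sup>+ t. ennreal (real n ^ n) * indicator {0..1} t + ennreal (t powr p * indicator {1::real..} t) \<partial>lborel)"
  proof (intro nn_integral_mono)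
    fix t :: real
    show "ennreal (t powr p * exp (- 1 / t)) * indicator {0<..} t
      \<le> ennreal (real n ^ n) * indicator {0..1} t + ennreal (t powr p * indicator {1::real..} t)"
    proof (cases "t \<le> 1")
      case True
      then show ?thesis using small[of t] by (auto simp: indicator_def ennreal_leI add_increasing2)
    next
      case False
      then show ?thesis by (auto simp: indicator_def intro!: ennreal_leI mult_left_le)
    qed
  qed
  also have "\<dots> = ennreal (real n ^ n) * 1 + (\<integral>\<^sup>+ t. ennreal (t powr p * indicator {1::real..} t) \<partial>lborel)"
    by (subst nn_integral_add) (auto simp: nn_integral_cmult_indicator)
  also have "\<dots> < \<infinity>"
    using big by (simp add: power_less_top_ennreal of_nat_less_top)
  finally show ?thesis .
qed

section \<open>Representation of the Riesz kernel by heat kernels\<close>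

locale riesz =
  fixes \<alpha> :: real and dim :: "'a::euclidean_space itself"
  assumes dim3: "3 \<le> DIM('a)" and alpha_pos: "0 < \<alpha>" and alpha_le: "\<alpha> \<le> 2"
begin

lemma heat_integral_unit_less_top:
  assumes "norm (x::'a) = 1"
  shows "(\<integral>\<^sup>+ t. ennreal (heat t x) \<partial>riesz_time \<alpha>) < \<infinity>"
proof -
  let ?p = "\<alpha> / 2 - 1 - real DIM('a) / 2"
  have "(\<integral>\<^sup>+ t. ennreal (heat t x) \<partial>riesz_time \<alpha>)
    = (\<integral>\<^sup>+ t. ennreal (1 / gauss_mass TYPE('a)) * (ennreal (t powr ?p * exp (- 1 / t)) * indicator {0<..} t) \<partial>lborel)"
  proof (subst nn_integral_riesz_time, simp, rule nn_integral_cong)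
    fix t :: real
    have "t powr ?p = t powr (\<alpha> / 2 - 1) * t powr (- (real DIM('a) / 2))"
      by (simp add: powr_add[symmetric])
    then show "ennreal (t powr (\<alpha> / 2 - 1)) * indicator {0<..} t * ennreal (heat t x)
        = ennreal (1 / gauss_mass TYPE('a)) * (ennreal (t powr ?p * exp (- 1 / t)) * indicator {0<..} t)"
      using assms gauss_mass_pos[where 'a='a]
      by (auto simp: heat_def indicator_def ennreal_mult'[symmetric] mult_ac)
  qed
  also have "\<dots> = ennreal (1 / gauss_mass TYPE('a)) * (\<integral>\<^sup>+ t. ennreal (t powr ?p * exp (- 1 / t)) * indicator {0<..} t \<partial>lborel)"
    by (rule nn_integral_cmult) simp
  also have "\<dots> < \<infinity>"
    using nn_integral_powr_exp_less_top[of "DIM('a)" ?p] dim3 alpha_pos alpha_le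
    by (auto simp: ennreal_mult_less_top)
  finally show ?thesis .
qed

lemma heat_integral_pos: "0 < (\<integral>\<^sup>+ t. ennreal (heat t (x::'a)) \<partial>riesz_time \<alpha>)"
proof -
  have "(\<integral>\<^sup>+ t. ennreal (heat t x) \<partial>riesz_time \<alpha>) \<noteq> 0"
  proof
    assume "(\<integral>\<^sup>+ t. ennreal (heat t x) \<partial>riesz_time \<alpha>) = 0"
    then have "AE t in riesz_time \<alpha>. ennreal (heat t x) = 0"
      by (subst (asm) nn_integral_0_iff_AE) auto
    then have "AE t in lborel. 0 < ennreal (t powr (\<alpha> / 2 - 1)) * indicator {0<..} t \<longrightarrow> ennreal (heat t x) = 0"
      unfolding riesz_time_def by (subst (asm) AE_density) auto
    then have "AE t in lborel. t \<le> (0::real)"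
    proof eventually_elim
      fix t :: real
      assume "0 < ennreal (t powr (\<alpha> / 2 - 1)) * indicator {0<..} t \<longrightarrow> ennreal (heat t x) = 0"
      then show "t \<le> 0"
        using heat_pos[of t x] by (cases "0 < t") (auto simp: indicator_def)
    qed
    then have "AE t in lborel. t \<notin> {1..2::real}"
      by eventually_elim auto
    then have "emeasure lborel {1..2::real} = 0"
      by (subst (asm) AE_iff_measurable[of "{1..2}"]) auto
    then show False by simp
  qed
  then show ?thesis by (simp add: zero_less_iff_neq_zero)
qed

text \<open>Substituting r^2 t for t gives r^\<alpha> from the time measure and r^(-n) from the heat
  kernel.\<close>

lemma heat_integral_scale:
  assumes "0 < r"
  shows "(\<integral>\<^sup>+ t. ennreal (heat t (x::'a)) \<partial>riesz_time \<alpha>)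
    = ennreal (r powr (\<alpha> - real DIM('a))) * (\<integral>\<^sup>+ t. ennreal (heat t (x /\<^sub>R r)) \<partial>riesz_time \<alpha>)"
proof -
  have "(\<integral>\<^sup>+ t. ennreal (heat t x) \<partial>riesz_time \<alpha>) = ennreal ((r\<^sup>2) powr (\<alpha> / 2)) * (\<integral>\<^sup>+ t. ennreal (heat (r\<^sup>2 * t) x) \<partial>riesz_time \<alpha>)"
    using assms by (intro riesz_time_scale) auto
  also have "\<dots> = ennreal (r powr \<alpha>) * (ennreal (r powr (- real DIM('a))) * (\<integral>\<^sup>+ t. ennreal (heat t (x /\<^sub>R r)) \<partial>riesz_time \<alpha>))"
    using assms powr_powr[of r 2 "\<alpha>/2"]
    by (subst nn_integral_cmult[symmetric]) (auto simp: heat_scale powr_numeral ennreal_mult')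
  finally show ?thesis
    using assms by (simp add: mult.assoc[symmetric] ennreal_mult'[symmetric] powr_add[symmetric])
qed

lemma unit_basis: "norm (SOME b::'a. b \<in> Basis) = 1"
  by (rule someI2_ex) (auto simp: nonempty_Basis ex_in_conv)

lemma riesz_const_pos: "0 < riesz_const \<alpha> TYPE('a)" "riesz_const \<alpha> TYPE('a) < \<infinity>"
  using heat_integral_unit_less_top[OF unit_basis] heat_integral_pos[of "SOME b::'a. b \<in> Basis"]
  unfolding riesz_const_def by (auto simp: ennreal_inverse_positive less_top[symmetric] ennreal_inverse_eq_top_iff zero_less_iff_neq_zero)

text \<open>Off the diagonal, scale to a unit vector. On the diagonal, scaling fixes the origin, so
  the positive integral equals a proper fraction of itself and must be infinite, in agreement with
  the value set in \<open>riesz_kernel\<close>.\<close>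

lemma riesz_kernel_eq:
  "riesz_kernel \<alpha> x (y::'a) = riesz_const \<alpha> TYPE('a) * (\<integral>\<^sup>+ t. ennreal (heat t (x - y)) \<partial>riesz_time \<alpha>)"
proof (cases "x = y")
  case True
  let ?I = "\<integral>\<^sup>+ t. ennreal (heat t (0::'a)) \<partial>riesz_time \<alpha>"
  have "?I = top"
  proof (rule ccontr)
    assume fin: "?I \<noteq> top"
    then obtain r where r: "0 \<le> r" "?I = ennreal r" by (cases ?I) auto
    have "?I = ennreal (2 powr (\<alpha> - real DIM('a))) * ?I"
      using heat_integral_scale[of 2 0] by simp
    then have "r = 2 powr (\<alpha> - real DIM('a)) * r" using r by (simp add: ennreal_mult'[symmetric])
    moreover have "2 powr (\<alpha> - real DIM('a)) < 1"
      using powr_less_mono[of "\<alpha> - real DIM('a)" 0 2] alpha_le dim3 by simp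
    ultimately have "r = 0" by auto
    with r heat_integral_pos[of 0] show False by simp
  qed
  with True riesz_const_pos show ?thesis by (simp add: riesz_kernel_def ennreal_mult_top)
next
  case False
  let ?r = "norm (x - y)" and ?e = "SOME b::'a. b \<in> Basis"
  let ?I = "\<integral>\<^sup>+ t. ennreal (heat t ?e) \<partial>riesz_time \<alpha>"
  have r: "?r > 0" using False by simp
  have "(\<integral>\<^sup>+ t. ennreal (heat t (x - y)) \<partial>riesz_time \<alpha>) = ennreal (?r powr (\<alpha> - real DIM('a))) * ?I"
    using r by (subst heat_integral_scale[OF r]) (simp add: heat_cong_norm[of "(x - y) /\<^sub>R ?r" ?e] unit_basis)
  moreover have "riesz_const \<alpha> TYPE('a) * ?I = 1"
    using heat_integral_unit_less_top[OF unit_basis] heat_integral_pos[of ?e]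
    unfolding riesz_const_def by (simp add: mult.commute ennreal_divide_self flip: divide_ennreal_def)
  ultimately show ?thesis using False
    by (simp add: riesz_kernel_def mult.left_commute[of "riesz_const \<alpha> TYPE('a)"])
qed

end

section \<open>Exchange of integrals, potentials and energies\<close>

lemma nn_integral_swap:
  assumes M: "sf_borel (M :: 'a::euclidean_space measure)" and N: "sf_borel (N :: 'b::euclidean_space measure)"
    and f: "(\<lambda>(x, y). f x y) \<in> borel_measurable (borel \<Otimes>\<^sub>M borel)"
  shows "(\<integral>\<^sup>+ y. \<integral>\<^sup>+ x. f x y \<partial>M \<partial>N) = (\<integral>\<^sup>+ x. \<integral>\<^sup>+ y. f x y \<partial>N \<partial>M)"
proof (rule pair_sigma_finite.Fubini')
  show "pair_sigma_finite M N"
    using M N by (simp add: pair_sigma_finite_def sf_borel_def)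
  have "sets (M \<Otimes>\<^sub>M N) = sets (borel \<Otimes>\<^sub>M borel)"
    using sf_borelD[OF M] sf_borelD[OF N] by (intro sets_pair_measure_cong) auto
  then show "(\<lambda>(x, y). f x y) \<in> borel_measurable (M \<Otimes>\<^sub>M N)"
    using f by (simp cong: measurable_cong_sets)
qed

lemma sf_borel_borel_measurable_nn_integral:
  assumes M: "sf_borel (M :: 'a::euclidean_space measure)"
    and f: "(\<lambda>(x, y). f x y) \<in> borel_measurable (N \<Otimes>\<^sub>M borel)"
  shows "(\<lambda>x. \<integral>\<^sup>+ y. f x y \<partial>M) \<in> borel_measurable N"
proof (rule sigma_finite_measure.borel_measurable_nn_integral)
  show "sigma_finite_measure M" using M by (rule sf_borelD)
  have "sets (N \<Otimes>\<^sub>M M) = sets (N \<Otimes>\<^sub>M borel)"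
    using sf_borelD[OF M] by (intro sets_pair_measure_cong) auto
  then show "(\<lambda>(x, y). f x y) \<in> borel_measurable (N \<Otimes>\<^sub>M M)"
    using f by (simp cong: measurable_cong_sets)
qed

lemma borel_measurable_heat_flow:
  assumes M: "sf_borel M" and [measurable]: "f \<in> borel_measurable L" "g \<in> borel_measurable L"
  shows "(\<lambda>w. heat_flow (f w) M (g w)) \<in> borel_measurable L"
  unfolding heat_flow_def by (rule sf_borel_borel_measurable_nn_integral[OF M]) measurable

lemma heat_flow_semigroup:
  assumes M: "sf_borel M" and "0 < s" "0 < t"
  shows "(\<integral>\<^sup>+ y. ennreal (heat s (x - y)) * heat_flow t M y \<partial>lborel) = heat_flow (s + t) M x"
proof -
  have m: "(\<lambda>z. ennreal (heat t (y - z))) \<in> borel_measurable M" for y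
    by (subst measurable_cong_sets[OF sf_borelD(2)[OF M] refl]) measurable
  have "(\<integral>\<^sup>+ y. ennreal (heat s (x - y)) * heat_flow t M y \<partial>lborel)
      = (\<integral>\<^sup>+ y. \<integral>\<^sup>+ z. ennreal (heat s (x - y)) * ennreal (heat t (y - z)) \<partial>M \<partial>lborel)"
    by (simp add: heat_flow_def nn_integral_cmult[OF m])
  also have "\<dots> = (\<integral>\<^sup>+ z. \<integral>\<^sup>+ y. ennreal (heat s (x - y)) * ennreal (heat t (y - z)) \<partial>lborel \<partial>M)"
    by (rule nn_integral_swap[symmetric, OF sf_borel_lborel M]) measurable
  also have "\<dots> = heat_flow (s + t) M x"
    by (simp add: heat_semigroup assms heat_flow_def)
  finally show ?thesis .
qed

text \<open>The heat kernel of time s + t is split by the semigroup law and one factor is given to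
  each measure. With s = t this turns the mutual energy into an inner product of L^2.\<close>

lemma nn_integral_heat_flow_add:
  assumes M: "sf_borel M" and N: "sf_borel N" and "0 < s" "0 < t"
  shows "(\<integral>\<^sup>+ x. heat_flow (s + t) M x \<partial>N) = (\<integral>\<^sup>+ z. heat_flow s M z * heat_flow t N z \<partial>lborel)"
proof -
  note [measurable] = borel_measurable_heat_flow[OF M] borel_measurable_heat_flow[OF N]
  have m: "(\<lambda>x. ennreal (heat t (z - x))) \<in> borel_measurable N" for z
    by (subst measurable_cong_sets[OF sf_borelD(2)[OF N] refl]) measurable
  have "(\<integral>\<^sup>+ x. heat_flow (s + t) M x \<partial>N) = (\<integral>\<^sup>+ x. \<integral>\<^sup>+ z. ennreal (heat t (x - z)) * heat_flow s M z \<partial>lborel \<partial>N)"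
    using heat_flow_semigroup[OF M \<open>0 < t\<close> \<open>0 < s\<close>] by (simp add: add.commute)
  also have "\<dots> = (\<integral>\<^sup>+ z. \<integral>\<^sup>+ x. heat_flow s M z * ennreal (heat t (z - x)) \<partial>N \<partial>lborel)"
    by (subst nn_integral_swap[OF sf_borel_lborel N]) (auto simp: heat_minus_commute mult.commute)
  also have "\<dots> = (\<integral>\<^sup>+ z. heat_flow s M z * heat_flow t N z \<partial>lborel)"
    by (simp add: nn_integral_cmult[OF m] heat_flow_def[of t])
  finally show ?thesis .
qed

lemma heat_flow_density_lborel:
  fixes w :: "'a::euclidean_space \<Rightarrow> ennreal"
  assumes [measurable]: "w \<in> borel_measurable borel"
  shows "heat_flow t (density lborel w) x = (\<integral>\<^sup>+ y. ennreal (heat t (x - y)) * w y \<partial>lborel)"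
  unfolding heat_flow_def by (subst nn_integral_density) (auto simp: mult.commute)

lemma sf_borel_density_lborel:
  fixes w :: "'a::euclidean_space \<Rightarrow> ennreal"
  assumes [measurable]: "w \<in> borel_measurable borel" and "AE x in lborel. w x \<noteq> \<infinity>"
  shows "sf_borel (density lborel w)"
  using assms sigma_finite_measure.sigma_finite_iff_density_finite[OF lborel.sigma_finite_measure_axioms, of w]
  by (auto simp: sf_borel_def)

lemma radon_sf_borel:
  assumes "radon M"
  shows "sf_borel M"
proof -
  have s: "sets M = sets borel" "space M = UNIV"
    using assms sets_eq_imp_space_eq[of M borel] by (auto simp: radon_def)
  have "sigma_finite_measure M"
  proof (rule sigma_finite_measure.intro, intro exI conjI)
    show "countable (range (\<lambda>n::nat. cball (0::'a) (real n)))" by simp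
    show "range (\<lambda>n::nat. cball (0::'a) (real n)) \<subseteq> sets M" by (auto simp: s)
    have "\<exists>n::nat. norm x \<le> real n" for x :: 'a by (rule real_arch_simple)
    then show "(\<Union>n::nat. cball (0::'a) (real n)) = space M" by (auto simp: s)
    show "\<forall>a\<in>range (\<lambda>n::nat. cball (0::'a) (real n)). emeasure M a \<noteq> \<infinity>"
      using assms by (auto simp: radon_def less_top[symmetric])
  qed
  with s show ?thesis by (simp add: sf_borel_def)
qed

lemma borel_measurable_riesz_kernel [measurable]:
  "(\<lambda>(x, y). riesz_kernel \<alpha> x y) \<in> borel_measurable (borel \<Otimes>\<^sub>M borel)"
  unfolding riesz_kernel_def by measurable

lemma riesz_kernel_commute: "riesz_kernel \<alpha> x y = riesz_kernel \<alpha> y x"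
  by (simp add: riesz_kernel_def norm_minus_commute)

lemma borel_measurable_potential:
  assumes M: "sf_borel M"
  shows "potential \<alpha> M \<in> borel_measurable borel"
  unfolding potential_def[abs_def] by (rule sf_borel_borel_measurable_nn_integral[OF M]) measurable

lemma mutual_energy_eq_potential:
  assumes M: "sf_borel M" and N: "sf_borel N"
  shows "mutual_energy \<alpha> M N = (\<integral>\<^sup>+ x. potential \<alpha> M x \<partial>N)"
proof -
  interpret N: sigma_finite_measure N using N by (rule sf_borelD)
  have s: "sets (M \<Otimes>\<^sub>M N) = sets (borel \<Otimes>\<^sub>M borel)"
    using sf_borelD[OF M] sf_borelD[OF N] by (intro sets_pair_measure_cong) auto
  have "mutual_energy \<alpha> M N = (\<integral>\<^sup>+ x. \<integral>\<^sup>+ y. riesz_kernel \<alpha> x y \<partial>N \<partial>M)"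
    unfolding mutual_energy_def
    by (subst N.nn_integral_fst[symmetric])
       (simp_all add: measurable_cong_sets[OF s refl] case_prod_beta'[symmetric])
  also have "\<dots> = (\<integral>\<^sup>+ y. \<integral>\<^sup>+ x. riesz_kernel \<alpha> y x \<partial>M \<partial>N)"
    by (subst nn_integral_swap[OF N M]) (auto simp: riesz_kernel_commute case_prod_beta')
  finally show ?thesis by (simp add: potential_def)
qed

lemma mutual_energy_commute:
  assumes M: "sf_borel M" and N: "sf_borel N"
  shows "mutual_energy \<alpha> M N = mutual_energy \<alpha> N M"
  unfolding mutual_energy_eq_potential[OF M N] mutual_energy_eq_potential[OF N M] potential_def
  by (subst nn_integral_swap[OF M N]) (auto simp: riesz_kernel_commute)

context riesz begin

lemma potential_eq_heat_flow:
  assumes M: "sf_borel (M::'a measure)"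
  shows "potential \<alpha> M x = riesz_const \<alpha> TYPE('a) * (\<integral>\<^sup>+ t. heat_flow t M x \<partial>riesz_time \<alpha>)"
proof -
  have [measurable]: "(\<lambda>y. \<integral>\<^sup>+ t. ennreal (heat t (x - y)) \<partial>riesz_time \<alpha>) \<in> borel_measurable M"
    by (subst measurable_cong_sets[OF sf_borelD(2)[OF M] refl], rule sf_borel_borel_measurable_nn_integral) auto
  show ?thesis
    unfolding potential_def riesz_kernel_eq heat_flow_def
    by (subst nn_integral_cmult, simp, subst nn_integral_swap[OF _ M]) auto
qed

lemma mutual_energy_heat_flow:
  assumes M: "sf_borel (M::'a measure)" and N: "sf_borel N"
  shows "mutual_energy \<alpha> M N = riesz_const \<alpha> TYPE('a) *
    (\<integral>\<^sup>+ t. \<integral>\<^sup>+ z. heat_flow (t / 2) M z * heat_flow (t / 2) N z \<partial>lborel \<partial>riesz_time \<alpha>)"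
proof -
  note [measurable] = borel_measurable_heat_flow[OF M] borel_measurable_heat_flow[OF N]
  have [measurable]: "(\<lambda>x. \<integral>\<^sup>+ t. heat_flow t M x \<partial>riesz_time \<alpha>) \<in> borel_measurable N"
    by (subst measurable_cong_sets[OF sf_borelD(2)[OF N] refl], rule sf_borel_borel_measurable_nn_integral) auto
  have "mutual_energy \<alpha> M N = riesz_const \<alpha> TYPE('a) * (\<integral>\<^sup>+ t. \<integral>\<^sup>+ x. heat_flow t M x \<partial>N \<partial>riesz_time \<alpha>)"
    unfolding mutual_energy_eq_potential[OF M N] potential_eq_heat_flow[OF M]
    by (subst nn_integral_cmult, simp, subst nn_integral_swap[OF _ N]) auto
  also have "(\<integral>\<^sup>+ t. \<integral>\<^sup>+ x. heat_flow t M x \<partial>N \<partial>riesz_time \<alpha>)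
    = (\<integral>\<^sup>+ t. \<integral>\<^sup>+ z. heat_flow (t / 2) M z * heat_flow (t / 2) N z \<partial>lborel \<partial>riesz_time \<alpha>)"
    by (rule nn_integral_riesz_time_cong) (simp add: nn_integral_heat_flow_add[OF M N, symmetric])
  finally show ?thesis .
qed

end

section \<open>Linear combinations of measures\<close>

text \<open>Serves both as the dominating sum of two measures and as the competitor in variations
  within the cone; countable additivity is checked in \<open>emeasure_lincomb\<close>.\<close>

definition lincomb :: "ennreal \<Rightarrow> 'a::euclidean_space measure \<Rightarrow> ennreal \<Rightarrow> 'a measure \<Rightarrow> 'a measure" where
  "lincomb a M b N = measure_of UNIV (sets borel) (\<lambda>B. a * emeasure M B + b * emeasure N B)"

lemma sets_lincomb [simp, measurable_cong]: "sets (lincomb a M b N) = sets borel"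
  by (simp add: lincomb_def sigma_algebra.sets_measure_of_eq[OF sets.sigma_algebra_axioms[of borel, simplified]])

lemma space_lincomb [simp]: "space (lincomb a M b N) = UNIV"
  using sets_eq_imp_space_eq[OF sets_lincomb[of a M b N]] by simp

lemma emeasure_lincomb:
  assumes "sets M = sets borel" "sets N = sets borel" "B \<in> sets borel"
  shows "emeasure (lincomb a M b N) B = a * emeasure M B + b * emeasure N B"
proof (rule emeasure_measure_of[OF lincomb_def])
  show "positive (sets (lincomb a M b N)) (\<lambda>B. a * emeasure M B + b * emeasure N B)"
    by (simp add: positive_def)
  show "countably_additive (sets (lincomb a M b N)) (\<lambda>B. a * emeasure M B + b * emeasure N B)"
  proof (rule countably_additiveI)
    fix F :: "nat \<Rightarrow> 'a set" assume F: "range F \<subseteq> sets (lincomb a M b N)" "disjoint_family F"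
    then show "(\<Sum>i. a * emeasure M (F i) + b * emeasure N (F i)) = a * emeasure M (\<Union> (range F)) + b * emeasure N (\<Union> (range F))"
      using assms suminf_emeasure[of F M] suminf_emeasure[of F N]
      by (simp add: suminf_add[symmetric] ennreal_suminf_cmult)
  qed
qed (use assms in auto)

lemma nn_integral_lincomb:
  assumes M: "sets M = sets borel" and N: "sets N = sets borel" and f: "f \<in> borel_measurable borel"
  shows "(\<integral>\<^sup>+ x. f x \<partial>lincomb a M b N) = a * (\<integral>\<^sup>+ x. f x \<partial>M) + b * (\<integral>\<^sup>+ x. f x \<partial>N)"
  using f
proof (induction rule: borel_measurable_induct)
  case (cong f g) then show ?case
    using sets_eq_imp_space_eq[OF M] sets_eq_imp_space_eq[OF N] by (simp cong: nn_integral_cong_simp)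
next
  case (set A) then show ?case using M N by (simp add: emeasure_lincomb)
next
  case (mult u c)
  moreover from mult have "u \<in> borel_measurable M" "u \<in> borel_measurable N"
    by (auto simp: measurable_cong_sets[OF M refl] measurable_cong_sets[OF N refl])
  ultimately show ?case
    by (simp add: nn_integral_cmult distrib_left mult_ac)
next
  case (add u v)
  moreover from add have "u \<in> borel_measurable M" "u \<in> borel_measurable N" "v \<in> borel_measurable M" "v \<in> borel_measurable N"
    by (auto simp: measurable_cong_sets[OF M refl] measurable_cong_sets[OF N refl])
  ultimately show ?case
    by (simp add: nn_integral_add distrib_left ac_simps)
next
  case (seq U)
  then have [measurable]: "U i \<in> borel_measurable M" "U i \<in> borel_measurable N" for i
    by (auto simp: measurable_cong_sets[OF M refl] measurable_cong_sets[OF N refl])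
  have inc: "incseq (\<lambda>i. c * integral\<^sup>N L (U i))" for c and L :: "'a measure"
    using seq by (auto simp: incseq_def le_fun_def intro!: mult_left_mono nn_integral_mono)
  have "(\<integral>\<^sup>+ x. (SUP i. U i x) \<partial>lincomb a M b N) = (SUP i. a * integral\<^sup>N M (U i) + b * integral\<^sup>N N (U i))"
    using seq by (subst nn_integral_monotone_convergence_SUP) auto
  also have "\<dots> = (SUP i. a * integral\<^sup>N M (U i)) + (SUP i. b * integral\<^sup>N N (U i))"
    by (rule ennreal_SUP_add) (use inc in auto)
  also have "\<dots> = a * (\<integral>\<^sup>+ x. (SUP i. U i x) \<partial>M) + b * (\<integral>\<^sup>+ x. (SUP i. U i x) \<partial>N)"
    using seq by (simp add: nn_integral_monotone_convergence_SUP SUP_mult_left_ennreal)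
  finally show ?case by (simp add: SUP_apply[abs_def] image_comp)
qed

lemma radon_lincomb:
  assumes "radon M" "radon N" "a < \<infinity>" "b < \<infinity>"
  shows "radon (lincomb a M b N)"
  using assms by (auto simp: radon_def emeasure_lincomb compact_imp_closed ennreal_mult_less_top)

section \<open>The renewal identity\<close>

lemma nn_integral_Beta:
  assumes "0 < a" "0 < b"
  shows "(\<integral>\<^sup>+ y. ennreal (y powr (a - 1) * (1 - y) powr (b - 1)) * indicator {0..1} y \<partial>lborel) = ennreal (Beta a b)"
proof -
  have "((\<lambda>y. if y \<in> {0..1} then y powr (a - 1) * (1 - y) powr (b - 1) else 0) has_integral Beta a b) UNIV"
    using has_integral_Beta_real[OF assms] by (simp only: has_integral_restrict_UNIV)
  then have "(\<integral>\<^sup>+ y. ennreal (if y \<in> {0..1} then y powr (a - 1) * (1 - y) powr (b - 1) else 0) \<partial>lborel) = ennreal (Beta a b)"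
    by (intro nn_integral_has_integral_lborel) auto
  then show ?thesis
    by (rule trans[rotated]) (auto intro!: nn_integral_cong simp: indicator_def)
qed

text \<open>With position -1/x both differences become linear in x divided by -x; the remaining
  powers of -1/x have exponents -1, -b, b - 1 and 2, which sum to 0.\<close>

lemma renewal_integrand:
  fixes b r u x :: real
  assumes b: "0 < b" "b < 1" and r: "0 < r" "r < u" and x: "x \<in> {- 1 / r .. - 1 / u}"
  shows "((- 1 / x) powr (- 1) * ((- 1 / x) - r) powr (- b) * (u - (- 1 / x)) powr (b - 1)) * (1 / x\<^sup>2)
    = (- u * x - 1) powr (b - 1) * (1 + r * x) powr (- b)"
proof -
  define s where "s = - x"
  have s: "0 < s" "1 / u \<le> s" "s \<le> 1 / r"
  proof -
    have "0 < u" using r by linarith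
    then have u: "1 / u > 0" by simp
    have "- (1 / r) \<le> x" "x \<le> - (1 / u)" using x by simp_all
    with u show "0 < s" "1 / u \<le> s" "s \<le> 1 / r" unfolding s_def by linarith+
  qed
  have nn: "0 \<le> u * s - 1" "0 \<le> 1 - r * s"
    using s r by (auto simp: field_simps)
  have x': "x = - s" by (simp add: s_def)
  have e1: "(1 / s - r) = (1 - r * s) / s" "(u - 1 / s) = (u * s - 1) / s"
    using s by (auto simp: field_simps)
  have "((1 / s) powr (- 1) * (1 / s - r) powr (- b) * (u - 1 / s) powr (b - 1)) * (1 / s\<^sup>2)
     = (u * s - 1) powr (b - 1) * (1 - r * s) powr (- b) * ((1 / s) powr (- 1) * (1 / s) powr (- b) * (1 / s) powr (b - 1) * (1 / s) powr 2)"
    unfolding e1 using nn s by (simp add: powr_divide power_divide powr_numeral)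
  also have "(1 / s) powr (- 1) * (1 / s) powr (- b) * (1 / s) powr (b - 1) * (1 / s) powr 2 = (1 / s) powr 0"
    using s by (simp only: powr_add[symmetric]) (simp add: algebra_simps)
  finally show ?thesis using s unfolding x' by simp
qed

text \<open>The inversion s = -1/x makes the three powers a product of two linear ones, and an
  affine map of the interval onto [0,1] then gives a Beta integral.\<close>

lemma renewal_Beta:
  fixes b r u :: real
  assumes b: "0 < b" "b < 1" and r: "0 < r" "r < u"
  shows "(\<integral>\<^sup>+ s. ennreal (s powr (- 1) * (s - r) powr (- b) * (u - s) powr (b - 1)) * indicator {r..u} s \<partial>lborel)
    = ennreal (u powr (b - 1) * r powr (- b) * Beta b (1 - b))"
proof -
  define c where "c = 1 / r - 1 / u"
  have c: "c > 0" using r by (simp add: c_def frac_less2)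
  have "(\<integral>\<^sup>+ s. ennreal (s powr (- 1) * (s - r) powr (- b) * (u - s) powr (b - 1)) * indicator {r..u} s \<partial>lborel)
    = (\<integral>\<^sup>+ s. ennreal (s powr (- 1) * (s - r) powr (- b) * (u - s) powr (b - 1)) * indicator {- 1 / (- 1 / r)..- 1 / (- 1 / u)} s \<partial>lborel)"
    by simp
  also have "\<dots> = (\<integral>\<^sup>+ x. ennreal ((- 1 / x) powr (- 1) * ((- 1 / x) - r) powr (- b) * (u - (- 1 / x)) powr (b - 1)) * ennreal (1 / x\<^sup>2) * indicator {- 1 / r .. - 1 / u} x \<partial>lborel)"
  proof (rule nn_integral_substitution_aux)
    fix x assume "x \<in> {- 1 / r .. - 1 / u}"
    then have "x < 0" using r by (auto intro: le_less_trans)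
    then show "((\<lambda>x. - 1 / x) has_real_derivative 1 / x\<^sup>2) (at x)"
      by (auto intro!: derivative_eq_intros simp: power2_eq_square)
  next
    show "continuous_on {- 1 / r .. - 1 / u} (\<lambda>x. 1 / x\<^sup>2)"
      using r by (intro continuous_intros) (auto simp: divide_less_0_iff dest: order.trans)
    show "- 1 / r < - 1 / u" using c by (simp add: c_def)
  qed auto
  also have "\<dots> = (\<integral>\<^sup>+ x. ennreal ((- u * x - 1) powr (b - 1) * (1 + r * x) powr (- b)) * indicator {- 1 / r .. - 1 / u} x \<partial>lborel)"
  proof (intro nn_integral_cong)
    fix x :: real
    show "ennreal ((- 1 / x) powr (- 1) * ((- 1 / x) - r) powr (- b) * (u - (- 1 / x)) powr (b - 1)) * ennreal (1 / x\<^sup>2) * indicator {- 1 / r .. - 1 / u} x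
      = ennreal ((- u * x - 1) powr (b - 1) * (1 + r * x) powr (- b)) * indicator {- 1 / r .. - 1 / u} x"
    proof (cases "x \<in> {- 1 / r .. - 1 / u}")
      case True
      show ?thesis
        by (subst ennreal_mult''[symmetric], simp) (simp only: renewal_integrand[OF b r True])
    qed (simp only: indicator_simps(2) not_False_eq_True mult_zero_right)
  qed
  \<comment> \<open>The substitution x = -1/u - c y reverses orientation: y = 0 is the end -1/u and
    y = 1 the end -1/r.\<close>
  also have "\<dots> = ennreal \<bar>- c\<bar> * (\<integral>\<^sup>+ y. ennreal ((- u * (- 1 / u + (- c) * y) - 1) powr (b - 1) * (1 + r * (- 1 / u + (- c) * y)) powr (- b)) * indicator {- 1 / r .. - 1 / u} (- 1 / u + (- c) * y) \<partial>lborel)"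
    using c by (intro nn_integral_real_affine) auto
  also have "\<dots> = ennreal c * (\<integral>\<^sup>+ y. ennreal ((u * c) powr (b - 1) * (r * c) powr (- b)) * (ennreal (y powr (b - 1) * (1 - y) powr ((1 - b) - 1)) * indicator {0..1} y) \<partial>lborel)"
  proof -
    have ind: "- 1 / u + (- c) * y \<in> {- 1 / r .. - 1 / u} \<longleftrightarrow> y \<in> {0..1}" for y
    proof -
      have "- 1 / r = - 1 / u + (- c) * 1" by (simp add: c_def)
      then have "- 1 / u + (- c) * y \<in> {- 1 / r .. - 1 / u} \<longleftrightarrow> c * y \<le> c * 1 \<and> c * 0 \<le> c * y" by auto
      also have "\<dots> \<longleftrightarrow> y \<in> {0..1}" using c by (simp only: mult_le_cancel_left_pos) auto
      finally show ?thesis .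
    qed
    have e1: "- u * (- 1 / u + (- c) * y) - 1 = (u * c) * y" for y using r by (simp add: field_simps)
    have e2: "1 + r * (- 1 / u + (- c) * y) = (r * c) * (1 - y)" for y using r by (simp add: c_def field_simps)
    have "ennreal (((u * c) * y) powr (b - 1) * ((r * c) * (1 - y)) powr (- b)) * indicator {0..1} y =
      ennreal ((u * c) powr (b - 1) * (r * c) powr (- b)) * (ennreal (y powr (b - 1) * (1 - y) powr ((1 - b) - 1)) * indicator {0..1} y)" for y
      using c r by (cases "y \<in> {0..1}") (auto simp: powr_mult ennreal_mult'[symmetric] mult_ac)
    moreover have "indicator {- 1 / r .. - 1 / u} (- 1 / u + (- c) * y) = (indicator {0..1} y :: ennreal)" for y
      unfolding indicator_def using ind[of y] by simp
    ultimately show ?thesis using c by (simp only: e1 e2) simp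
  qed
  also have "\<dots> = ennreal c * (ennreal ((u * c) powr (b - 1) * (r * c) powr (- b)) * ennreal (Beta b (1 - b)))"
    using nn_integral_Beta[of b "1 - b"] b by (subst nn_integral_cmult) auto
  also have "\<dots> = ennreal (c * ((u * c) powr (b - 1) * (r * c) powr (- b)) * Beta b (1 - b))"
    using c by (simp add: ennreal_mult'[symmetric] ennreal_mult''[symmetric] mult.assoc)
  also have "c * ((u * c) powr (b - 1) * (r * c) powr (- b)) = u powr (b - 1) * r powr (- b) * (c powr 1 * c powr (b - 1) * c powr (- b))"
    using c r by (simp add: powr_mult)
  also have "c powr 1 * c powr (b - 1) * c powr (- b) = c powr 0"
    by (simp only: powr_add[symmetric]) simp
  finally show ?thesis using c by simp
qed

lemma nn_integral_lborel_translate: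
  assumes [measurable]: "f \<in> borel_measurable borel"
  shows "(\<integral>\<^sup>+ t. f (s + t) \<partial>lborel) = (\<integral>\<^sup>+ t. f (t :: real) \<partial>lborel)"
  using nn_integral_real_affine[of f 1 s] by simp

text \<open>For \<open>\<alpha> < 2\<close> the measure \<open>F\<close> is, up to normalisation, the law of the position at which the
  stable subordinator of index \<open>\<alpha> / 2\<close> jumps over the level \<open>r\<close>; for \<open>\<alpha> = 2\<close> the subordinator is
  the deterministic drift and \<open>F\<close> is the point mass at \<open>r\<close>.\<close>

lemma riesz_time_renewal:
  assumes alpha: "0 < \<alpha>" "\<alpha> \<le> 2" and r: "0 < r"
  obtains F where "sf_borel F" "AE s in F. r \<le> s"
    "\<And>h. h \<in> borel_measurable borel \<Longrightarrow> (\<integral>\<^sup>+ t. h t \<partial>riesz_time \<alpha>)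
      = (\<integral>\<^sup>+ t. h t * indicator {..r} t \<partial>riesz_time \<alpha>) + (\<integral>\<^sup>+ s. \<integral>\<^sup>+ t. h (s + t) \<partial>riesz_time \<alpha> \<partial>F)"
proof (cases "\<alpha> = 2")
  case True
  \<comment> \<open>Here \<open>riesz_time\<close> is Lebesgue measure on the positive axis, and the
    identity is translation by r.\<close>
  show ?thesis
  proof (rule that)
    interpret prob_space "return borel r" by (rule prob_space_return) simp
    show "sf_borel (return borel r)"
      by (simp add: sf_borel_def sigma_finite_measure_axioms)
    show "AE s in return borel r. r \<le> s"
      by (subst AE_return) auto
    fix h :: "real \<Rightarrow> ennreal" assume [measurable]: "h \<in> borel_measurable borel"
    have "(\<integral>\<^sup>+ s. \<integral>\<^sup>+ t. h (s + t) \<partial>riesz_time \<alpha> \<partial>return borel r) = (\<integral>\<^sup>+ t. h (r + t) \<partial>riesz_time \<alpha>)"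
      by (rule nn_integral_return) (auto intro!: sf_borel_borel_measurable_nn_integral)
    also have "\<dots> = (\<integral>\<^sup>+ t. indicator {r<..} (r + t) * h (r + t) \<partial>lborel)"
      by (subst nn_integral_riesz_time) (auto intro!: nn_integral_cong simp: True indicator_def)
    also have "\<dots> = (\<integral>\<^sup>+ t. indicator {r<..} t * h t \<partial>lborel)"
      by (rule nn_integral_lborel_translate) measurable
    finally have 1: "(\<integral>\<^sup>+ s. \<integral>\<^sup>+ t. h (s + t) \<partial>riesz_time \<alpha> \<partial>return borel r) = \<dots>" .
    have "(\<integral>\<^sup>+ t. h t \<partial>riesz_time \<alpha>) = (\<integral>\<^sup>+ t. ennreal (t powr (\<alpha> / 2 - 1)) * indicator {0<..} t * (h t * indicator {..r} t) + indicator {r<..} t * h t \<partial>lborel)"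
      using r by (subst nn_integral_riesz_time) (auto intro!: nn_integral_cong simp: True indicator_def)
    then show "(\<integral>\<^sup>+ t. h t \<partial>riesz_time \<alpha>) = (\<integral>\<^sup>+ t. h t * indicator {..r} t \<partial>riesz_time \<alpha>)
        + (\<integral>\<^sup>+ s. \<integral>\<^sup>+ t. h (s + t) \<partial>riesz_time \<alpha> \<partial>return borel r)"
      unfolding 1 by (subst (2) nn_integral_riesz_time) (auto simp: nn_integral_add)
  qed
next
  case False
  define b where "b = \<alpha> / 2"
  have b: "0 < b" "b < 1" using False alpha by (auto simp: b_def)
  \<comment> \<open>Normalised so that, by \<open>renewal_Beta\<close>, the convolution below equals
    u^(b-1) with constant 1.\<close>
  define C where "C = r powr b / Beta b (1 - b)"
  have B: "0 < Beta b (1 - b)" using b by (simp add: Beta_def Gamma_real_pos)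
  define \<phi> where "\<phi> s = ennreal (C * s powr (- 1) * (s - r) powr (- b)) * indicator {r<..} s" for s
  have [measurable]: "\<phi> \<in> borel_measurable borel" unfolding \<phi>_def by measurable
  \<comment> \<open>The heart of the matter: convolving the jump density with t^(b-1) returns
    t^(b-1) cut off to t > r.\<close>
  have inner: "(\<integral>\<^sup>+ s. \<phi> s * (ennreal ((u - s) powr (b - 1)) * indicator {0<..} (u - s)) \<partial>lborel)
      = ennreal (u powr (b - 1)) * indicator {r<..} u" for u
  proof (cases "r < u")
    case True
    have "(\<integral>\<^sup>+ s. \<phi> s * (ennreal ((u - s) powr (b - 1)) * indicator {0<..} (u - s)) \<partial>lborel)
      = (\<integral>\<^sup>+ s. ennreal C * (ennreal (s powr (- 1) * (s - r) powr (- b) * (u - s) powr (b - 1)) * indicator {r..u} s) \<partial>lborel)"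
      using B b r by (intro nn_integral_cong)
        (auto simp: \<phi>_def C_def indicator_def ennreal_mult'[symmetric] ennreal_mult''[symmetric] mult_ac)
    also have "\<dots> = ennreal C * ennreal (u powr (b - 1) * r powr (- b) * Beta b (1 - b))"
      by (subst nn_integral_cmult, measurable) (simp only: renewal_Beta[OF b r True])
    also have "\<dots> = ennreal (u powr (b - 1))"
      using B r by (simp add: C_def ennreal_mult'[symmetric] powr_minus field_simps)
    finally show ?thesis using True by simp
  next
    case False
    then have z: "\<phi> s * (ennreal ((u - s) powr (b - 1)) * indicator {0<..} (u - s)) = 0" for s
      by (auto simp: \<phi>_def indicator_def)
    show ?thesis unfolding z using False by simp
  qed
  show ?thesis
  proof (rule that)
    show "sf_borel (density lborel \<phi>)"
      by (rule sf_borel_density_lborel) (auto simp: \<phi>_def indicator_def)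
    show "AE s in density lborel \<phi>. r \<le> s"
      by (subst AE_density) (auto simp: \<phi>_def indicator_def)
    fix h :: "real \<Rightarrow> ennreal" assume [measurable]: "h \<in> borel_measurable borel"
    have tr: "(\<integral>\<^sup>+ t. h (s + t) \<partial>riesz_time \<alpha>) = (\<integral>\<^sup>+ u. ennreal ((u - s) powr (b - 1)) * indicator {0<..} (u - s) * h u \<partial>lborel)" for s
      using nn_integral_lborel_translate[of "\<lambda>u. ennreal ((u - s) powr (b - 1)) * indicator {0<..} (u - s) * h u" s]
      by (subst nn_integral_riesz_time) (auto simp: b_def)
    have "(\<integral>\<^sup>+ s. \<integral>\<^sup>+ t. h (s + t) \<partial>riesz_time \<alpha> \<partial>density lborel \<phi>)
      = (\<integral>\<^sup>+ s. \<integral>\<^sup>+ u. \<phi> s * (ennreal ((u - s) powr (b - 1)) * indicator {0<..} (u - s) * h u) \<partial>lborel \<partial>lborel)"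
      unfolding tr by (subst nn_integral_density) (auto simp: nn_integral_cmult)
    also have "\<dots> = (\<integral>\<^sup>+ u. \<integral>\<^sup>+ s. h u * (\<phi> s * (ennreal ((u - s) powr (b - 1)) * indicator {0<..} (u - s))) \<partial>lborel \<partial>lborel)"
      by (subst nn_integral_swap) (auto simp: mult_ac)
    also have "\<dots> = (\<integral>\<^sup>+ u. h u * (ennreal (u powr (b - 1)) * indicator {r<..} u) \<partial>lborel)"
      by (simp add: nn_integral_cmult inner)
    finally have 1: "(\<integral>\<^sup>+ s. \<integral>\<^sup>+ t. h (s + t) \<partial>riesz_time \<alpha> \<partial>density lborel \<phi>) = \<dots>" .
    have "(\<integral>\<^sup>+ t. h t \<partial>riesz_time \<alpha>) = (\<integral>\<^sup>+ t. ennreal (t powr (\<alpha> / 2 - 1)) * indicator {0<..} t * (h t * indicator {..r} t) + h t * (ennreal (t powr (b - 1)) * indicator {r<..} t) \<partial>lborel)"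
      using r by (subst nn_integral_riesz_time) (auto intro!: nn_integral_cong simp: b_def indicator_def mult_ac)
    then show "(\<integral>\<^sup>+ t. h t \<partial>riesz_time \<alpha>) = (\<integral>\<^sup>+ t. h t * indicator {..r} t \<partial>riesz_time \<alpha>)
        + (\<integral>\<^sup>+ s. \<integral>\<^sup>+ t. h (s + t) \<partial>riesz_time \<alpha> \<partial>density lborel \<phi>)"
      unfolding 1 by (subst (2) nn_integral_riesz_time) (auto simp: nn_integral_add)
  qed
qed

section \<open>Mixtures of heat operators\<close>

text \<open>The counterpart of \<open>heat_flow\<close> for functions; it admits infinite values,
  for which \<open>density lborel w\<close> need not be sigma-finite.\<close>

definition heat_fun :: "real \<Rightarrow> ('a::euclidean_space \<Rightarrow> ennreal) \<Rightarrow> 'a \<Rightarrow> ennreal" where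
  "heat_fun t w x = (\<integral>\<^sup>+ y. ennreal (heat t (x - y)) * w y \<partial>lborel)"

definition heat_fun_mix :: "real measure \<Rightarrow> ('a::euclidean_space \<Rightarrow> ennreal) \<Rightarrow> 'a \<Rightarrow> ennreal" where
  "heat_fun_mix F w x = (\<integral>\<^sup>+ t. heat_fun t w x \<partial>F)"

definition heat_mix :: "real measure \<Rightarrow> 'a::euclidean_space measure \<Rightarrow> 'a \<Rightarrow> ennreal" where
  "heat_mix F M x = (\<integral>\<^sup>+ t. heat_flow t M x \<partial>F)"

lemma borel_measurable_heat_fun [measurable]:
  assumes [measurable]: "w \<in> borel_measurable borel" "f \<in> borel_measurable L" "g \<in> borel_measurable L"
  shows "(\<lambda>z. heat_fun (f z) w (g z)) \<in> borel_measurable L"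
  unfolding heat_fun_def by (rule sf_borel_borel_measurable_nn_integral[OF sf_borel_lborel]) measurable

lemma borel_measurable_heat_fun_mix:
  assumes F: "sf_borel F" and [measurable]: "w \<in> borel_measurable borel"
  shows "heat_fun_mix F w \<in> borel_measurable borel"
  unfolding heat_fun_mix_def[abs_def] by (rule sf_borel_borel_measurable_nn_integral[OF F]) measurable

lemma borel_measurable_heat_mix:
  assumes F: "sf_borel F" and M: "sf_borel M"
  shows "heat_mix F M \<in> borel_measurable borel"
proof -
  note [measurable] = borel_measurable_heat_flow[OF M]
  show ?thesis
    unfolding heat_mix_def[abs_def] by (rule sf_borel_borel_measurable_nn_integral[OF F]) measurable
qed

lemma heat_fun_mono:
  assumes "\<And>y. w y \<le> w' y"
  shows "heat_fun t w x \<le> heat_fun t w' x"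
  unfolding heat_fun_def by (intro nn_integral_mono mult_left_mono assms) simp

lemma heat_fun_mix_mono:
  assumes "\<And>y. w y \<le> w' y"
  shows "heat_fun_mix F w x \<le> heat_fun_mix F w' x"
  unfolding heat_fun_mix_def by (intro nn_integral_mono heat_fun_mono assms)

lemma heat_fun_add:
  assumes [measurable]: "w \<in> borel_measurable borel" "w' \<in> borel_measurable borel"
  shows "heat_fun t (\<lambda>y. w y + w' y) x = heat_fun t w x + heat_fun t w' x"
  unfolding heat_fun_def by (simp add: distrib_left nn_integral_add)

lemma sf_borel_measurable1:
  "sf_borel F \<Longrightarrow> f \<in> borel_measurable borel \<Longrightarrow> f \<in> borel_measurable F"
  using measurable_cong_sets[OF sf_borelD(2) refl] by blast

lemma heat_fun_mix_add:
  assumes F: "sf_borel F" and [measurable]: "w \<in> borel_measurable borel" "w' \<in> borel_measurable borel"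
  shows "heat_fun_mix F (\<lambda>y. w y + w' y) x = heat_fun_mix F w x + heat_fun_mix F w' x"
proof -
  have [measurable]: "(\<lambda>t. heat_fun t w x) \<in> borel_measurable F" "(\<lambda>t. heat_fun t w' x) \<in> borel_measurable F"
    by (auto intro!: sf_borel_measurable1[OF F])
  show ?thesis unfolding heat_fun_mix_def by (simp add: heat_fun_add nn_integral_add)
qed

lemma heat_fun_cmult:
  assumes [measurable]: "w \<in> borel_measurable borel"
  shows "heat_fun t (\<lambda>y. c * w y) x = c * heat_fun t w x"
  unfolding heat_fun_def by (simp add: mult.left_commute[of _ c] nn_integral_cmult)

lemma heat_fun_mix_cmult:
  assumes F: "sf_borel F" and [measurable]: "w \<in> borel_measurable borel"
  shows "heat_fun_mix F (\<lambda>y. c * w y) x = c * heat_fun_mix F w x"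
  unfolding heat_fun_mix_def by (simp add: heat_fun_cmult nn_integral_cmult sf_borel_measurable1[OF F])

lemma heat_fun_heat_flow:
  assumes "sf_borel M" "0 < s" "0 < t"
  shows "heat_fun s (heat_flow t M) x = heat_flow (s + t) M x"
  unfolding heat_fun_def by (rule heat_flow_semigroup[OF assms])

lemma heat_fun_semigroup:
  assumes [measurable]: "w \<in> borel_measurable borel" and st: "0 < s" "0 < t"
  shows "heat_fun s (heat_fun t w) x = heat_fun (s + t) w x"
proof -
  have "heat_fun s (heat_fun t w) x = (\<integral>\<^sup>+ y. \<integral>\<^sup>+ z. ennreal (heat s (x - y)) * (ennreal (heat t (y - z)) * w z) \<partial>lborel \<partial>lborel)"
    unfolding heat_fun_def by (simp add: nn_integral_cmult)
  also have "\<dots> = (\<integral>\<^sup>+ z. \<integral>\<^sup>+ y. (ennreal (heat s (x - y)) * ennreal (heat t (y - z))) * w z \<partial>lborel \<partial>lborel)"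
    by (subst nn_integral_swap) (auto simp: mult.assoc)
  also have "\<dots> = heat_fun (s + t) w x"
    by (simp add: nn_integral_multc heat_semigroup st heat_fun_def)
  finally show ?thesis .
qed

lemma nn_integral_heat_fun_commute:
  assumes [measurable]: "w \<in> borel_measurable borel" "w' \<in> borel_measurable borel"
  shows "(\<integral>\<^sup>+ x. heat_fun t w x * w' x \<partial>lborel) = (\<integral>\<^sup>+ x. w x * heat_fun t w' x \<partial>lborel)"
proof -
  have "(\<integral>\<^sup>+ x. heat_fun t w x * w' x \<partial>lborel) = (\<integral>\<^sup>+ x. \<integral>\<^sup>+ y. ennreal (heat t (x - y)) * w y * w' x \<partial>lborel \<partial>lborel)"
    unfolding heat_fun_def by (simp add: nn_integral_multc)
  also have "\<dots> = (\<integral>\<^sup>+ y. \<integral>\<^sup>+ x. w y * (ennreal (heat t (y - x)) * w' x) \<partial>lborel \<partial>lborel)"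
    by (subst nn_integral_swap) (auto simp: mult_ac heat_minus_commute)
  also have "\<dots> = (\<integral>\<^sup>+ x. w x * heat_fun t w' x \<partial>lborel)"
    unfolding heat_fun_def by (simp add: nn_integral_cmult)
  finally show ?thesis .
qed

lemma nn_integral_heat_fun_measure:
  assumes M: "sf_borel M" and [measurable]: "w \<in> borel_measurable borel"
  shows "(\<integral>\<^sup>+ x. heat_fun t w x \<partial>M) = (\<integral>\<^sup>+ x. w x * heat_flow t M x \<partial>lborel)"
proof -
  have m: "(\<lambda>y. ennreal (heat t (x - y))) \<in> borel_measurable M" for x
    by (rule sf_borel_measurable1[OF M]) measurable
  have "(\<integral>\<^sup>+ x. heat_fun t w x \<partial>M) = (\<integral>\<^sup>+ y. \<integral>\<^sup>+ x. w y * ennreal (heat t (y - x)) \<partial>M \<partial>lborel)"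
    unfolding heat_fun_def by (subst nn_integral_swap[OF _ M]) (auto simp: mult_ac heat_minus_commute)
  also have "\<dots> = (\<integral>\<^sup>+ x. w x * heat_flow t M x \<partial>lborel)"
    unfolding heat_flow_def by (simp add: nn_integral_cmult[OF m])
  finally show ?thesis .
qed

lemma nn_integral_heat_fun_mix_commute:
  assumes F: "sf_borel F" and [measurable]: "w \<in> borel_measurable borel" "w' \<in> borel_measurable borel"
  shows "(\<integral>\<^sup>+ x. heat_fun_mix F w x * w' x \<partial>lborel) = (\<integral>\<^sup>+ x. w x * heat_fun_mix F w' x \<partial>lborel)"
proof -
  have m: "(\<lambda>t. heat_fun t w x) \<in> borel_measurable F" "(\<lambda>t. heat_fun t w' x) \<in> borel_measurable F" for x
    by (auto intro!: sf_borel_measurable1[OF F])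
  have "(\<integral>\<^sup>+ x. heat_fun_mix F w x * w' x \<partial>lborel) = (\<integral>\<^sup>+ t. \<integral>\<^sup>+ x. heat_fun t w x * w' x \<partial>lborel \<partial>F)"
    unfolding heat_fun_mix_def by (subst nn_integral_swap[OF _ F]) (auto simp: nn_integral_multc m)
  also have "\<dots> = (\<integral>\<^sup>+ t. \<integral>\<^sup>+ x. w x * heat_fun t w' x \<partial>lborel \<partial>F)"
    by (simp add: nn_integral_heat_fun_commute)
  also have "\<dots> = (\<integral>\<^sup>+ x. w x * heat_fun_mix F w' x \<partial>lborel)"
    unfolding heat_fun_mix_def by (subst nn_integral_swap[OF _ F]) (auto simp: nn_integral_cmult m)
  finally show ?thesis .
qed

lemma nn_integral_heat_fun_mix_measure:
  assumes F: "sf_borel F" and M: "sf_borel M" and [measurable]: "w \<in> borel_measurable borel"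
  shows "(\<integral>\<^sup>+ x. heat_fun_mix F w x \<partial>M) = (\<integral>\<^sup>+ x. w x * heat_mix F M x \<partial>lborel)"
proof -
  note [measurable] = borel_measurable_heat_flow[OF M]
  have m: "(\<lambda>t. heat_flow t M x) \<in> borel_measurable F" for x
    by (rule sf_borel_measurable1[OF F]) measurable
  have "(\<integral>\<^sup>+ x. heat_fun_mix F w x \<partial>M) = (\<integral>\<^sup>+ t. \<integral>\<^sup>+ x. heat_fun t w x \<partial>M \<partial>F)"
    unfolding heat_fun_mix_def by (subst nn_integral_swap[OF M F]) auto
  also have "\<dots> = (\<integral>\<^sup>+ x. w x * heat_mix F M x \<partial>lborel)"
    unfolding heat_mix_def nn_integral_heat_fun_measure[OF M assms(3)]
    by (subst nn_integral_swap[OF _ F]) (auto simp: nn_integral_cmult m)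
  finally show ?thesis .
qed

lemma heat_fun_heat_fun_mix:
  assumes F: "sf_borel F" and pos: "AE t in F. 0 < t" and [measurable]: "w \<in> borel_measurable borel" and s: "0 < s"
  shows "heat_fun s (heat_fun_mix F w) x = (\<integral>\<^sup>+ t. heat_fun (s + t) w x \<partial>F)"
proof -
  have m: "(\<lambda>t. heat_fun t w x) \<in> borel_measurable F" for x
    by (auto intro!: sf_borel_measurable1[OF F])
  have "heat_fun s (heat_fun_mix F w) x = (\<integral>\<^sup>+ y. \<integral>\<^sup>+ t. ennreal (heat s (x - y)) * heat_fun t w y \<partial>F \<partial>lborel)"
    unfolding heat_fun_def[of s] heat_fun_mix_def by (simp add: nn_integral_cmult[OF m])
  also have "\<dots> = (\<integral>\<^sup>+ t. heat_fun s (heat_fun t w) x \<partial>F)"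
    unfolding heat_fun_def[of s] by (subst nn_integral_swap[OF _ F]) auto
  also have "\<dots> = (\<integral>\<^sup>+ t. heat_fun (s + t) w x \<partial>F)"
    by (rule nn_integral_cong_AE, use pos in eventually_elim) (simp add: heat_fun_semigroup s)
  finally show ?thesis .
qed

lemma heat_fun_heat_mix:
  assumes F: "sf_borel F" and pos: "AE t in F. 0 < t" and M: "sf_borel M" and s: "0 < s"
  shows "heat_fun s (heat_mix F M) x = (\<integral>\<^sup>+ t. heat_flow (s + t) M x \<partial>F)"
proof -
  note [measurable] = borel_measurable_heat_flow[OF M]
  have m: "(\<lambda>t. heat_flow t M x) \<in> borel_measurable F" for x
    by (rule sf_borel_measurable1[OF F]) measurable
  have "heat_fun s (heat_mix F M) x = (\<integral>\<^sup>+ y. \<integral>\<^sup>+ t. ennreal (heat s (x - y)) * heat_flow t M y \<partial>F \<partial>lborel)"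
    unfolding heat_fun_def[of s] heat_mix_def by (simp add: nn_integral_cmult[OF m])
  also have "\<dots> = (\<integral>\<^sup>+ t. heat_fun s (heat_flow t M) x \<partial>F)"
    unfolding heat_fun_def[of s] by (subst nn_integral_swap[OF _ F]) auto
  also have "\<dots> = (\<integral>\<^sup>+ t. heat_flow (s + t) M x \<partial>F)"
    by (rule nn_integral_cong_AE, use pos in eventually_elim) (simp add: heat_fun_heat_flow[OF M s])
  finally show ?thesis .
qed

text \<open>Mixing heat operators over these times gives the local part of the Riesz kernel.\<close>

definition riesz_time_upto :: "real \<Rightarrow> real \<Rightarrow> real measure" where
  "riesz_time_upto \<alpha> r = density (riesz_time \<alpha>) (indicator {..r})"

lemma nn_integral_riesz_time_upto:
  assumes [measurable]: "f \<in> borel_measurable borel"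
  shows "(\<integral>\<^sup>+ t. f t \<partial>riesz_time_upto \<alpha> r) = (\<integral>\<^sup>+ t. f t * indicator {..r} t \<partial>riesz_time \<alpha>)"
  unfolding riesz_time_upto_def by (subst nn_integral_density) (auto simp: mult.commute)

lemma sf_borel_riesz_time_upto [simp]: "sf_borel (riesz_time_upto \<alpha> r)"
proof -
  have "sigma_finite_measure (riesz_time_upto \<alpha> r)"
    unfolding riesz_time_upto_def
    by (subst sigma_finite_measure.sigma_finite_iff_density_finite[OF sf_borelD(1)[OF sf_borel_riesz_time]])
       (auto simp: indicator_def)
  then show ?thesis by (simp add: sf_borel_def riesz_time_upto_def)
qed

lemma AE_riesz_time_upto: "AE t in riesz_time_upto \<alpha> r. 0 < t \<and> t \<le> r"
  unfolding riesz_time_upto_def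
  using AE_riesz_time[of \<alpha>] by (subst AE_density) (auto elim!: eventually_mono simp: indicator_def)

lemma AE_riesz_time_upto_pos: "AE t in riesz_time_upto \<alpha> r. 0 < t"
  using AE_riesz_time_upto by eventually_elim simp

section \<open>Positivity of the energy\<close>

lemma two_mult_le_squares_ennreal: "2 * (x * y) \<le> x * x + y * (y::ennreal)"
proof (cases x)
  case (real a) note a = this
  show ?thesis
  proof (cases y)
    case (real b)
    have "0 \<le> (a - b)\<^sup>2" by simp
    then have "2 * (a * b) \<le> a * a + b * b" by (simp add: power2_eq_square algebra_simps)
    then show ?thesis using a real
      by (simp add: ennreal_mult'[symmetric] ennreal_plus[symmetric] flip: ennreal_numeral del: ennreal_plus)
  qed simp
qed simp

text \<open>Positivity of the energy of a - b, written without subtraction so that infinite values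
  are allowed.\<close>

lemma energy_fun_pos:
  assumes [measurable]: "a \<in> borel_measurable borel" "b \<in> borel_measurable borel"
  shows "2 * (\<integral>\<^sup>+ x. heat_fun_mix (riesz_time \<alpha>) a x * b x \<partial>lborel)
    \<le> (\<integral>\<^sup>+ x. heat_fun_mix (riesz_time \<alpha>) a x * a x \<partial>lborel) + (\<integral>\<^sup>+ x. heat_fun_mix (riesz_time \<alpha>) b x * b x \<partial>lborel)"
proof -
  \<comment> \<open>Half of the time is moved to each factor, which exhibits the pairing as an
    integral of products; the pointwise inequality between product and squares then applies.\<close>
  have E: "(\<integral>\<^sup>+ x. heat_fun_mix (riesz_time \<alpha>) a x * b x \<partial>lborel)
      = (\<integral>\<^sup>+ t. \<integral>\<^sup>+ x. heat_fun (t / 2) a x * heat_fun (t / 2) b x \<partial>lborel \<partial>riesz_time \<alpha>)"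
    if [measurable]: "a \<in> borel_measurable borel" "b \<in> borel_measurable borel" for a b :: "'a \<Rightarrow> ennreal"
  proof -
    have "(\<integral>\<^sup>+ x. heat_fun_mix (riesz_time \<alpha>) a x * b x \<partial>lborel) = (\<integral>\<^sup>+ t. \<integral>\<^sup>+ x. heat_fun t a x * b x \<partial>lborel \<partial>riesz_time \<alpha>)"
      unfolding heat_fun_mix_def by (subst nn_integral_swap) (auto simp: nn_integral_multc)
    also have "\<dots> = (\<integral>\<^sup>+ t. \<integral>\<^sup>+ x. heat_fun (t / 2) (heat_fun (t / 2) a) x * b x \<partial>lborel \<partial>riesz_time \<alpha>)"
      by (rule nn_integral_riesz_time_cong) (simp add: heat_fun_semigroup)
    also have "\<dots> = (\<integral>\<^sup>+ t. \<integral>\<^sup>+ x. heat_fun (t / 2) a x * heat_fun (t / 2) b x \<partial>lborel \<partial>riesz_time \<alpha>)"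
      by (simp add: nn_integral_heat_fun_commute)
    finally show ?thesis .
  qed
  have [measurable]: "(\<lambda>t. \<integral>\<^sup>+ x. heat_fun (t / 2) a x * heat_fun (t / 2) b x \<partial>lborel) \<in> borel_measurable borel"
    if [measurable]: "a \<in> borel_measurable borel" "b \<in> borel_measurable borel" for a b :: "'a \<Rightarrow> ennreal"
    by (rule sf_borel_borel_measurable_nn_integral) auto
  have "2 * (\<integral>\<^sup>+ x. heat_fun_mix (riesz_time \<alpha>) a x * b x \<partial>lborel)
    = (\<integral>\<^sup>+ t. \<integral>\<^sup>+ x. 2 * (heat_fun (t / 2) a x * heat_fun (t / 2) b x) \<partial>lborel \<partial>riesz_time \<alpha>)"
    by (simp add: E nn_integral_cmult)
  also have "\<dots> \<le> (\<integral>\<^sup>+ t. \<integral>\<^sup>+ x. heat_fun (t / 2) a x * heat_fun (t / 2) a x + heat_fun (t / 2) b x * heat_fun (t / 2) b x \<partial>lborel \<partial>riesz_time \<alpha>)"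
    by (intro nn_integral_mono two_mult_le_squares_ennreal)
  also have "\<dots> = (\<integral>\<^sup>+ x. heat_fun_mix (riesz_time \<alpha>) a x * a x \<partial>lborel) + (\<integral>\<^sup>+ x. heat_fun_mix (riesz_time \<alpha>) b x * b x \<partial>lborel)"
    by (simp add: E nn_integral_add)
  finally show ?thesis .
qed

section \<open>Riesz decomposition of supermedian functions\<close>

text \<open>Only these properties of the jump distribution are kept, so both cases of
  \<open>riesz_time_renewal\<close> are treated alike. Below, \<open>K\<close> is the full potential
  operator, \<open>G\<close> its part with times up to r, and \<open>Q\<close> the operator of one
  jump.\<close>

locale renewal =
  fixes \<alpha> r :: real and F :: "real measure"
  assumes r_pos: "0 < r" and F: "sf_borel F" and F_ge: "AE s in F. r \<le> s"
    and renew: "h \<in> borel_measurable borel \<Longrightarrow> (\<integral>\<^sup>+ t. h t \<partial>riesz_time \<alpha>)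
      = (\<integral>\<^sup>+ t. h t * indicator {..r} t \<partial>riesz_time \<alpha>) + (\<integral>\<^sup>+ s. \<integral>\<^sup>+ t. h (s + t) \<partial>riesz_time \<alpha> \<partial>F)"
begin

lemma F_pos: "AE s in F. 0 < s"
  using F_ge by eventually_elim (use r_pos in auto)

lemma of_nat_mult_r_mono: "m \<le> n \<Longrightarrow> real m * r \<le> real n * r"
  using r_pos by (intro mult_right_mono) auto

lemma F_mono:
  assumes "\<And>s. r \<le> s \<Longrightarrow> f s \<le> g s"
  shows "(\<integral>\<^sup>+ s. f s \<partial>F) \<le> (\<integral>\<^sup>+ s. g s \<partial>F)"
  by (rule nn_integral_mono_AE, use F_ge in eventually_elim) (use assms in auto)

abbreviation (input) "K \<equiv> heat_fun_mix (riesz_time \<alpha>)"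
abbreviation (input) "G \<equiv> heat_fun_mix (riesz_time_upto \<alpha> r)"
abbreviation (input) "Q \<equiv> heat_fun_mix F"

lemmas [measurable] = borel_measurable_heat_fun_mix[OF F] borel_measurable_heat_fun_mix[OF sf_borel_riesz_time]
  borel_measurable_heat_fun_mix[OF sf_borel_riesz_time_upto]

lemma borel_measurable_Q_funpow [measurable]:
  "w \<in> borel_measurable borel \<Longrightarrow> (Q ^^ j) w \<in> borel_measurable borel"
  by (induction j) auto

text \<open>Truncation at multiples of r matches the number of jumps: each consumes time at least
  r.\<close>

definition K_upto :: "nat \<Rightarrow> ('a::euclidean_space \<Rightarrow> ennreal) \<Rightarrow> 'a \<Rightarrow> ennreal" where
  "K_upto n b x = (\<integral>\<^sup>+ t. heat_fun t b x * indicator {..real n * r} t \<partial>riesz_time \<alpha>)"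

lemma nn_integral_riesz_time_F_swap:
  assumes [measurable]: "b \<in> borel_measurable borel" "f \<in> borel_measurable borel"
  shows "(\<integral>\<^sup>+ s. \<integral>\<^sup>+ t. heat_fun (s + t) b x * f t \<partial>riesz_time \<alpha> \<partial>F)
    = (\<integral>\<^sup>+ t. heat_fun t (Q b) x * f t \<partial>riesz_time \<alpha>)"
proof -
  have m: "(\<lambda>s. heat_fun (t + s) b x) \<in> borel_measurable F" for t
    by (rule sf_borel_measurable1[OF F]) measurable
  have "(\<integral>\<^sup>+ s. \<integral>\<^sup>+ t. heat_fun (s + t) b x * f t \<partial>riesz_time \<alpha> \<partial>F)
    = (\<integral>\<^sup>+ t. \<integral>\<^sup>+ s. heat_fun (t + s) b x * f t \<partial>F \<partial>riesz_time \<alpha>)"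
    by (subst nn_integral_swap[OF _ F]) (auto simp: add.commute)
  also have "\<dots> = (\<integral>\<^sup>+ t. heat_fun t (Q b) x * f t \<partial>riesz_time \<alpha>)"
    by (rule nn_integral_riesz_time_cong)
       (simp add: nn_integral_multc m heat_fun_heat_fun_mix[OF F F_pos])
  finally show ?thesis .
qed

text \<open>Each use of the renewal identity splits off one local part and leaves a time budget
  smaller by at least r, so n steps exhaust n r.\<close>

lemma K_upto_le_sum:
  assumes "b \<in> borel_measurable borel"
  shows "K_upto n b x \<le> (\<Sum>j<n. G ((Q ^^ j) b) x)"
  using assms
proof (induction n arbitrary: b)
  case 0
  have "K_upto 0 b x = (\<integral>\<^sup>+ t. 0 \<partial>riesz_time \<alpha>)"
    unfolding K_upto_def by (rule nn_integral_riesz_time_cong) simp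
  then show ?case by simp
next
  case (Suc n)
  note [measurable] = Suc.prems
  define h where "h t = heat_fun t b x * indicator {..real (Suc n) * r} t" for t
  have [measurable]: "h \<in> borel_measurable borel" unfolding h_def by measurable
  have "K_upto (Suc n) b x = (\<integral>\<^sup>+ t. h t * indicator {..r} t \<partial>riesz_time \<alpha>) + (\<integral>\<^sup>+ s. \<integral>\<^sup>+ t. h (s + t) \<partial>riesz_time \<alpha> \<partial>F)"
    unfolding K_upto_def h_def[symmetric] by (rule renew) measurable
  also have "(\<integral>\<^sup>+ t. h t * indicator {..r} t \<partial>riesz_time \<alpha>) \<le> G b x"
    unfolding heat_fun_mix_def h_def
    by (subst nn_integral_riesz_time_upto) (auto intro!: nn_integral_mono simp: indicator_def)
  \<comment> \<open>As s >= r, the bound s + t <= (n + 1) r forces t <= n r.\<close>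
  also have "(\<integral>\<^sup>+ s. \<integral>\<^sup>+ t. h (s + t) \<partial>riesz_time \<alpha> \<partial>F)
     \<le> (\<integral>\<^sup>+ s. \<integral>\<^sup>+ t. heat_fun (s + t) b x * indicator {..real n * r} t \<partial>riesz_time \<alpha> \<partial>F)"
    by (intro F_mono nn_integral_mono) (auto simp: h_def indicator_def algebra_simps)
  also have "\<dots> = K_upto n (Q b) x"
    unfolding K_upto_def by (rule nn_integral_riesz_time_F_swap) measurable
  also have "\<dots> \<le> (\<Sum>j<n. G ((Q ^^ j) (Q b)) x)"
    by (rule Suc.IH) measurable
  also have "G b x + \<dots> = (\<Sum>j<Suc n. G ((Q ^^ j) b) x)"
    by (subst sum.lessThan_Suc_shift) (simp add: funpow_swap1)
  finally show ?case by (simp add: add_mono)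
qed

lemma K_renew:
  assumes [measurable]: "b \<in> borel_measurable borel"
  shows "K b x = G b x + K (Q b) x"
proof -
  have "K b x = (\<integral>\<^sup>+ t. heat_fun t b x * indicator {..r} t \<partial>riesz_time \<alpha>) + (\<integral>\<^sup>+ s. \<integral>\<^sup>+ t. heat_fun (s + t) b x \<partial>riesz_time \<alpha> \<partial>F)"
    unfolding heat_fun_mix_def by (rule renew) measurable
  also have "(\<integral>\<^sup>+ t. heat_fun t b x * indicator {..r} t \<partial>riesz_time \<alpha>) = G b x"
    unfolding heat_fun_mix_def by (subst nn_integral_riesz_time_upto) auto
  also have "(\<integral>\<^sup>+ s. \<integral>\<^sup>+ t. heat_fun (s + t) b x \<partial>riesz_time \<alpha> \<partial>F) = K (Q b) x"
    using nn_integral_riesz_time_F_swap[OF assms, of "\<lambda>_. 1" x] by (simp add: heat_fun_mix_def)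
  finally show ?thesis .
qed

text \<open>Iterates K = G + K Q from \<open>K_renew\<close>; the remainder K Q^n b is nonnegative
  and dropped.\<close>

lemma sum_le_K:
  assumes "b \<in> borel_measurable borel"
  shows "(\<Sum>j<n. G ((Q ^^ j) b) x) \<le> K b x"
  using assms
proof (induction n arbitrary: b)
  case (Suc n)
  have "(\<Sum>j<Suc n. G ((Q ^^ j) b) x) = G b x + (\<Sum>j<n. G ((Q ^^ j) (Q b)) x)"
    by (subst sum.lessThan_Suc_shift) (simp add: funpow_swap1)
  also have "\<dots> \<le> G b x + K (Q b) x"
    using Suc by (intro add_left_mono Suc.IH) measurable
  also have "\<dots> = K b x" by (rule K_renew[OF Suc.prems, symmetric])
  finally show ?case .
qed simp

text \<open>Applying Q^j to w = b + Q w gives a telescoping identity; the remainder G Q^n w is kept,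
  since it can be shown to vanish only under domination by a potential.\<close>

lemma G_expand:
  assumes [measurable]: "b \<in> borel_measurable borel" "w \<in> borel_measurable borel"
    and w: "\<And>x. w x = b x + Q w x"
  shows "G w x = (\<Sum>j<n. G ((Q ^^ j) b) x) + G ((Q ^^ n) w) x"
proof -
  have step: "(Q ^^ n) w = (\<lambda>y. (Q ^^ n) b y + (Q ^^ Suc n) w y)" for n
  proof (induction n)
    case 0 then show ?case by (rule ext) (simp add: w[symmetric])
  next
    case (Suc n)
    have "(Q ^^ Suc n) w = Q ((Q ^^ n) w)"
      by simp
    also have "\<dots> = Q (\<lambda>y. (Q ^^ n) b y + (Q ^^ Suc n) w y)"
      by (rule arg_cong[OF Suc])
    also have "\<dots> = (\<lambda>y. (Q ^^ Suc n) b y + (Q ^^ Suc (Suc n)) w y)"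
      by (rule ext, subst heat_fun_mix_add[OF F]) (auto simp del: funpow.simps simp: funpow.simps(2)[of _ Q])
    finally show ?case .
  qed
  show ?thesis
  proof (induction n)
    case (Suc n)
    have "G ((Q ^^ n) w) x = G (\<lambda>y. (Q ^^ n) b y + (Q ^^ Suc n) w y) x"
      using step[of n] by simp
    also have "\<dots> = G ((Q ^^ n) b) x + G ((Q ^^ Suc n) w) x"
      by (rule heat_fun_mix_add) (auto simp del: funpow.simps)
    finally show ?case using Suc by (simp add: add.assoc)
  qed simp
qed

context
  fixes M :: "'a::euclidean_space measure"
  assumes M: "sf_borel M"
begin

lemmas [measurable] = borel_measurable_heat_flow[OF M] borel_measurable_heat_mix[OF _ M]

text \<open>The tail of the potential beyond time n r, which dominates Q^n w for every w below the
  potential.\<close>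

definition U_from :: "nat \<Rightarrow> 'a \<Rightarrow> ennreal" where
  "U_from n x = (\<integral>\<^sup>+ t. heat_flow t M x * indicator {real n * r<..} t \<partial>riesz_time \<alpha>)"

lemma borel_measurable_U_from [measurable]: "U_from n \<in> borel_measurable borel"
  unfolding U_from_def[abs_def] by (rule sf_borel_borel_measurable_nn_integral) auto

lemma U_from_0: "U_from 0 x = heat_mix (riesz_time \<alpha>) M x"
  unfolding U_from_def heat_mix_def by (rule nn_integral_riesz_time_cong) simp

lemma shift_heat_flow_swap:
  assumes [measurable]: "f \<in> borel_measurable borel" and s: "0 < s"
  shows "heat_fun s (\<lambda>y. \<integral>\<^sup>+ t. heat_flow t M y * f t \<partial>riesz_time \<alpha>) x
    = (\<integral>\<^sup>+ t. heat_flow (s + t) M x * f t \<partial>riesz_time \<alpha>)"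
proof -
  have "heat_fun s (\<lambda>y. \<integral>\<^sup>+ t. heat_flow t M y * f t \<partial>riesz_time \<alpha>) x
     = (\<integral>\<^sup>+ y. \<integral>\<^sup>+ t. ennreal (heat s (x - y)) * heat_flow t M y * f t \<partial>riesz_time \<alpha> \<partial>lborel)"
    unfolding heat_fun_def by (simp add: nn_integral_cmult mult.assoc)
  also have "\<dots> = (\<integral>\<^sup>+ t. heat_fun s (heat_flow t M) x * f t \<partial>riesz_time \<alpha>)"
    unfolding heat_fun_def by (subst nn_integral_swap) (auto simp: nn_integral_multc)
  also have "\<dots> = (\<integral>\<^sup>+ t. heat_flow (s + t) M x * f t \<partial>riesz_time \<alpha>)"
    by (rule nn_integral_riesz_time_cong) (simp add: heat_fun_heat_flow[OF M s])
  finally show ?thesis .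
qed

text \<open>After a jump of length at least r, a time beyond n r lies beyond (n + 1) r; the renewal
  identity for that tail then bounds the jump term.\<close>

lemma Q_U_from_le: "Q (U_from n) x \<le> U_from (Suc n) x"
proof -
  define h where "h t = heat_flow t M x * indicator {real (Suc n) * r<..} t" for t
  have [measurable]: "h \<in> borel_measurable borel" unfolding h_def by measurable
  have "Q (U_from n) x = (\<integral>\<^sup>+ s. \<integral>\<^sup>+ t. heat_flow (s + t) M x * indicator {real n * r<..} t \<partial>riesz_time \<alpha> \<partial>F)"
    unfolding heat_fun_mix_def U_from_def[abs_def]
    by (rule nn_integral_cong_AE, use F_pos in eventually_elim) (simp add: shift_heat_flow_swap)
  also have "\<dots> \<le> (\<integral>\<^sup>+ s. \<integral>\<^sup>+ t. h (s + t) \<partial>riesz_time \<alpha> \<partial>F)"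
    by (intro F_mono nn_integral_mono) (auto simp: h_def indicator_def algebra_simps)
  also have "\<dots> \<le> (\<integral>\<^sup>+ t. h t \<partial>riesz_time \<alpha>)"
    by (subst renew) (auto simp: add_increasing)
  also have "\<dots> = U_from (Suc n) x" by (simp add: U_from_def h_def)
  finally show ?thesis .
qed

text \<open>A jump to s >= r makes the restriction to times above r automatic. Applied to the
  restricted flow, the renewal identity has no local term.\<close>

lemma Q_heat_mix: "Q (heat_mix (riesz_time \<alpha>) M) x = (\<integral>\<^sup>+ t. heat_flow t M x * indicator {r<..} t \<partial>riesz_time \<alpha>)"
proof -
  define h where "h t = heat_flow t M x * indicator {r<..} t" for t
  have [measurable]: "h \<in> borel_measurable borel" unfolding h_def by measurable
  have "Q (heat_mix (riesz_time \<alpha>) M) x = (\<integral>\<^sup>+ s. \<integral>\<^sup>+ t. heat_flow (s + t) M x \<partial>riesz_time \<alpha> \<partial>F)"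
    unfolding heat_fun_mix_def heat_mix_def[abs_def]
    by (rule nn_integral_cong_AE, use F_pos in eventually_elim)
       (use shift_heat_flow_swap[of "\<lambda>_. 1"] in simp)
  also have "\<dots> = (\<integral>\<^sup>+ s. \<integral>\<^sup>+ t. h (s + t) \<partial>riesz_time \<alpha> \<partial>F)"
    by (rule nn_integral_cong_AE, use F_ge in eventually_elim, rule nn_integral_riesz_time_cong) (simp add: h_def)
  also have "\<dots> = (\<integral>\<^sup>+ t. h t \<partial>riesz_time \<alpha>)"
  proof -
    have "(\<integral>\<^sup>+ t. h t * indicator {..r} t \<partial>riesz_time \<alpha>) = (\<integral>\<^sup>+ t. 0 \<partial>riesz_time \<alpha>)"
      by (rule nn_integral_cong) (auto simp: h_def indicator_def)
    then show ?thesis by (subst renew) auto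
  qed
  finally show ?thesis by (simp add: h_def)
qed

lemma Q_heat_mix_le: "Q (heat_mix (riesz_time \<alpha>) M) x \<le> heat_mix (riesz_time \<alpha>) M x"
  unfolding Q_heat_mix heat_mix_def by (intro nn_integral_mono) (auto simp: indicator_def)

lemma Q_funpow_le_U_from:
  assumes "\<And>x. w x \<le> heat_mix (riesz_time \<alpha>) M x"
  shows "(Q ^^ n) w x \<le> U_from n x"
proof (induction n arbitrary: x)
  case 0 then show ?case using assms by (simp add: U_from_0)
next
  case (Suc n)
  have "(Q ^^ Suc n) w x \<le> Q (U_from n) x"
    using Suc by (simp add: heat_fun_mix_mono)
  also have "\<dots> \<le> U_from (Suc n) x" by (rule Q_U_from_le)
  finally show ?case .
qed

lemma decseq_U_from: "decseq (\<lambda>n. U_from n x)"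
proof (rule antimonoI)
  fix m n :: nat assume "m \<le> n"
  then show "U_from n x \<le> U_from m x"
    unfolding U_from_def using of_nat_mult_r_mono[of m n]
    by (intro nn_integral_mono) (auto simp: indicator_def)
qed

lemma INF_U_from:
  assumes "heat_mix (riesz_time \<alpha>) M x < \<infinity>"
  shows "(INF n. U_from n x) = 0"
proof -
  have dec: "decseq (\<lambda>n t. heat_flow t M x * indicator {real n * r<..} t)"
  proof (intro antimonoI le_funI)
    fix m n :: nat and t :: real assume "m \<le> n"
    then show "heat_flow t M x * indicator {real n * r<..} t \<le> heat_flow t M x * indicator {real m * r<..} t"
      using of_nat_mult_r_mono[of m n] by (auto simp: indicator_def)
  qed
  have "(INF n. U_from n x) = (\<integral>\<^sup>+ t. (INF n. heat_flow t M x * indicator {real n * r<..} t) \<partial>riesz_time \<alpha>)"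
    unfolding U_from_def
    by (rule nn_integral_monotone_convergence_INF_decseq[OF dec, symmetric, of _ 0])
       (use assms U_from_0[of x] in \<open>auto simp: U_from_def\<close>)
  also have "\<dots> = (\<integral>\<^sup>+ t. 0 \<partial>riesz_time \<alpha>)"
  proof (rule nn_integral_cong)
    fix t :: real
    obtain n :: nat where "t / r < real n" using reals_Archimedean2 by blast
    then have "t \<le> real n * r" using r_pos by (simp add: field_simps)
    then have "(INF n. heat_flow t M x * indicator {real n * r<..} t) \<le> 0"
      by (intro INF_lower2[of n]) (auto simp: indicator_def)
    then show "(INF n. heat_flow t M x * indicator {real n * r<..} t) = 0" by simp
  qed
  finally show ?thesis by simp
qed

text \<open>Decreasing convergence against the kernel \<open>k\<close> of G, with the finite value
  at n = 0 as dominating integral.\<close>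

lemma INF_G_U_from:
  assumes fin: "G (heat_mix (riesz_time \<alpha>) M) x < \<infinity>"
  shows "(INF n. G (U_from n) x) = 0"
proof -
  define k where "k y = (\<integral>\<^sup>+ t. ennreal (heat t (x - y)) \<partial>riesz_time_upto \<alpha> r)" for y
  have [measurable]: "k \<in> borel_measurable borel"
    unfolding k_def by (rule sf_borel_borel_measurable_nn_integral) auto
  have m: "(\<lambda>t. ennreal (heat t (x - y))) \<in> borel_measurable (riesz_time_upto \<alpha> r)" for y
    by (rule sf_borel_measurable1) auto
  have Gk: "G w x = (\<integral>\<^sup>+ y. k y * w y \<partial>lborel)" if [measurable]: "w \<in> borel_measurable borel" for w
    unfolding heat_fun_mix_def heat_fun_def k_def
    by (subst nn_integral_swap) (auto simp: nn_integral_multc m)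
  let ?u = "heat_mix (riesz_time \<alpha>) M"
  have u0: "U_from 0 = ?u" by (simp add: U_from_0 fun_eq_iff)
  have [measurable]: "?u \<in> borel_measurable borel" by measurable
  have fin': "(\<integral>\<^sup>+ y. k y * ?u y \<partial>lborel) < \<infinity>" using fin by (simp add: Gk)
  then have ae: "AE y in lborel. k y * ?u y \<noteq> \<infinity>"
    by (intro nn_integral_PInf_AE) auto
  have dec: "decseq (\<lambda>n y. k y * U_from n y)"
    by (intro antimonoI le_funI mult_left_mono antimonoD[OF decseq_U_from]) auto
  have "(INF n. G (U_from n) x) = (INF n. \<integral>\<^sup>+ y. k y * U_from n y \<partial>lborel)"
    by (simp add: Gk)
  also have "\<dots> = (\<integral>\<^sup>+ y. (INF n. k y * U_from n y) \<partial>lborel)"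
    by (rule nn_integral_monotone_convergence_INF_decseq[OF dec, symmetric, of _ 0])
       (simp_all add: u0 fin'[unfolded infinity_ennreal_def])
  also have "\<dots> = (\<integral>\<^sup>+ y. 0 \<partial>(lborel :: 'a measure))"
  proof (rule nn_integral_cong_AE)
    show "AE y in lborel. (INF n. k y * U_from n y) = 0"
      using ae
    proof eventually_elim
      fix y assume *: "k y * ?u y \<noteq> \<infinity>"
      show "(INF n. k y * U_from n y) = 0"
      proof (cases "k y = 0")
        case False
        then have "?u y < \<infinity>" using * by (auto simp: less_top[symmetric] ennreal_mult_eq_top_iff)
        then have inf: "(INF n. U_from n y) = 0" by (rule INF_U_from)
        show ?thesis
        proof (cases "k y = top")
          case True
          \<comment> \<open>Multiplication by an infinite kernel value is not continuous at 0, but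
            there finiteness of the product already forces the whole potential to vanish.\<close>
          then have "?u y = 0" using * by (auto simp: ennreal_mult_eq_top_iff)
          then have "k y * U_from 0 y = 0" by (simp add: u0)
          then have "(INF n. k y * U_from n y) \<le> 0" by (intro INF_lower2[of 0]) simp_all
          then show ?thesis by simp
        next
          case False
          have "(\<lambda>n. U_from n y) \<longlonglongrightarrow> (INF n. U_from n y)" by (rule LIMSEQ_INF[OF decseq_U_from])
          then have "(\<lambda>n. k y * U_from n y) \<longlonglongrightarrow> k y * 0"
            unfolding inf using False by (intro ennreal_tendsto_cmult) (auto simp: less_top)
          moreover have "(\<lambda>n. k y * U_from n y) \<longlonglongrightarrow> (INF n. k y * U_from n y)"
            by (intro LIMSEQ_INF antimonoI mult_left_mono antimonoD[OF decseq_U_from]) auto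
          ultimately show ?thesis using LIMSEQ_unique by fastforce
        qed
      qed simp
    qed
  qed
  finally show ?thesis by simp
qed

lemma K_upto_SUP:
  assumes [measurable]: "b \<in> borel_measurable borel"
  shows "K b x = (SUP n. K_upto n b x)"
proof -
  have inc: "incseq (\<lambda>n t. heat_fun t b x * indicator {..real n * r} t)"
  proof (intro monoI le_funI)
    fix m n :: nat and t :: real assume "m \<le> n"
    then show "heat_fun t b x * indicator {..real m * r} t \<le> heat_fun t b x * indicator {..real n * r} t"
      using of_nat_mult_r_mono[of m n] by (auto simp: indicator_def)
  qed
  have "(SUP n. K_upto n b x) = (\<integral>\<^sup>+ t. (SUP n. heat_fun t b x * indicator {..real n * r} t) \<partial>riesz_time \<alpha>)"
    unfolding K_upto_def by (rule nn_integral_monotone_convergence_SUP[OF inc, symmetric]) measurable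
  also have "\<dots> = (\<integral>\<^sup>+ t. heat_fun t b x \<partial>riesz_time \<alpha>)"
  proof (rule nn_integral_cong)
    fix t :: real
    obtain n :: nat where "t / r < real n" using reals_Archimedean2 by blast
    then have n: "t \<le> real n * r" using r_pos by (simp add: field_simps)
    show "(SUP n. heat_fun t b x * indicator {..real n * r} t) = heat_fun t b x"
    proof (rule antisym)
      show "(SUP n. heat_fun t b x * indicator {..real n * r} t) \<le> heat_fun t b x"
        by (intro SUP_least) (auto simp: indicator_def)
      show "heat_fun t b x \<le> (SUP n. heat_fun t b x * indicator {..real n * r} t)"
        by (rule SUP_upper2[of n]) (use n in auto)
    qed
  qed
  finally show ?thesis by (simp add: heat_fun_mix_def)
qed

text \<open>A Riesz decomposition with local part G w. The partial sums of G Q^j b lie below G w for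
  every n and exhaust K b; conversely G w exceeds them by at most G applied to a tail of the
  potential, which tends to 0 where G u is finite.\<close>

lemma
  assumes [measurable]: "b \<in> borel_measurable borel" "w \<in> borel_measurable borel"
    and w: "\<And>x. w x = b x + Q w x" and w_le: "\<And>x. w x \<le> heat_mix (riesz_time \<alpha>) M x"
  shows K_difference_le: "K b x \<le> G w x"
    and K_difference_eq: "G (heat_mix (riesz_time \<alpha>) M) x < \<infinity> \<Longrightarrow> K b x = G w x"
proof -
  show le: "K b x \<le> G w x"
    unfolding K_upto_SUP[OF assms(1)]
  proof (rule SUP_least)
    fix n
    have "K_upto n b x \<le> (\<Sum>j<n. G ((Q ^^ j) b) x)" by (rule K_upto_le_sum) measurable
    also have "\<dots> \<le> G w x" by (subst G_expand[OF assms(1,2) w, of x n]) (simp add: add_increasing2)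
    finally show "K_upto n b x \<le> G w x" .
  qed
  assume fin: "G (heat_mix (riesz_time \<alpha>) M) x < \<infinity>"
  have "G w x \<le> K b x + G (U_from n) x" for n
    unfolding G_expand[OF assms(1,2) w, of x n]
    by (intro add_mono sum_le_K heat_fun_mix_mono Q_funpow_le_U_from w_le) measurable
  then have "G w x \<le> (INF n. K b x + G (U_from n) x)" by (rule INF_greatest)
  also have "\<dots> = K b x + (INF n. G (U_from n) x)"
    by (rule INF_ennreal_const_add)
  finally have "G w x \<le> K b x" by (simp add: INF_G_U_from[OF fin])
  with le show "K b x = G w x" by (rule antisym)
qed

end

end

section \<open>The domination principle\<close>

text \<open>For \<alpha> > 0 and r > 0 this is (2/\<alpha>) r^(\<alpha>/2).\<close>

definition riesz_time_mass :: "real \<Rightarrow> real \<Rightarrow> ennreal" where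
  "riesz_time_mass \<alpha> r = (\<integral>\<^sup>+ t. indicator {..r} t \<partial>riesz_time \<alpha>)"

definition unit_time :: "real \<Rightarrow> real measure" where
  "unit_time \<alpha> = density (riesz_time \<alpha>) (\<lambda>t. indicator {..1} t * inverse (riesz_time_mass \<alpha> 1))"

lemma sets_unit_time [simp, measurable_cong]: "sets (unit_time \<alpha>) = sets borel"
  by (simp add: unit_time_def)

lemma riesz_time_mass_scale:
  assumes "0 < r"
  shows "riesz_time_mass \<alpha> r = ennreal (r powr (\<alpha> / 2)) * riesz_time_mass \<alpha> 1"
proof -
  have "(\<lambda>t. indicator {..r} (r * t) :: ennreal) = indicator {..1}"
    using assms by (auto simp: fun_eq_iff indicator_def)
  then show ?thesis
    unfolding riesz_time_mass_def using assms by (subst riesz_time_scale[of _ r]) auto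
qed

lemma riesz_time_mass_1:
  assumes "0 < \<alpha>"
  shows "0 < riesz_time_mass \<alpha> 1" "riesz_time_mass \<alpha> 1 < \<infinity>"
proof -
  have "riesz_time_mass \<alpha> 1 = (\<integral>\<^sup>+ t. ennreal (t powr (\<alpha> / 2 - 1) * (1 - t) powr (1 - 1)) * indicator {0..1} t \<partial>lborel)"
    unfolding riesz_time_mass_def
  proof (subst nn_integral_riesz_time, simp, rule nn_integral_cong_AE)
    show "AE t in lborel. ennreal (t powr (\<alpha> / 2 - 1)) * indicator {0<..} t * indicator {..1} t
      = ennreal (t powr (\<alpha> / 2 - 1) * (1 - t) powr (1 - 1)) * indicator {0..1} t"
      using AE_lborel_singleton[of "1::real"]
    proof eventually_elim
      fix t :: real assume "t \<noteq> 1"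
      then show "ennreal (t powr (\<alpha> / 2 - 1)) * indicator {0<..} t * indicator {..1} t
        = ennreal (t powr (\<alpha> / 2 - 1) * (1 - t) powr (1 - 1)) * indicator {0..1} t"
        by (cases "t = 0") (simp_all add: indicator_def)
    qed
  qed
  also have "\<dots> = ennreal (Beta (\<alpha> / 2) 1)"
    using assms by (intro nn_integral_Beta) auto
  finally have eq: "riesz_time_mass \<alpha> 1 = ennreal (Beta (\<alpha> / 2) 1)" .
  have "0 < Beta (\<alpha> / 2) 1"
    unfolding Beta_def using assms by (intro divide_pos_pos mult_pos_pos Gamma_real_pos) auto
  then show "0 < riesz_time_mass \<alpha> 1" "riesz_time_mass \<alpha> 1 < \<infinity>"
    by (simp_all add: eq)
qed

lemma riesz_time_mass:
  assumes "0 < \<alpha>" "0 < r"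
  shows "0 < riesz_time_mass \<alpha> r" "riesz_time_mass \<alpha> r < \<infinity>"
proof -
  have p: "0 < ennreal (r powr (\<alpha> / 2))" "ennreal (r powr (\<alpha> / 2)) < \<infinity>" using assms by simp_all
  show "0 < riesz_time_mass \<alpha> r"
    unfolding riesz_time_mass_scale[OF assms(2)]
    using p riesz_time_mass_1[OF assms(1)] by (simp add: ennreal_zero_less_mult_iff)
  show "riesz_time_mass \<alpha> r < \<infinity>"
    unfolding riesz_time_mass_scale[OF assms(2)]
    using p riesz_time_mass_1[OF assms(1)] by (simp add: ennreal_mult_less_top)
qed

lemma nn_integral_unit_time:
  assumes [measurable]: "f \<in> borel_measurable borel"
  shows "(\<integral>\<^sup>+ t. f t \<partial>unit_time \<alpha>) = inverse (riesz_time_mass \<alpha> 1) * (\<integral>\<^sup>+ t. f t * indicator {..1} t \<partial>riesz_time \<alpha>)"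
  unfolding unit_time_def
  by (subst nn_integral_density) (auto simp: nn_integral_cmult[symmetric] mult_ac)

lemma AE_unit_time: "AE t in unit_time \<alpha>. 0 < t"
  unfolding unit_time_def using AE_riesz_time[of \<alpha>] by (subst AE_density) (auto elim!: eventually_mono)

lemma prob_space_unit_time:
  assumes "0 < \<alpha>"
  shows "prob_space (unit_time \<alpha>)"
proof
  have "emeasure (unit_time \<alpha>) (space (unit_time \<alpha>)) = (\<integral>\<^sup>+ t. 1 \<partial>unit_time \<alpha>)" by simp
  also have "\<dots> = inverse (riesz_time_mass \<alpha> 1) * riesz_time_mass \<alpha> 1"
    by (subst nn_integral_unit_time) (auto simp: riesz_time_mass_def)
  also have "\<dots> = 1"
    using riesz_time_mass_1[OF assms] by (simp add: mult.commute ennreal_divide_self flip: divide_ennreal_def)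
  finally show "emeasure (unit_time \<alpha>) (space (unit_time \<alpha>)) = 1" .
qed

text \<open>The local operator G divided by its mass. The averaging law does not depend on r, only
  the times are scaled, which makes the limit r -> 0 accessible to Fatou's lemma.\<close>

definition heat_mean :: "real \<Rightarrow> real \<Rightarrow> ('a::euclidean_space \<Rightarrow> ennreal) \<Rightarrow> 'a \<Rightarrow> ennreal" where
  "heat_mean \<alpha> r w x = (\<integral>\<^sup>+ t. heat_fun (r * t) w x \<partial>unit_time \<alpha>)"

lemma sf_borel_unit_time: "0 < \<alpha> \<Longrightarrow> sf_borel (unit_time \<alpha>)"
  using prob_space_unit_time[of \<alpha>] by (simp add: sf_borel_def prob_space_imp_sigma_finite)

lemma borel_measurable_heat_mean [measurable]:
  assumes "0 < \<alpha>" and [measurable]: "w \<in> borel_measurable borel"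
  shows "heat_mean \<alpha> r w \<in> borel_measurable borel"
  unfolding heat_mean_def[abs_def]
  by (rule sf_borel_borel_measurable_nn_integral[OF sf_borel_unit_time[OF assms(1)]]) measurable

lemma heat_fun_mix_upto_eq:
  assumes "0 < \<alpha>" "0 < r" and [measurable]: "w \<in> borel_measurable borel"
  shows "heat_fun_mix (riesz_time_upto \<alpha> r) w x = riesz_time_mass \<alpha> r * heat_mean \<alpha> r w x"
proof -
  let ?m = "riesz_time_mass \<alpha> 1"
  have m: "?m * inverse ?m = 1"
    using riesz_time_mass_1[OF assms(1)] by (simp add: ennreal_divide_self flip: divide_ennreal_def)
  have "heat_fun_mix (riesz_time_upto \<alpha> r) w x = (\<integral>\<^sup>+ t. heat_fun t w x * indicator {..r} t \<partial>riesz_time \<alpha>)"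
    unfolding heat_fun_mix_def by (rule nn_integral_riesz_time_upto) measurable
  also have "\<dots> = ennreal (r powr (\<alpha> / 2)) * (\<integral>\<^sup>+ t. heat_fun (r * t) w x * indicator {..r} (r * t) \<partial>riesz_time \<alpha>)"
    by (rule riesz_time_scale) (use assms in auto)
  also have "(\<integral>\<^sup>+ t. heat_fun (r * t) w x * indicator {..r} (r * t) \<partial>riesz_time \<alpha>)
    = (\<integral>\<^sup>+ t. heat_fun (r * t) w x * indicator {..1} t \<partial>riesz_time \<alpha>)"
    using assms by (intro nn_integral_cong) (auto simp: indicator_def)
  also have "\<dots> = (?m * inverse ?m) * \<dots>" unfolding m by simp
  also have "\<dots> = ?m * heat_mean \<alpha> r w x"
    unfolding heat_mean_def by (subst nn_integral_unit_time) (auto simp: mult.assoc)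
  finally show ?thesis by (simp add: riesz_time_mass_scale[OF assms(2)] mult.assoc)
qed

lemma heat_fun_eq_integral:
  fixes w :: "'a::euclidean_space \<Rightarrow> ennreal"
  assumes [measurable]: "w \<in> borel_measurable borel" and t: "0 < t"
  shows "heat_fun t w x = (\<integral>\<^sup>+ y. w (x + sqrt t *\<^sub>R y) \<partial>density lborel (\<lambda>y. ennreal (heat 1 y)))"
proof -
  have h: "ennreal (\<bar>sqrt t\<bar> ^ DIM('a)) * ennreal (heat t (x - (x + sqrt t *\<^sub>R y))) = ennreal (heat 1 y)" for y :: 'a
  proof -
    have "heat t (x - (x + sqrt t *\<^sub>R y)) = sqrt t powr (- real DIM('a)) * heat 1 y"
      using heat_scale[of "sqrt t" 1 "x - (x + sqrt t *\<^sub>R y)"] t by (simp add: heat_def)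
    moreover have "\<bar>sqrt t\<bar> ^ DIM('a) * sqrt t powr (- real DIM('a)) = 1"
      using t by (simp add: powr_minus powr_realpow)
    ultimately show ?thesis by (simp add: ennreal_mult'[symmetric] mult.assoc[symmetric])
  qed
  have "heat_fun t w x = ennreal (\<bar>sqrt t\<bar> ^ DIM('a)) * (\<integral>\<^sup>+ y. ennreal (heat t (x - (x + sqrt t *\<^sub>R y))) * w (x + sqrt t *\<^sub>R y) \<partial>lborel)"
    unfolding heat_fun_def using t by (intro nn_integral_lborel_affine) auto
  also have "\<dots> = (\<integral>\<^sup>+ y. ennreal (heat 1 y) * w (x + sqrt t *\<^sub>R y) \<partial>lborel)"
    by (subst nn_integral_cmult[symmetric], measurable) (simp only: mult.assoc[symmetric] h)
  also have "\<dots> = (\<integral>\<^sup>+ y. w (x + sqrt t *\<^sub>R y) \<partial>density lborel (\<lambda>y. ennreal (heat 1 y)))"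
    by (subst nn_integral_density) auto
  finally show ?thesis .
qed

lemma prob_space_heat_1: "prob_space (density lborel (\<lambda>y::'a::euclidean_space. ennreal (heat 1 y)))"
proof
  show "emeasure (density lborel (\<lambda>y::'a. ennreal (heat 1 y))) (space (density lborel (\<lambda>y. ennreal (heat 1 y)))) = 1"
    using nn_integral_heat[of 1 "0::'a"] heat_minus_commute[of 1 "0::'a"] by (simp add: emeasure_density)
qed

text \<open>In Gaussian coordinates the means sample points X j + sqrt(r j * t) y, which still
  converge to x. Functions and points both vary with j, so the conclusion has the form of the
  hypothesis and the lemma can be applied again to the means themselves.\<close>

lemma heat_mean_Fatou:
  fixes w :: "'a::euclidean_space \<Rightarrow> ennreal" and W :: "nat \<Rightarrow> 'a \<Rightarrow> ennreal"
  assumes "0 < \<alpha>" and r: "\<And>j. 0 < r j" "r \<longlonglongrightarrow> 0"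
    and [measurable]: "\<And>j. W j \<in> borel_measurable borel"
    and W: "\<And>x X. X \<longlonglongrightarrow> x \<Longrightarrow> w x \<le> liminf (\<lambda>j. W j (X j))"
    and X: "X \<longlonglongrightarrow> x"
  shows "w x \<le> liminf (\<lambda>j. heat_mean \<alpha> (r j) (W j) (X j))"
proof -
  interpret P: prob_space "unit_time \<alpha>" by (rule prob_space_unit_time) fact
  interpret H: prob_space "density lborel (\<lambda>y::'a. ennreal (heat 1 y))" by (rule prob_space_heat_1)
  let ?H = "density lborel (\<lambda>y::'a. ennreal (heat 1 y))"
  have inner: "w x \<le> liminf (\<lambda>j. heat_fun (r j * t) (W j) (X j))" if t: "0 < t" for t
  proof -
    have "w x \<le> liminf (\<lambda>j. W j (X j + sqrt (r j * t) *\<^sub>R y))" for y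
    proof (rule W)
      have "(\<lambda>j. X j + sqrt (r j * t) *\<^sub>R y) \<longlonglongrightarrow> x + sqrt (0 * t) *\<^sub>R y"
        by (intro tendsto_intros X r)
      then show "(\<lambda>j. X j + sqrt (r j * t) *\<^sub>R y) \<longlonglongrightarrow> x" by simp
    qed
    then have "(\<integral>\<^sup>+ y. w x \<partial>?H) \<le> (\<integral>\<^sup>+ y. liminf (\<lambda>j. W j (X j + sqrt (r j * t) *\<^sub>R y)) \<partial>?H)"
      by (intro nn_integral_mono)
    also have "\<dots> \<le> liminf (\<lambda>j. \<integral>\<^sup>+ y. W j (X j + sqrt (r j * t) *\<^sub>R y) \<partial>?H)"
      by (rule nn_integral_liminf) measurable
    also have "\<dots> = liminf (\<lambda>j. heat_fun (r j * t) (W j) (X j))"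
      using t r by (simp add: heat_fun_eq_integral)
    finally show ?thesis by (simp add: H.emeasure_space_1[simplified])
  qed
  have "(\<integral>\<^sup>+ t. w x \<partial>unit_time \<alpha>) \<le> (\<integral>\<^sup>+ t. liminf (\<lambda>j. heat_fun (r j * t) (W j) (X j)) \<partial>unit_time \<alpha>)"
    by (rule nn_integral_mono_AE, use AE_unit_time in eventually_elim) (use inner in auto)
  also have "\<dots> \<le> liminf (\<lambda>j. \<integral>\<^sup>+ t. heat_fun (r j * t) (W j) (X j) \<partial>unit_time \<alpha>)"
    by (rule nn_integral_liminf) measurable
  finally show ?thesis by (simp add: heat_mean_def P.emeasure_space_1)
qed

text \<open>Replace 2 f(x) f(y) by f(x)^2 + f(y)^2 under the symmetric kernel, whose integral in
  each variable is 1.\<close>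

lemma heat_fun_contraction:
  assumes [measurable]: "f \<in> borel_measurable borel" and t: "0 < t"
  shows "(\<integral>\<^sup>+ x. heat_fun t f x * f x \<partial>lborel) \<le> (\<integral>\<^sup>+ x. f x * f (x::'a::euclidean_space) \<partial>lborel)"
proof -
  let ?h = "\<lambda>x y. ennreal (heat t (x - y :: 'a))"
  have "2 * (\<integral>\<^sup>+ x. heat_fun t f x * f x \<partial>lborel) = (\<integral>\<^sup>+ x. \<integral>\<^sup>+ y. ?h x y * (2 * (f x * f y)) \<partial>lborel \<partial>lborel)"
    unfolding heat_fun_def
    by (simp add: nn_integral_multc[symmetric] nn_integral_cmult[symmetric] mult_ac)
  also have "\<dots> \<le> (\<integral>\<^sup>+ x. \<integral>\<^sup>+ y. ?h x y * (f x * f x + f y * f y) \<partial>lborel \<partial>lborel)"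
    by (intro nn_integral_mono mult_left_mono two_mult_le_squares_ennreal) auto
  also have "\<dots> = (\<integral>\<^sup>+ x. \<integral>\<^sup>+ y. ?h x y * (f x * f x) \<partial>lborel \<partial>lborel) + (\<integral>\<^sup>+ x. \<integral>\<^sup>+ y. ?h x y * (f y * f y) \<partial>lborel \<partial>lborel)"
    by (simp add: distrib_left nn_integral_add)
  also have "(\<integral>\<^sup>+ x. \<integral>\<^sup>+ y. ?h x y * (f x * f x) \<partial>lborel \<partial>lborel) = (\<integral>\<^sup>+ x. f x * f x \<partial>lborel)"
    by (simp add: nn_integral_multc nn_integral_heat[OF t])
  also have "(\<integral>\<^sup>+ x. \<integral>\<^sup>+ y. ?h x y * (f y * f y) \<partial>lborel \<partial>lborel) = (\<integral>\<^sup>+ y. f y * f y \<partial>lborel)"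
  proof -
    have "(\<integral>\<^sup>+ x. \<integral>\<^sup>+ y. ?h x y * (f y * f y) \<partial>lborel \<partial>lborel) = (\<integral>\<^sup>+ y. \<integral>\<^sup>+ x. ?h y x * (f y * f y) \<partial>lborel \<partial>lborel)"
      by (subst nn_integral_swap) (auto simp: heat_minus_commute)
    then show ?thesis by (simp add: nn_integral_multc nn_integral_heat[OF t])
  qed
  finally show ?thesis
    by (simp add: ennreal_mult_le_mult_iff flip: mult_2)
qed

text \<open>The integral at time s + t is the pairing of g with its heat flow at time s, where g is
  the flow of M at time t/2; the contraction property applies to g.\<close>

lemma nn_integral_heat_flow_antimono:
  assumes M: "sf_borel M" and s: "0 < s" and t: "0 < t"
  shows "(\<integral>\<^sup>+ x. heat_flow (s + t) M x \<partial>M) \<le> (\<integral>\<^sup>+ x. heat_flow t M x \<partial>M)"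
proof -
  note [measurable] = borel_measurable_heat_flow[OF M]
  have "(\<integral>\<^sup>+ x. heat_flow (s + t) M x \<partial>M) = (\<integral>\<^sup>+ z. heat_flow (s + t / 2) M z * heat_flow (t / 2) M z \<partial>lborel)"
    using nn_integral_heat_flow_add[OF M M, of "s + t / 2" "t / 2"] s t by (simp add: add.commute[of t s])
  also have "\<dots> = (\<integral>\<^sup>+ z. heat_fun s (heat_flow (t / 2) M) z * heat_flow (t / 2) M z \<partial>lborel)"
    using t by (simp add: heat_fun_heat_flow[OF M s])
  also have "\<dots> \<le> (\<integral>\<^sup>+ z. heat_flow (t / 2) M z * heat_flow (t / 2) M z \<partial>lborel)"
    by (rule heat_fun_contraction[OF _ s]) measurable
  also have "\<dots> = (\<integral>\<^sup>+ x. heat_flow t M x \<partial>M)"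
    using nn_integral_heat_flow_add[OF M M, of "t / 2" "t / 2"] t by simp
  finally show ?thesis .
qed

lemma nn_integral_heat_fun_heat_mix_le:
  assumes M: "sf_borel M" and s: "0 < s"
  shows "(\<integral>\<^sup>+ x. heat_fun s (heat_mix (riesz_time \<alpha>) M) x \<partial>M) \<le> (\<integral>\<^sup>+ x. heat_mix (riesz_time \<alpha>) M x \<partial>M)"
proof -
  note [measurable] = borel_measurable_heat_flow[OF M]
  have "(\<integral>\<^sup>+ x. heat_fun s (heat_mix (riesz_time \<alpha>) M) x \<partial>M) = (\<integral>\<^sup>+ t. \<integral>\<^sup>+ x. heat_flow (s + t) M x \<partial>M \<partial>riesz_time \<alpha>)"
    unfolding heat_fun_heat_mix[OF sf_borel_riesz_time AE_riesz_time M s]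
    by (subst nn_integral_swap[OF M]) auto
  also have "\<dots> \<le> (\<integral>\<^sup>+ t. \<integral>\<^sup>+ x. heat_flow t M x \<partial>M \<partial>riesz_time \<alpha>)"
    by (intro nn_integral_riesz_time_mono nn_integral_heat_flow_antimono[OF M s])
  also have "\<dots> = (\<integral>\<^sup>+ x. heat_mix (riesz_time \<alpha>) M x \<partial>M)"
    unfolding heat_mix_def by (subst nn_integral_swap[OF M]) auto
  finally show ?thesis .
qed

section \<open>Lower semicontinuity of potentials and comparison of nearby heat kernels\<close>

lemma heat_flow_liminf:
  assumes M: "sf_borel M" and X: "X \<longlonglongrightarrow> x"
  shows "heat_flow t M x \<le> liminf (\<lambda>j. heat_flow t M (X j))"
proof -
  have m: "(\<lambda>y. ennreal (heat t (z - y))) \<in> borel_measurable M" for z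
    by (rule sf_borel_measurable1[OF M]) measurable
  have "(\<lambda>j. ennreal (heat t (X j - y))) \<longlonglongrightarrow> ennreal (heat t (x - y))" for y
    using X by (intro tendsto_ennrealI isCont_tendsto_compose[OF isCont_heat] tendsto_intros)
  then have "liminf (\<lambda>j. ennreal (heat t (X j - y))) = ennreal (heat t (x - y))" for y
    by (intro lim_imp_Liminf) auto
  then have "heat_flow t M x = (\<integral>\<^sup>+ y. liminf (\<lambda>j. ennreal (heat t (X j - y))) \<partial>M)"
    unfolding heat_flow_def by simp
  also have "\<dots> \<le> liminf (\<lambda>j. heat_flow t M (X j))"
    unfolding heat_flow_def by (rule nn_integral_liminf) (rule m)
  finally show ?thesis .
qed

lemma heat_mix_liminf:
  assumes M: "sf_borel M" and X: "X \<longlonglongrightarrow> x"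
  shows "heat_mix (riesz_time \<alpha>) M x \<le> liminf (\<lambda>j. heat_mix (riesz_time \<alpha>) M (X j))"
proof -
  note [measurable] = borel_measurable_heat_flow[OF M]
  have "heat_mix (riesz_time \<alpha>) M x \<le> (\<integral>\<^sup>+ t. liminf (\<lambda>j. heat_flow t M (X j)) \<partial>riesz_time \<alpha>)"
    unfolding heat_mix_def by (intro nn_integral_mono heat_flow_liminf[OF M X])
  also have "\<dots> \<le> liminf (\<lambda>j. heat_mix (riesz_time \<alpha>) M (X j))"
    unfolding heat_mix_def by (rule nn_integral_liminf) measurable
  finally show ?thesis .
qed

lemma heat_fun_heat:
  assumes "0 < s" "0 < t"
  shows "heat_fun s (\<lambda>x. ennreal (heat t x)) x = ennreal (heat (s + t) x)"
  unfolding heat_fun_def using heat_semigroup[OF assms, of x 0] by simp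

text \<open>The constants do not depend on s, so averaging the Gaussian over short times keeps it
  between fixed multiples of Gaussians, uniformly in r <= 1.\<close>

lemma heat_1_plus_bounds:
  fixes x :: "'a::euclidean_space"
  assumes "0 \<le> s" "s \<le> 1"
  shows "heat (s + 1) x \<le> 2 powr (real DIM('a) / 2) * heat 2 x"
    and "2 powr (- (real DIM('a) / 2)) * heat 1 x \<le> heat (s + 1) x"
proof -
  let ?n = "real DIM('a) / 2" and ?Z = "gauss_mass TYPE('a)"
  have Z: "?Z > 0" by (rule gauss_mass_pos)
  have "(s + 1) powr (- ?n) * exp (- (norm x)\<^sup>2 / (s + 1)) \<le> 1 * exp (- (norm x)\<^sup>2 / 2)"
  proof (intro mult_mono)
    have "(s + 1) powr (- ?n) \<le> (s + 1) powr 0" using assms by (intro powr_mono) auto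
    then show "(s + 1) powr (- ?n) \<le> 1" using assms by simp
    show "exp (- (norm x)\<^sup>2 / (s + 1)) \<le> exp (- (norm x)\<^sup>2 / 2)"
      using assms divide_left_mono[of "s + 1" 2 "(norm x)\<^sup>2"] by simp
  qed auto
  moreover have "2 powr ?n * 2 powr (- ?n) = (1::real)" by (simp add: powr_minus)
  ultimately show "heat (s + 1) x \<le> 2 powr ?n * heat 2 x"
    using Z by (simp add: heat_def divide_simps mult.assoc[symmetric])
  have "2 powr (- ?n) * exp (- (norm x)\<^sup>2) \<le> (s + 1) powr (- ?n) * exp (- (norm x)\<^sup>2 / (s + 1))"
  proof (intro mult_mono)
    show "2 powr (- ?n) \<le> (s + 1) powr (- ?n)"
      using assms by (intro powr_mono2') auto
    show "exp (- (norm x)\<^sup>2) \<le> exp (- (norm x)\<^sup>2 / (s + 1))"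
      using assms by (simp add: field_simps)
  qed auto
  then show "2 powr (- ?n) * heat 1 x \<le> heat (s + 1) x"
    using Z by (simp add: heat_def divide_simps)
qed

text \<open>The bound \<open>finite_heat_2\<close> makes G u integrable against the Gaussian
  \<open>\<tau>\<close>; thus G u is finite almost everywhere, and the pairing of b with
  \<open>\<tau>\<close> can be cancelled.\<close>

locale domination = renewal \<alpha> r F for \<alpha> r F +
  fixes M N :: "'a::euclidean_space measure"
  assumes alpha_pos: "0 < \<alpha>" and r_le: "r \<le> 1"
    and M: "sf_borel M" and N: "sf_borel N"
    and finite_energy: "(\<integral>\<^sup>+ x. heat_mix (riesz_time \<alpha>) M x \<partial>M) < \<infinity>"
    and finite_heat_2: "(\<integral>\<^sup>+ x. heat_mix (riesz_time \<alpha>) M x * ennreal (heat 2 x) \<partial>lborel) < \<infinity>"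
begin

abbreviation (input) "u \<equiv> heat_mix (riesz_time \<alpha>) M"
abbreviation (input) "w \<equiv> (\<lambda>x. min (heat_mix (riesz_time \<alpha>) M x) (heat_mix (riesz_time \<alpha>) N x))"
abbreviation (input) "m \<equiv> riesz_time_mass \<alpha> r"
abbreviation (input) "\<tau> \<equiv> (\<lambda>x::'a. ennreal (heat 1 x))"

lemmas [measurable] = borel_measurable_heat_mix[OF sf_borel_riesz_time M] borel_measurable_heat_mix[OF sf_borel_riesz_time N]
  borel_measurable_heat_mix[OF sf_borel_riesz_time_upto M] borel_measurable_heat_flow[OF M]
  borel_measurable_heat_mean[OF alpha_pos]

lemma m: "0 < m" "m < \<infinity>"
  using riesz_time_mass[OF alpha_pos r_pos] by auto

lemma G_\<tau>_bounds:
  "G \<tau> x \<le> m * (ennreal (2 powr (real DIM('a) / 2)) * ennreal (heat 2 x))"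
  "m * (ennreal (2 powr (- (real DIM('a) / 2))) * \<tau> x) \<le> G \<tau> x"
proof -
  have G: "G \<tau> x = (\<integral>\<^sup>+ t. ennreal (heat (t + 1) x) \<partial>riesz_time_upto \<alpha> r)"
    unfolding heat_fun_mix_def
    by (rule nn_integral_cong_AE, use AE_riesz_time_upto in eventually_elim) (simp add: heat_fun_heat)
  have c: "(\<integral>\<^sup>+ t. c \<partial>riesz_time_upto \<alpha> r) = m * c" for c
    by (subst nn_integral_riesz_time_upto) (auto simp: riesz_time_mass_def nn_integral_cmult mult.commute)
  have "G \<tau> x \<le> (\<integral>\<^sup>+ t. ennreal (2 powr (real DIM('a) / 2)) * ennreal (heat 2 x) \<partial>riesz_time_upto \<alpha> r)"
    unfolding G
    by (rule nn_integral_mono_AE, use AE_riesz_time_upto in eventually_elim)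
       (use heat_1_plus_bounds(1)[of _ x] r_le in \<open>auto simp: ennreal_mult'[symmetric] intro!: ennreal_leI\<close>)
  then show "G \<tau> x \<le> m * (ennreal (2 powr (real DIM('a) / 2)) * ennreal (heat 2 x))" by (simp only: c)
  have "(\<integral>\<^sup>+ t. ennreal (2 powr (- (real DIM('a) / 2))) * \<tau> x \<partial>riesz_time_upto \<alpha> r) \<le> G \<tau> x"
    unfolding G
    by (rule nn_integral_mono_AE, use AE_riesz_time_upto in eventually_elim)
       (use heat_1_plus_bounds(2)[of _ x] r_le in \<open>auto simp: ennreal_mult'[symmetric] intro!: ennreal_leI\<close>)
  then show "m * (ennreal (2 powr (- (real DIM('a) / 2))) * \<tau> x) \<le> G \<tau> x" by (simp only: c)
qed

lemma nn_integral_G_u_\<tau>: "(\<integral>\<^sup>+ x. G u x * \<tau> x \<partial>lborel) < \<infinity>"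
proof -
  have "(\<integral>\<^sup>+ x. G u x * \<tau> x \<partial>lborel) = (\<integral>\<^sup>+ x. u x * G \<tau> x \<partial>lborel)"
    by (rule nn_integral_heat_fun_mix_commute) auto
  also have "\<dots> \<le> (\<integral>\<^sup>+ x. (m * ennreal (2 powr (real DIM('a) / 2))) * (u x * ennreal (heat 2 x)) \<partial>lborel)"
    by (intro nn_integral_mono order_trans[OF mult_left_mono[OF G_\<tau>_bounds(1)]]) (auto simp: mult_ac)
  also have "\<dots> = (m * ennreal (2 powr (real DIM('a) / 2))) * (\<integral>\<^sup>+ x. u x * ennreal (heat 2 x) \<partial>lborel)"
    by (rule nn_integral_cmult) measurable
  also have "\<dots> < \<infinity>"
    using m finite_heat_2 by (simp add: ennreal_mult_less_top)
  finally show ?thesis .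
qed

lemma AE_G_u: "AE x in lborel. G u x < \<infinity>"
proof -
  have "AE x in lborel. G u x * \<tau> x \<noteq> \<infinity>"
    using nn_integral_G_u_\<tau> by (intro nn_integral_PInf_AE) auto
  then show ?thesis
  proof eventually_elim
    fix x :: 'a assume "G u x * \<tau> x \<noteq> \<infinity>"
    moreover have "\<tau> x \<noteq> 0" using heat_pos[of 1 x] by simp
    ultimately show "G u x < \<infinity>" by (auto simp: ennreal_mult_eq_top_iff less_top)
  qed
qed

text \<open>Smoothing does not increase the energy of M, and the two averages over short times
  contribute one factor m each.\<close>

lemma nn_integral_G_G_u_le: "(\<integral>\<^sup>+ x. G (G u) x \<partial>M) \<le> m * (m * (\<integral>\<^sup>+ x. u x \<partial>M))"
proof -
  let ?R = "riesz_time_upto \<alpha> r"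
  have c: "(\<integral>\<^sup>+ t. c \<partial>?R) = m * c" for c
    by (subst nn_integral_riesz_time_upto) (auto simp: riesz_time_mass_def nn_integral_cmult mult.commute)
  have "(\<integral>\<^sup>+ x. G (G u) x \<partial>M) = (\<integral>\<^sup>+ x. \<integral>\<^sup>+ s. \<integral>\<^sup>+ t. heat_fun (s + t) u x \<partial>?R \<partial>?R \<partial>M)"
    unfolding heat_fun_mix_def[of _ "G u"]
    by (rule nn_integral_cong, rule nn_integral_cong_AE, use AE_riesz_time_upto_pos in eventually_elim)
       (simp add: heat_fun_heat_fun_mix AE_riesz_time_upto_pos)
  also have "\<dots> = (\<integral>\<^sup>+ s. \<integral>\<^sup>+ x. \<integral>\<^sup>+ t. heat_fun (s + t) u x \<partial>?R \<partial>M \<partial>?R)"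
    by (rule nn_integral_swap[OF sf_borel_riesz_time_upto M])
       (auto simp: case_prod_beta' intro!: sf_borel_borel_measurable_nn_integral[OF sf_borel_riesz_time_upto])
  also have "\<dots> = (\<integral>\<^sup>+ s. \<integral>\<^sup>+ t. \<integral>\<^sup>+ x. heat_fun (s + t) u x \<partial>M \<partial>?R \<partial>?R)"
    by (intro nn_integral_cong nn_integral_swap[OF sf_borel_riesz_time_upto M]) auto
  also have "\<dots> \<le> (\<integral>\<^sup>+ s. \<integral>\<^sup>+ t. (\<integral>\<^sup>+ x. u x \<partial>M) \<partial>?R \<partial>?R)"
  proof (rule nn_integral_mono_AE, use AE_riesz_time_upto_pos in eventually_elim)
    fix s :: real assume s: "0 < s"
    show "(\<integral>\<^sup>+ t. \<integral>\<^sup>+ x. heat_fun (s + t) u x \<partial>M \<partial>?R) \<le> (\<integral>\<^sup>+ t. (\<integral>\<^sup>+ x. u x \<partial>M) \<partial>?R)"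
      by (rule nn_integral_mono_AE, use AE_riesz_time_upto_pos in eventually_elim)
         (use s in \<open>auto intro!: nn_integral_heat_fun_heat_mix_le[OF M]\<close>)
  qed
  also have "\<dots> = m * (m * (\<integral>\<^sup>+ x. u x \<partial>M))" by (simp only: c)
  finally show ?thesis .
qed

text \<open>The two time mixtures commute, since both only add their times to that of the
  flow.\<close>

lemma K_a_eq: "K (heat_mix (riesz_time_upto \<alpha> r) M) x = G u x"
proof -
  let ?R = "riesz_time_upto \<alpha> r"
  have "K (heat_mix ?R M) x = (\<integral>\<^sup>+ t. \<integral>\<^sup>+ s. heat_flow (t + s) M x \<partial>?R \<partial>riesz_time \<alpha>)"
    unfolding heat_fun_mix_def
    by (rule nn_integral_riesz_time_cong)
       (rule heat_fun_heat_mix[OF sf_borel_riesz_time_upto AE_riesz_time_upto_pos M])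
  also have "\<dots> = (\<integral>\<^sup>+ s. \<integral>\<^sup>+ t. heat_flow (s + t) M x \<partial>riesz_time \<alpha> \<partial>?R)"
    by (subst nn_integral_swap) (auto simp: add.commute)
  also have "\<dots> = G u x"
    unfolding heat_fun_mix_def
    by (rule nn_integral_cong_AE, use AE_riesz_time_upto_pos in eventually_elim)
       (simp add: heat_fun_heat_mix[OF sf_borel_riesz_time AE_riesz_time M])
  finally show ?thesis .
qed

text \<open>The energies of \<open>a\<close> and \<open>b\<close>, regularisations of \<open>M\<close> and of the measure whose potential is
  \<open>w\<close>, are compared after perturbing \<open>b\<close> by a multiple of \<open>\<tau>\<close>.\<close>

lemma main_inequality:
  assumes s: "0 < (s::real)"
  shows "(\<integral>\<^sup>+ x. heat_mean \<alpha> r (heat_mean \<alpha> r w) x \<partial>M)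
      + 2 * (ennreal s * (ennreal (2 powr (- (real DIM('a) / 2))) * (\<integral>\<^sup>+ x. (u x - w x) * \<tau> x \<partial>lborel)))
    \<le> (\<integral>\<^sup>+ x. u x \<partial>M) + ennreal s * (ennreal s * (\<integral>\<^sup>+ x. K \<tau> x * \<tau> x \<partial>lborel))"
proof -
  \<comment> \<open>By \<open>Q_heat_mix\<close> this is u - Q u wherever the tail Q u is
    finite.\<close>
  define a where "a = heat_mix (riesz_time_upto \<alpha> r) M"
  define b where "b x = w x - Q w x" for x
  have [measurable]: "a \<in> borel_measurable borel" "b \<in> borel_measurable borel"
    unfolding a_def b_def by measurable
  have Qw: "Q w x \<le> w x" for x
  proof -
    have "Q w x \<le> Q u x" "Q w x \<le> Q (heat_mix (riesz_time \<alpha>) N) x"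
      by (auto intro!: heat_fun_mix_mono)
    then show ?thesis
      using Q_heat_mix_le[OF M, of x] Q_heat_mix_le[OF N, of x] by (auto intro: order_trans)
  qed
  then have w: "w x = b x + Q w x" for x
    by (simp add: b_def diff_add_cancel_ennreal)
  have Kb_le: "K b x \<le> G w x" for x
    by (rule K_difference_le[OF M _ _ w]) auto
  have Kb_eq: "G u x < \<infinity> \<Longrightarrow> K b x = G w x" for x
    by (rule K_difference_eq[OF M _ _ w]) auto
  have Gw_le: "G w x \<le> G u x" for x by (intro heat_fun_mix_mono) auto
  have Ka: "K a x = G u x" for x unfolding a_def by (rule K_a_eq)
  define A where "A = (\<integral>\<^sup>+ x. K a x * a x \<partial>lborel)"
  define AB where "AB = (\<integral>\<^sup>+ x. K a x * b x \<partial>lborel)"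
  define B where "B = (\<integral>\<^sup>+ x. K b x * b x \<partial>lborel)"
  define Ta where "Ta = (\<integral>\<^sup>+ x. K a x * \<tau> x \<partial>lborel)"
  define Tb where "Tb = (\<integral>\<^sup>+ x. K b x * \<tau> x \<partial>lborel)"
  define T where "T = (\<integral>\<^sup>+ x. K \<tau> x * \<tau> x \<partial>lborel)"
  define e where "e = (\<integral>\<^sup>+ x. u x \<partial>M)"
  define X where "X = (\<integral>\<^sup>+ x. heat_mean \<alpha> r (heat_mean \<alpha> r w) x \<partial>M)"
  define D where "D = ennreal (2 powr (- (real DIM('a) / 2))) * (\<integral>\<^sup>+ x. (u x - w x) * \<tau> x \<partial>lborel)"
  have GM: "(\<integral>\<^sup>+ x. f x * a x \<partial>lborel) = (\<integral>\<^sup>+ x. G f x \<partial>M)" if [measurable]: "f \<in> borel_measurable borel" for f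
    unfolding a_def by (rule nn_integral_heat_fun_mix_measure[OF _ M, symmetric]) auto
  have A_le: "A \<le> m * (m * e)"
    unfolding A_def Ka e_def by (subst GM) (auto intro: nn_integral_G_G_u_le)
  have e_fin: "e < \<infinity>" using finite_energy by (simp add: e_def)
  have A_fin: "A < \<infinity>" using A_le e_fin m by (auto simp: ennreal_mult_less_top intro: le_less_trans)
  have AB_eq: "AB = (\<integral>\<^sup>+ x. K b x * a x \<partial>lborel)"
    unfolding AB_def by (subst nn_integral_heat_fun_mix_commute) (auto simp: mult.commute)
  \<comment> \<open>K b equals G w outside a Lebesgue null set, and pairing with \<open>a\<close> is
    integration of a further G against M; two normalisations then produce m^2.\<close>
  have AB_X: "AB = m * (m * X)"
  proof -
    have "AB = (\<integral>\<^sup>+ x. G w x * a x \<partial>lborel)"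
      unfolding AB_eq by (rule nn_integral_cong_AE, use AE_G_u in eventually_elim) (simp add: Kb_eq)
    also have "\<dots> = (\<integral>\<^sup>+ x. G (G w) x \<partial>M)" by (rule GM) measurable
    also have "\<dots> = (\<integral>\<^sup>+ x. m * (m * heat_mean \<alpha> r (heat_mean \<alpha> r w) x) \<partial>M)"
    proof (rule nn_integral_cong)
      fix x
      have "G (G w) x = m * heat_mean \<alpha> r (G w) x"
        by (rule heat_fun_mix_upto_eq[OF alpha_pos r_pos]) measurable
      also have "heat_mean \<alpha> r (G w) x = heat_mean \<alpha> r (\<lambda>x. m * heat_mean \<alpha> r w x) x"
        by (rule arg_cong[where f="\<lambda>f. heat_mean \<alpha> r f x"], rule ext) (rule heat_fun_mix_upto_eq[OF alpha_pos r_pos], measurable)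
      also have "\<dots> = m * heat_mean \<alpha> r (heat_mean \<alpha> r w) x"
        unfolding heat_mean_def[of _ _ "\<lambda>x. m * heat_mean \<alpha> r w x"] heat_mean_def[of _ _ "heat_mean \<alpha> r w"]
        by (subst heat_fun_cmult, measurable, rule nn_integral_cmult) measurable
      finally show "G (G w) x = m * (m * heat_mean \<alpha> r (heat_mean \<alpha> r w) x)" .
    qed
    also have "\<dots> = m * (m * X)"
    proof -
      have [measurable]: "heat_mean \<alpha> r (heat_mean \<alpha> r w) \<in> borel_measurable M"
        by (rule sf_borel_measurable1[OF M]) measurable
      show ?thesis unfolding X_def by (simp add: nn_integral_cmult)
    qed
    finally show ?thesis .
  qed
  have B_le: "B \<le> AB"
    unfolding B_def AB_def Ka by (intro nn_integral_mono mult_right_mono order_trans[OF Kb_le Gw_le]) auto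
  have AB_le: "AB \<le> A"
    unfolding AB_eq A_def Ka by (intro nn_integral_mono mult_right_mono order_trans[OF Kb_le Gw_le]) auto
  have Tb_le: "Tb \<le> (\<integral>\<^sup>+ x. G w x * \<tau> x \<partial>lborel)"
    unfolding Tb_def by (intro nn_integral_mono mult_right_mono Kb_le) auto
  also have "\<dots> \<le> (\<integral>\<^sup>+ x. G u x * \<tau> x \<partial>lborel)"
    by (intro nn_integral_mono mult_right_mono Gw_le) auto
  finally have Tb_fin: "Tb < \<infinity>" using nn_integral_G_u_\<tau> by (rule le_less_trans)
  \<comment> \<open>First-order effect of the perturbation: moving G to \<open>\<tau>\<close> leaves
    the integral of (u - w) G \<open>\<tau>\<close>, and G \<open>\<tau>\<close> is at least a
    multiple of m \<open>\<tau>\<close>.\<close>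
  have Ta_ge: "Tb + m * D \<le> Ta"
  proof -
    have "m * D = (\<integral>\<^sup>+ x. (u x - w x) * (m * (ennreal (2 powr (- (real DIM('a) / 2))) * \<tau> x)) \<partial>lborel)"
      unfolding D_def by (simp add: nn_integral_cmult[symmetric] mult_ac)
    also have "\<dots> \<le> (\<integral>\<^sup>+ x. (u x - w x) * G \<tau> x \<partial>lborel)"
      by (intro nn_integral_mono mult_left_mono G_\<tau>_bounds(2)) auto
    finally have mD: "m * D \<le> (\<integral>\<^sup>+ x. (u x - w x) * G \<tau> x \<partial>lborel)" .
    have "Tb \<le> (\<integral>\<^sup>+ x. w x * G \<tau> x \<partial>lborel)"
      using Tb_le by (subst (asm) nn_integral_heat_fun_mix_commute) auto
    then have "Tb + m * D \<le> (\<integral>\<^sup>+ x. w x * G \<tau> x \<partial>lborel) + (\<integral>\<^sup>+ x. (u x - w x) * G \<tau> x \<partial>lborel)"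
      using mD by (rule add_mono)
    also have "\<dots> = (\<integral>\<^sup>+ x. u x * G \<tau> x \<partial>lborel)"
      by (subst nn_integral_add[symmetric]) (auto simp: distrib_right[symmetric] add_diff_inverse_ennreal)
    also have "\<dots> = Ta"
      unfolding Ta_def Ka by (rule nn_integral_heat_fun_mix_commute[symmetric]) auto
    finally show ?thesis .
  qed
  \<comment> \<open>The step is proportional to m, so that the linear and quadratic terms have the
    order m^2 of the energies.\<close>
  define \<sigma> where "\<sigma> = m * ennreal s"
  have \<sigma>_fin: "\<sigma> < \<infinity>" using m by (simp add: \<sigma>_def ennreal_mult_less_top)
  have pos: "2 * (AB + \<sigma> * Ta) \<le> A + (B + 2 * (\<sigma> * Tb) + \<sigma> * (\<sigma> * T))"
  proof -
    let ?c = "\<lambda>x. b x + \<sigma> * \<tau> x"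
    have "2 * (\<integral>\<^sup>+ x. K a x * ?c x \<partial>lborel) \<le> (\<integral>\<^sup>+ x. K a x * a x \<partial>lborel) + (\<integral>\<^sup>+ x. K ?c x * ?c x \<partial>lborel)"
      by (rule energy_fun_pos) auto
    moreover have "(\<integral>\<^sup>+ x. K a x * ?c x \<partial>lborel) = AB + \<sigma> * Ta"
      unfolding AB_def Ta_def by (simp add: distrib_left nn_integral_add nn_integral_cmult mult.left_commute)
    moreover have "(\<integral>\<^sup>+ x. K ?c x * ?c x \<partial>lborel) = B + 2 * (\<sigma> * Tb) + \<sigma> * (\<sigma> * T)"
    proof -
      have "K ?c x = K b x + \<sigma> * K \<tau> x" for x
        by (simp add: heat_fun_mix_add heat_fun_mix_cmult)
      then have "(\<integral>\<^sup>+ x. K ?c x * ?c x \<partial>lborel)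
        = (\<integral>\<^sup>+ x. K b x * b x + (\<sigma> * (K b x * \<tau> x) + (\<sigma> * (K \<tau> x * b x) + \<sigma> * (\<sigma> * (K \<tau> x * \<tau> x)))) \<partial>lborel)"
        by (simp add: distrib_left distrib_right mult_ac add_ac)
      also have "\<dots> = B + (\<sigma> * Tb + (\<sigma> * (\<integral>\<^sup>+ x. K \<tau> x * b x \<partial>lborel) + \<sigma> * (\<sigma> * T)))"
        unfolding B_def Tb_def T_def by (simp add: nn_integral_add nn_integral_cmult)
      also have "(\<integral>\<^sup>+ x. K \<tau> x * b x \<partial>lborel) = Tb"
        unfolding Tb_def by (subst nn_integral_heat_fun_mix_commute) (auto simp: mult.commute)
      finally show ?thesis by (simp add: add.assoc mult_2)
    qed
    ultimately show ?thesis by (simp add: A_def)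
  qed
  have AB_fin: "AB < \<infinity>" using AB_le A_fin by (rule le_less_trans)
  \<comment> \<open>Both sides are arranged to share the finite summand AB + 2 \<sigma> Tb, which is
    then cancelled.\<close>
  have "(AB + 2 * (\<sigma> * Tb)) + (AB + 2 * (\<sigma> * (m * D))) = 2 * (AB + \<sigma> * (Tb + m * D))"
    by (simp add: mult_2 distrib_left add_ac)
  also have "\<dots> \<le> 2 * (AB + \<sigma> * Ta)"
    by (intro mult_left_mono add_left_mono Ta_ge) auto
  also note pos
  also have "A + (B + 2 * (\<sigma> * Tb) + \<sigma> * (\<sigma> * T)) \<le> A + (AB + 2 * (\<sigma> * Tb) + \<sigma> * (\<sigma> * T))"
    by (intro add_left_mono add_right_mono B_le)
  also have "\<dots> = (AB + 2 * (\<sigma> * Tb)) + (A + \<sigma> * (\<sigma> * T))" by (simp add: add_ac)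
  finally have "AB + 2 * (\<sigma> * (m * D)) \<le> A + \<sigma> * (\<sigma> * T)"
    using AB_fin Tb_fin \<sigma>_fin
    by (auto simp: ennreal_add_left_cancel_le ennreal_mult_eq_top_iff less_top[symmetric])
  then have "m * (m * (X + 2 * (ennreal s * D))) \<le> m * (m * (e + ennreal s * (ennreal s * T)))"
    using A_le unfolding AB_X \<sigma>_def by (auto simp: distrib_left mult_ac intro: order_trans add_right_mono)
  then have "X + 2 * (ennreal s * D) \<le> e + ennreal s * (ennreal s * T)"
    using m by (simp add: ennreal_mult_le_mult_iff)
  then show ?thesis by (simp add: X_def D_def e_def T_def)
qed

end

section \<open>Passage to the limit in the domination principle\<close>

context riesz begin

text \<open>By the semigroup law this is the time integral of the heat kernel at the origin, shifted
  by 2c. The shift removes the singularity at 0, and dimension above \<alpha> handles large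
  times.\<close>

lemma nn_integral_K_heat_1: "(\<integral>\<^sup>+ x. heat_fun_mix (riesz_time \<alpha>) (\<lambda>x::'a. ennreal (heat c x)) x * ennreal (heat c x) \<partial>lborel) < \<infinity>"
  if c: "0 < c" for c
proof -
  define d where "d = c + c"
  have d: "0 < d" using c by (simp add: d_def)
  obtain e :: 'a where e: "norm e = 1" using unit_basis by blast
  have "(\<integral>\<^sup>+ x. heat_fun_mix (riesz_time \<alpha>) (\<lambda>x::'a. ennreal (heat c x)) x * ennreal (heat c x) \<partial>lborel)
     = (\<integral>\<^sup>+ t. \<integral>\<^sup>+ x. heat_fun t (\<lambda>x::'a. ennreal (heat c x)) x * ennreal (heat c x) \<partial>lborel \<partial>riesz_time \<alpha>)"
    unfolding heat_fun_mix_def by (subst nn_integral_swap) (auto simp: nn_integral_multc)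
  also have "\<dots> = (\<integral>\<^sup>+ t. ennreal (heat (t + d) (0::'a)) \<partial>riesz_time \<alpha>)"
  proof (rule nn_integral_riesz_time_cong)
    fix t :: real assume t: "0 < t"
    have "(\<integral>\<^sup>+ x. heat_fun t (\<lambda>x::'a. ennreal (heat c x)) x * ennreal (heat c x) \<partial>lborel)
      = (\<integral>\<^sup>+ x. ennreal (heat (t + c) (0 - x)) * ennreal (heat c (x - (0::'a))) \<partial>lborel)"
      using t c by (intro nn_integral_cong) (simp add: heat_fun_heat heat_cong_norm[OF norm_minus_cancel])
    also have "\<dots> = ennreal (heat (t + c + c) (0 - (0::'a)))"
      using t c by (intro heat_semigroup) auto
    finally show "(\<integral>\<^sup>+ x. heat_fun t (\<lambda>x::'a. ennreal (heat c x)) x * ennreal (heat c x) \<partial>lborel)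
        = ennreal (heat (t + d) (0::'a))" by (simp add: d_def add.assoc)
  qed
  \<comment> \<open>For t > 1 the value at the origin is compared with that at a unit vector: they
    differ by exp(-1/t) >= exp(-1), whence the factor \<open>exp 1\<close>.\<close>
  also have "\<dots> \<le> (\<integral>\<^sup>+ t. ennreal (heat d (0::'a)) * indicator {..1} t + ennreal (exp 1) * ennreal (heat t e) \<partial>riesz_time \<alpha>)"
  proof (rule nn_integral_riesz_time_mono)
    fix t :: real assume t: "0 < t"
    let ?n = "real DIM('a) / 2" and ?Z = "gauss_mass TYPE('a)"
    have Z: "?Z > 0" by (rule gauss_mass_pos)
    show "ennreal (heat (t + d) (0::'a)) \<le> ennreal (heat d (0::'a)) * indicator {..1} t + ennreal (exp 1) * ennreal (heat t e)"
    proof (cases "t \<le> 1")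
      case True
      have "heat (t + d) (0::'a) \<le> heat d (0::'a)"
        using t d Z by (auto simp: heat_def intro!: divide_right_mono powr_mono2')
      then show ?thesis using True by (simp add: ennreal_leI add_increasing2)
    next
      case False
      have "heat (t + d) (0::'a) \<le> t powr (- ?n) / ?Z"
        using t d Z by (auto simp: heat_def intro!: divide_right_mono powr_mono2')
      also have "\<dots> \<le> exp 1 * heat t e"
      proof -
        have "1 \<le> exp 1 * exp (- 1 / t)"
          using False by (simp add: exp_add[symmetric])
        then have "t powr (- ?n) * 1 \<le> t powr (- ?n) * (exp 1 * exp (- 1 / t))"
          by (intro mult_left_mono) auto
        then show ?thesis using Z by (simp add: heat_def e divide_simps mult_ac)
      qed
      finally show ?thesis using False by (simp add: ennreal_mult'[symmetric] ennreal_leI)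
    qed
  qed
  also have "\<dots> = ennreal (heat d (0::'a)) * riesz_time_mass \<alpha> 1 + ennreal (exp 1) * (\<integral>\<^sup>+ t. ennreal (heat t e) \<partial>riesz_time \<alpha>)"
    by (simp add: nn_integral_add nn_integral_cmult riesz_time_mass_def)
  also have "\<dots> < \<infinity>"
    using riesz_time_mass_1[OF alpha_pos] heat_integral_unit_less_top[OF e]
    by (simp add: ennreal_mult_less_top)
  finally show ?thesis .
qed

text \<open>In the limit r -> 0 the averaged term of \<open>main_inequality\<close> is at least the
  integral of w, which equals that of u for M. What remains is 2 s D <= s^2 T for all s > 0, hence D
  = 0 and u <= v Lebesgue almost everywhere.\<close>

theorem heat_mix_domination:
  fixes M N :: "'a measure"
  assumes M: "sf_borel M" and N: "sf_borel N"
    and fin: "(\<integral>\<^sup>+ x. heat_mix (riesz_time \<alpha>) M x \<partial>M) < \<infinity>"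
    and fin2: "(\<integral>\<^sup>+ x. heat_mix (riesz_time \<alpha>) M x * ennreal (heat 2 x) \<partial>lborel) < \<infinity>"
    and le: "AE x in M. heat_mix (riesz_time \<alpha>) M x \<le> heat_mix (riesz_time \<alpha>) N x"
  shows "heat_mix (riesz_time \<alpha>) M x \<le> heat_mix (riesz_time \<alpha>) N x"
proof -
  define u where "u = heat_mix (riesz_time \<alpha>) M"
  define v where "v = heat_mix (riesz_time \<alpha>) N"
  define w where "w x = min (u x) (v x)" for x
  note [measurable] = borel_measurable_heat_flow[OF M] borel_measurable_heat_flow[OF N]
  have [measurable]: "u \<in> borel_measurable borel" "v \<in> borel_measurable borel" "w \<in> borel_measurable borel"
    unfolding w_def u_def v_def using borel_measurable_heat_mix[OF sf_borel_riesz_time M] borel_measurable_heat_mix[OF sf_borel_riesz_time N]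
    by auto
  define r where "r j = inverse (real (Suc j))" for j
  have r: "0 < r j" "r j \<le> 1" for j by (auto simp: r_def field_simps)
  have r_lim: "r \<longlonglongrightarrow> 0" unfolding r_def by (rule LIMSEQ_inverse_real_of_nat)
  have "\<exists>F. renewal \<alpha> (r j) F" for j
  proof (rule riesz_time_renewal[OF alpha_pos alpha_le r(1)[of j]])
    fix F
    assume F: "sf_borel F" "AE s in F. r j \<le> s"
      "\<And>h. h \<in> borel_measurable borel \<Longrightarrow> (\<integral>\<^sup>+ t. h t \<partial>riesz_time \<alpha>)
        = (\<integral>\<^sup>+ t. h t * indicator {..r j} t \<partial>riesz_time \<alpha>) + (\<integral>\<^sup>+ s. \<integral>\<^sup>+ t. h (s + t) \<partial>riesz_time \<alpha> \<partial>F)"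
    have "renewal \<alpha> (r j) F" by (rule renewal.intro[OF r(1) F])
    then show ?thesis ..
  qed
  then obtain F where F: "\<And>j. renewal \<alpha> (r j) (F j)" by metis
  define D where "D = ennreal (2 powr (- (real DIM('a) / 2))) * (\<integral>\<^sup>+ x. (u x - w x) * ennreal (heat 1 x) \<partial>lborel)"
  define T where "T = (\<integral>\<^sup>+ x. heat_fun_mix (riesz_time \<alpha>) (\<lambda>x::'a. ennreal (heat 1 x)) x * ennreal (heat 1 x) \<partial>lborel)"
  have T: "T < \<infinity>" unfolding T_def by (rule nn_integral_K_heat_1) simp
  define e where "e = (\<integral>\<^sup>+ x. u x \<partial>M)"
  have e: "e < \<infinity>" using fin by (simp add: e_def u_def)
  have main: "(\<integral>\<^sup>+ x. heat_mean \<alpha> (r j) (heat_mean \<alpha> (r j) w) x \<partial>M) + 2 * (ennreal s * D) \<le> e + ennreal s * (ennreal s * T)"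
    if s: "0 < s" for s j
  proof -
    interpret domination \<alpha> "r j" "F j" M N
      using F[of j] by (intro domination.intro domination_axioms.intro alpha_pos r M N fin fin2)
    show ?thesis using main_inequality[OF s] by (simp add: D_def T_def e_def u_def v_def w_def[abs_def])
  qed
  have w_lsc: "w x \<le> liminf (\<lambda>j. w (X j))" if X: "X \<longlonglongrightarrow> x" for X x
  proof (subst le_Liminf_iff, intro allI impI)
    fix y assume y: "y < w x"
    have "u x \<le> liminf (\<lambda>j. u (X j))" "v x \<le> liminf (\<lambda>j. v (X j))"
      unfolding u_def v_def using heat_mix_liminf[OF M X] heat_mix_liminf[OF N X] by auto
    moreover have "y < u x" "y < v x" using y by (auto simp: w_def)
    ultimately have "eventually (\<lambda>j. y < u (X j)) sequentially" "eventually (\<lambda>j. y < v (X j)) sequentially"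
      by (auto simp: le_Liminf_iff)
    then show "eventually (\<lambda>j. y < w (X j)) sequentially"
      by eventually_elim (simp add: w_def)
  qed
  have mean1: "w x \<le> liminf (\<lambda>j. heat_mean \<alpha> (r j) w (X j))" if X: "X \<longlonglongrightarrow> x" for X x
    by (rule heat_mean_Fatou[OF alpha_pos r(1) r_lim _ w_lsc X]) measurable
  \<comment> \<open>A second application of the same Fatou argument, with the first means as the
    moving functions.\<close>
  have mean2: "w x \<le> liminf (\<lambda>j. heat_mean \<alpha> (r j) (heat_mean \<alpha> (r j) w) x)" for x
    by (rule heat_mean_Fatou[OF alpha_pos r(1) r_lim _ mean1 tendsto_const]) (use alpha_pos in measurable)
  have e_w: "e \<le> (\<integral>\<^sup>+ x. w x \<partial>M)"
    unfolding e_def by (rule nn_integral_mono_AE, use le in eventually_elim) (simp add: w_def u_def v_def)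
  also have "\<dots> \<le> (\<integral>\<^sup>+ x. liminf (\<lambda>j. heat_mean \<alpha> (r j) (heat_mean \<alpha> (r j) w) x) \<partial>M)"
    by (intro nn_integral_mono mean2)
  also have "\<dots> \<le> liminf (\<lambda>j. \<integral>\<^sup>+ x. heat_mean \<alpha> (r j) (heat_mean \<alpha> (r j) w) x \<partial>M)"
    by (rule nn_integral_liminf, rule sf_borel_measurable1[OF M]) (use alpha_pos in measurable)
  finally have lim: "e \<le> liminf (\<lambda>j. \<integral>\<^sup>+ x. heat_mean \<alpha> (r j) (heat_mean \<alpha> (r j) w) x \<partial>M)" .
  \<comment> \<open>The j-dependent term lies below a constant for every j, hence so does its lower
    limit; finiteness of \<open>e\<close> allows the cancellation.\<close>
  have D_le: "2 * D \<le> ennreal s * T" if s: "0 < s" for s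
  proof -
    define c where "c = e + ennreal s * (ennreal s * T)"
    have c: "c < \<infinity>" using e T by (simp add: c_def ennreal_mult_less_top)
    have *: "(\<integral>\<^sup>+ x. heat_mean \<alpha> (r j) (heat_mean \<alpha> (r j) w) x \<partial>M) \<le> c - 2 * (ennreal s * D)" for j
      using main[OF s, of j] c
      by (subst ennreal_le_minus_iff) (auto simp: c_def add.commute intro: order_trans[OF _ main[OF s, of j]] add_increasing)
    have "e \<le> c - 2 * (ennreal s * D)"
      using lim by (rule order_trans) (rule Liminf_le, auto intro!: always_eventually *)
    moreover have "2 * (ennreal s * D) \<le> c"
      using main[OF s, of 0] unfolding c_def by (rule order_trans[rotated]) (simp add: add_increasing)
    ultimately have "e + 2 * (ennreal s * D) \<le> c"
      by (metis add.commute add_left_mono diff_add_cancel_ennreal)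
    then have "2 * (ennreal s * D) \<le> ennreal s * (ennreal s * T)"
      using e unfolding c_def by (auto simp: ennreal_add_left_cancel_le)
    then have "ennreal s * (2 * D) \<le> ennreal s * (ennreal s * T)" by (simp add: mult_ac)
    then show ?thesis using s by (subst (asm) ennreal_mult_le_mult_iff) auto
  qed
  have "2 * D \<le> 0 + ennreal \<epsilon>" if \<epsilon>: "0 < \<epsilon>" for \<epsilon>
  proof -
    obtain t where t: "T = ennreal t" "0 \<le> t" using T by (cases T) auto
    have "2 * D \<le> ennreal (\<epsilon> / (t + 1)) * T" using t \<epsilon> by (intro D_le) auto
    also have "\<dots> = ennreal (\<epsilon> / (t + 1) * t)" unfolding t(1) by (rule ennreal_mult''[OF t(2), symmetric])
    also have "\<dots> \<le> ennreal \<epsilon>" using t \<epsilon> by (intro ennreal_leI) (simp add: field_simps)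
    finally show ?thesis by simp
  qed
  then have "2 * D \<le> 0" by (rule ennreal_le_epsilon)
  then have "(\<integral>\<^sup>+ x. (u x - w x) * ennreal (heat 1 x) \<partial>lborel) = 0" by (simp add: D_def)
  then have "AE x in lborel. (u x - w x) * ennreal (heat 1 x) = 0"
    by (subst (asm) nn_integral_0_iff_AE) auto
  then have uv: "AE x in lborel. u x \<le> v x"
  proof eventually_elim
    fix x :: 'a assume "(u x - w x) * ennreal (heat 1 x) = 0"
    then have "u x - w x = 0" using heat_pos[of 1 x] by auto
    then have "u x \<le> w x" by (cases "u x"; cases "w x") (auto simp: ennreal_minus ennreal_eq_0_iff top_unique)
    then show "u x \<le> v x" by (simp add: w_def)
  qed
  \<comment> \<open>From almost everywhere to everywhere: the tail of u at x is Q u, an integral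
    against Lebesgue densities that does not see null sets, and Q v <= v holds at every
    point.\<close>
  have tail: "(\<integral>\<^sup>+ t. heat_flow t M x * indicator {r j<..} t \<partial>riesz_time \<alpha>) \<le> v x" for j
  proof -
    interpret renewal \<alpha> "r j" "F j" by (rule F)
    have "heat_fun t u x \<le> heat_fun t v x" for t
      unfolding heat_fun_def by (rule nn_integral_mono_AE, use uv in eventually_elim) (auto intro: mult_left_mono)
    then have "heat_fun_mix (F j) u x \<le> heat_fun_mix (F j) v x"
      unfolding heat_fun_mix_def by (intro nn_integral_mono)
    also have "\<dots> \<le> v x" unfolding v_def by (rule Q_heat_mix_le[OF N])
    finally show ?thesis unfolding u_def Q_heat_mix[OF M] .
  qed
  have "heat_mix (riesz_time \<alpha>) M x \<le> (\<integral>\<^sup>+ t. liminf (\<lambda>j. heat_flow t M x * indicator {r j<..} t) \<partial>riesz_time \<alpha>)"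
    unfolding heat_mix_def
  proof (rule nn_integral_riesz_time_mono)
    fix t :: real assume "0 < t"
    then have "eventually (\<lambda>j. r j < t) sequentially" using r_lim by (simp add: order_tendsto_iff)
    then have "eventually (\<lambda>j. heat_flow t M x \<le> heat_flow t M x * indicator {r j<..} t) sequentially"
      by eventually_elim simp
    then show "heat_flow t M x \<le> liminf (\<lambda>j. heat_flow t M x * indicator {r j<..} t)"
      by (rule Liminf_bounded)
  qed
  also have "\<dots> \<le> liminf (\<lambda>j. \<integral>\<^sup>+ t. heat_flow t M x * indicator {r j<..} t \<partial>riesz_time \<alpha>)"
    by (rule nn_integral_liminf) measurable
  also have "\<dots> \<le> v x" by (rule Liminf_le, auto intro!: always_eventually tail)
  finally show ?thesis by (simp add: v_def)
qed

end

section \<open>Vague compactness\<close>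

text \<open>Schoenberg's space-filling curve. Of the step function only the following is used: it is continuous
  with period 2, equal to \<open>0\<close> on \<open>[0, 1/3]\<close> and to \<open>1\<close> on \<open>[2/3, 1]\<close>.\<close>

definition schoenberg_step :: "real \<Rightarrow> real" where
  "schoenberg_step t = max 0 (min 1 (1 / 2 - cos (pi * t)))"

lemma schoenberg_step_bounds: "0 \<le> schoenberg_step t" "schoenberg_step t \<le> 1"
  by (auto simp: schoenberg_step_def)

lemma continuous_on_schoenberg_step [continuous_intros]:
  fixes f :: "'a::t2_space \<Rightarrow> real"
  shows "continuous_on S f \<Longrightarrow> continuous_on S (\<lambda>x. schoenberg_step (f x))"
  unfolding schoenberg_step_def by (intro continuous_intros continuous_on_cos)

lemma schoenberg_step_periodic: "schoenberg_step (2 * real m + t) = schoenberg_step t"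
proof -
  have "cos (pi * (2 * real m + t)) = cos (pi * t + 2 * pi * real m)" by (simp add: algebra_simps)
  also have "\<dots> = cos (pi * t)"
  proof -
    have "cos (2 * pi * real m) = 1" "sin (2 * pi * real m) = 0"
      using cos_2npi[of m] sin_2npi[of m] by (simp_all add: mult_ac)
    then show ?thesis by (simp only: cos_add)
  qed
  finally show ?thesis by (simp add: schoenberg_step_def)
qed

lemma schoenberg_step_0: "0 \<le> t \<Longrightarrow> t \<le> 1 / 3 \<Longrightarrow> schoenberg_step t = 0"
  using cos_monotone_0_pi_le[of "pi * t" "pi / 3"] by (simp add: schoenberg_step_def cos_60)

lemma schoenberg_step_1:
  assumes "2 / 3 \<le> t" "t \<le> 1"
  shows "schoenberg_step t = 1"
proof -
  have "cos (pi * (2 / 3)) = - 1 / 2"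
    using cos_120 by (simp add: mult.commute)
  moreover have "cos (pi * t) \<le> cos (pi * (2 / 3))"
    using assms by (intro cos_monotone_0_pi_le) auto
  ultimately show ?thesis by (simp add: schoenberg_step_def)
qed

text \<open>Coordinate i reads the ternary positions congruent to i modulo n and takes them as
  binary digits.\<close>

definition schoenberg_coord :: "nat \<Rightarrow> nat \<Rightarrow> real \<Rightarrow> real" where
  "schoenberg_coord n i t = (\<Sum>k. (1 / 2) ^ Suc k * schoenberg_step (3 ^ (n * k + i) * t))"

lemma continuous_on_schoenberg_coord: "continuous_on UNIV (schoenberg_coord n i)"
proof -
  have "uniform_limit UNIV (\<lambda>N t. \<Sum>k<N. (1 / 2) ^ Suc k * schoenberg_step (3 ^ (n * k + i) * t))
      (\<lambda>t. \<Sum>k. (1 / 2) ^ Suc k * schoenberg_step (3 ^ (n * k + i) * t)) sequentially"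
  proof (rule Weierstrass_m_test)
    show "norm ((1 / 2) ^ Suc k * schoenberg_step (3 ^ (n * k + i) * t)) \<le> (1 / 2) ^ Suc k" for k and t :: real
      using schoenberg_step_bounds[of "3 ^ (n * k + i) * t"] by (simp add: abs_mult mult_left_le)
    show "summable (\<lambda>k. (1 / 2 :: real) ^ Suc k)"
      by (subst summable_Suc_iff) (simp add: summable_geometric)
  qed
  then show ?thesis unfolding schoenberg_coord_def[abs_def]
    by (rule uniform_limit_theorem[rotated]) (auto intro!: always_eventually continuous_intros)
qed

lemma binary_expansion:
  assumes "0 \<le> y" "y < (1::real)"
  obtains d :: "nat \<Rightarrow> nat" where "\<And>k. d k \<le> 1" "(\<lambda>k. (1 / 2) ^ Suc k * real (d k)) sums y"
proof -
  \<comment> \<open>The k-th binary digit as a difference of truncations, so that the partial sums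
    telescope.\<close>
  define D where "D k = \<lfloor>2 ^ Suc k * y\<rfloor> - 2 * \<lfloor>2 ^ k * y\<rfloor>" for k :: nat
  have D: "0 \<le> D k" "D k \<le> 1" for k
  proof -
    have "2 * \<lfloor>2 ^ k * y\<rfloor> \<le> \<lfloor>2 * (2 ^ k * y)\<rfloor>" by linarith
    moreover have "\<lfloor>2 * (2 ^ k * y)\<rfloor> \<le> 2 * \<lfloor>2 ^ k * y\<rfloor> + 1" by linarith
    ultimately show "0 \<le> D k" "D k \<le> 1" by (simp_all add: D_def mult.assoc)
  qed
  have part: "(\<Sum>k<N. (1 / 2) ^ Suc k * real_of_int (D k)) = real_of_int \<lfloor>2 ^ N * y\<rfloor> / 2 ^ N" for N
  proof (induction N)
    case 0
    have "\<lfloor>y\<rfloor> = 0" using assms by (simp add: floor_eq_iff)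
    then show ?case by simp
  next
    case (Suc N)
    then show ?case by (simp add: D_def field_simps power_one_over)
  qed
  have "(\<lambda>N. real_of_int \<lfloor>2 ^ N * y\<rfloor> / 2 ^ N) \<longlonglongrightarrow> y"
  proof (rule real_tendsto_sandwich)
    show "eventually (\<lambda>N. y - (1 / 2) ^ N \<le> real_of_int \<lfloor>2 ^ N * y\<rfloor> / 2 ^ N) sequentially"
    proof (intro always_eventually allI)
      fix N :: nat
      have "2 ^ N * y - 1 \<le> real_of_int \<lfloor>2 ^ N * y\<rfloor>" by linarith
      then have "(2 ^ N * y - 1) / 2 ^ N \<le> real_of_int \<lfloor>2 ^ N * y\<rfloor> / 2 ^ N"
        by (intro divide_right_mono) auto
      then show "y - (1 / 2) ^ N \<le> real_of_int \<lfloor>2 ^ N * y\<rfloor> / 2 ^ N"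
        by (simp add: diff_divide_distrib power_one_over)
    qed
    show "eventually (\<lambda>N. real_of_int \<lfloor>2 ^ N * y\<rfloor> / 2 ^ N \<le> y) sequentially"
    proof (intro always_eventually allI)
      fix N :: nat
      have "real_of_int \<lfloor>2 ^ N * y\<rfloor> \<le> 2 ^ N * y" by linarith
      then show "real_of_int \<lfloor>2 ^ N * y\<rfloor> / 2 ^ N \<le> y" by (simp add: field_simps)
    qed
    have "(\<lambda>N. (1 / 2 :: real) ^ N) \<longlonglongrightarrow> 0" by (rule LIMSEQ_power_zero) simp
    from tendsto_diff[OF tendsto_const this, of y] show "(\<lambda>N. y - (1 / 2) ^ N) \<longlonglongrightarrow> y" by simp
  qed simp
  then have "(\<lambda>k. (1 / 2) ^ Suc k * real_of_int (D k)) sums y"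
    unfolding sums_def part .
  moreover have "real_of_int (D k) = real (nat (D k))" for k using D by simp
  ultimately have "(\<lambda>k. (1 / 2) ^ Suc k * real (nat (D k))) sums y" by (simp only:)
  moreover have "nat (D k) \<le> 1" for k using D(2)[of k] by simp
  ultimately show ?thesis by (intro that)
qed

text \<open>For a Cantor number with ternary digits 2 \<open>a j\<close>, multiplication by 3^m puts
  digit m first after the point; the first third means digit 0, the last third digit 1.\<close>

lemma schoenberg_digit:
  fixes a :: "nat \<Rightarrow> nat"
  assumes a: "\<And>m. a m \<le> 1"
  shows "schoenberg_step (3 ^ m * (\<Sum>j. 2 * real (a j) * (1 / 3) ^ Suc j)) = real (a m)"
    and "(\<Sum>j. 2 * real (a j) * (1 / 3) ^ Suc j) \<in> {0..1}"
proof -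
  have geo: "summable (\<lambda>j. (1 / 3 :: real) ^ Suc j)" "(\<Sum>j. (1 / 3 :: real) ^ Suc j) = 1 / 2"
    using sums_mult[OF geometric_sums[of "1 / 3 :: real"], of "1 / 3"] by (auto simp: sums_iff)
  have bound: "2 * real (b j) * (1 / 3) ^ Suc j \<le> 2 * (1 / 3) ^ Suc j" if "\<And>m. b m \<le> 1" for b :: "nat \<Rightarrow> nat" and j
    using that[of j] by simp
  have sm: "summable (\<lambda>j. 2 * real (b j) * (1 / 3) ^ Suc j)" if b: "\<And>m. b m \<le> 1" for b :: "nat \<Rightarrow> nat"
    by (rule summable_comparison_test'[OF summable_mult[OF geo(1), of 2], of 0]) (use bound[of b, OF b] in simp)
  have rng: "0 \<le> (\<Sum>j. 2 * real (b j) * (1 / 3) ^ Suc j)" "(\<Sum>j. 2 * real (b j) * (1 / 3) ^ Suc j) \<le> 1"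
    if b: "\<And>m. b m \<le> 1" for b :: "nat \<Rightarrow> nat"
  proof -
    show "0 \<le> (\<Sum>j. 2 * real (b j) * (1 / 3) ^ Suc j)" by (intro suminf_nonneg sm b) auto
    have "(\<Sum>j. 2 * real (b j) * (1 / 3) ^ Suc j) \<le> (\<Sum>j. 2 * (1 / 3 :: real) ^ Suc j)"
      by (intro suminf_le sm b bound summable_mult geo)
    also have "\<dots> = 2 * (1 / 2)" by (simp only: suminf_mult[OF geo(1)] geo(2))
    also have "\<dots> = 1" by simp
    finally show "(\<Sum>j. 2 * real (b j) * (1 / 3) ^ Suc j) \<le> 1" .
  qed
  show "(\<Sum>j. 2 * real (a j) * (1 / 3) ^ Suc j) \<in> {0..1}" using rng[OF a] by simp
  define s where "s = (\<Sum>j. 2 * real (a (j + m)) * (1 / 3) ^ Suc j)"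
  have "(\<Sum>j. 2 * real (a j) * (1 / 3) ^ Suc j) = (\<Sum>j. 2 * real (a (j + m)) * (1 / 3) ^ Suc (j + m)) + (\<Sum>j<m. 2 * real (a j) * (1 / 3) ^ Suc j)"
    by (rule suminf_split_initial_segment) (rule sm[OF a])
  also have "(\<Sum>j. 2 * real (a (j + m)) * (1 / 3) ^ Suc (j + m)) = (\<Sum>j. (1 / 3) ^ m * (2 * real (a (j + m)) * (1 / 3) ^ Suc j))"
    by (simp add: power_add mult_ac)
  also have "\<dots> = (1 / 3) ^ m * s"
    unfolding s_def by (rule suminf_mult) (rule sm[of "\<lambda>j. a (j + m)", OF a])
  finally have "3 ^ m * (\<Sum>j. 2 * real (a j) * (1 / 3) ^ Suc j) = 3 ^ m * (\<Sum>j<m. 2 * real (a j) * (1 / 3) ^ Suc j) + s"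
    by (simp add: distrib_left power_one_over)
  \<comment> \<open>The digits moved before the point are all even, so they form an even integer,
    invisible to a function of period 2.\<close>
  also have "3 ^ m * (\<Sum>j<m. 2 * real (a j) * (1 / 3) ^ Suc j) = 2 * real (\<Sum>j<m. a j * 3 ^ (m - Suc j))"
  proof -
    have "3 ^ m * (2 * real (a j) * (1 / 3) ^ Suc j) = 2 * real (a j * 3 ^ (m - Suc j))" if "j < m" for j
    proof -
      have "(3::real) ^ m = 3 ^ (m - Suc j) * 3 ^ Suc j"
        using that by (simp only: power_add[symmetric]) simp
      then show ?thesis by (simp add: power_one_over del: power_Suc)
    qed
    then have "(\<Sum>j<m. 3 ^ m * (2 * real (a j) * (1 / 3) ^ Suc j)) = (\<Sum>j<m. 2 * real (a j * 3 ^ (m - Suc j)))"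
      by (intro sum.cong refl) (simp only: lessThan_iff)
    then show ?thesis by (simp only: sum_distrib_left of_nat_sum)
  qed
  finally have "schoenberg_step (3 ^ m * (\<Sum>j. 2 * real (a j) * (1 / 3) ^ Suc j)) = schoenberg_step s"
    by (simp only: schoenberg_step_periodic)
  also have "\<dots> = real (a m)"
  proof -
    define q where "q = (\<Sum>j. 2 * real (a (Suc j + m)) * (1 / 3) ^ Suc j)"
    have q: "0 \<le> q" "q \<le> 1" unfolding q_def using rng[of "\<lambda>j. a (Suc j + m)", OF a] by auto
    have "s = (\<Sum>j. 2 * real (a (Suc j + m)) * (1 / 3) ^ Suc (Suc j)) + 2 * real (a (0 + m)) * (1 / 3) ^ Suc 0"
      unfolding s_def using suminf_split_head[OF sm[of "\<lambda>j. a (j + m)", OF a]] by simp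
    also have "(\<Sum>j. 2 * real (a (Suc j + m)) * (1 / 3) ^ Suc (Suc j)) = (\<Sum>j. (1 / 3) * (2 * real (a (Suc j + m)) * (1 / 3) ^ Suc j))"
      by (simp add: mult_ac)
    also have "\<dots> = (1 / 3) * q"
      unfolding q_def by (rule suminf_mult) (rule sm[of "\<lambda>j. a (Suc j + m)", OF a])
    finally have s: "s = q / 3 + 2 * real (a m) / 3" by simp
    consider "a m = 0" | "a m = 1" using a[of m] by linarith
    then show ?thesis
      by cases (use q s in \<open>auto intro!: schoenberg_step_0 schoenberg_step_1\<close>)
  qed
  finally show "schoenberg_step (3 ^ m * (\<Sum>j. 2 * real (a j) * (1 / 3) ^ Suc j)) = real (a m)" .
qed

text \<open>The binary digits of all n coordinates are interleaved into one Cantor number: position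
  m holds digit \<open>m div n\<close> of coordinate \<open>m mod n\<close>.\<close>

lemma schoenberg_surj:
  assumes n: "0 < n" and y: "\<And>i. i < n \<Longrightarrow> 0 \<le> y i \<and> y i < (1::real)"
  obtains t where "t \<in> {0..1}" "\<And>i. i < n \<Longrightarrow> schoenberg_coord n i t = y i"
proof -
  have "\<exists>d :: nat \<Rightarrow> nat. (\<forall>k. d k \<le> 1) \<and> (i < n \<longrightarrow> (\<lambda>k. (1 / 2) ^ Suc k * real (d k)) sums y i)" for i
  proof (cases "i < n")
    case True
    then obtain d :: "nat \<Rightarrow> nat" where "\<And>k. d k \<le> 1" "(\<lambda>k. (1 / 2) ^ Suc k * real (d k)) sums y i"
      using y[OF True] binary_expansion[of "y i"] by metis
    then show ?thesis by blast
  next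
    case False
    then show ?thesis by (intro exI[of _ "\<lambda>_. 0"]) auto
  qed
  then obtain d :: "nat \<Rightarrow> nat \<Rightarrow> nat" where d: "\<And>i k. d i k \<le> 1"
    "\<And>i. i < n \<Longrightarrow> (\<lambda>k. (1 / 2) ^ Suc k * real (d i k)) sums y i"
    by metis
  define a where "a m = d (m mod n) (m div n)" for m
  have a: "a m \<le> 1" for m unfolding a_def by (rule d)
  define t where "t = (\<Sum>j. 2 * real (a j) * (1 / 3) ^ Suc j)"
  show ?thesis
  proof (rule that)
    show "t \<in> {0..1}" unfolding t_def by (rule schoenberg_digit[OF a])
    fix i assume i: "i < n"
    have "schoenberg_step (3 ^ (n * k + i) * t) = real (d i k)" for k
      unfolding t_def schoenberg_digit(1)[OF a] using i by (simp add: a_def)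
    then show "schoenberg_coord n i t = y i"
      unfolding schoenberg_coord_def using d(2)[OF i] by (simp add: sums_iff)
  qed
qed

text \<open>The unit cube is stretched to [-1,1]^n, which contains the ball. At t = 0 all
  coordinates are -1, which provides a parameter outside the open ball where surplus mass can be
  parked.\<close>

lemma continuous_curve_onto_ball:
  obtains c :: "real \<Rightarrow> 'a::euclidean_space" where "continuous_on UNIV c" "1 \<le> norm (c 0)"
    "\<And>y. norm y < 1 \<Longrightarrow> \<exists>t\<in>{0..1}. c t = y"
proof -
  obtain idx where idx: "bij_betw idx (Basis :: 'a set) {0..<DIM('a)}"
    using ex_bij_betw_finite_nat[OF finite_Basis] by blast
  define c where "c t = (\<Sum>b\<in>(Basis :: 'a set). (2 * schoenberg_coord DIM('a) (idx b) t - 1) *\<^sub>R b)" for t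
  have comp: "c t \<bullet> b = 2 * schoenberg_coord DIM('a) (idx b) t - 1" if "b \<in> Basis" for b t
    using that by (simp add: c_def)
  show ?thesis
  proof (rule that)
    show "continuous_on UNIV c"
      unfolding c_def[abs_def] by (intro continuous_intros continuous_on_schoenberg_coord)
    obtain b :: 'a where b: "b \<in> Basis" using nonempty_Basis by blast
    have "schoenberg_coord DIM('a) (idx b) 0 = 0"
      unfolding schoenberg_coord_def by (simp add: schoenberg_step_0)
    then have "\<bar>c 0 \<bullet> b\<bar> = 1" using comp[OF b] by simp
    then show "1 \<le> norm (c 0)" using Basis_le_norm[OF b, of "c 0"] by simp
    fix y :: 'a assume y: "norm y < 1"
    have yb: "\<bar>y \<bullet> b\<bar> < 1" if "b \<in> Basis" for b using Basis_le_norm[OF that, of y] y by simp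
    define z where "z i = (y \<bullet> (inv_into Basis idx i) + 1) / 2" for i
    have "0 \<le> z i \<and> z i < 1" if "i < DIM('a)" for i
    proof -
      have "inv_into Basis idx i \<in> Basis"
        using idx that by (intro inv_into_into) (auto simp: bij_betw_def)
      then show ?thesis using yb[of "inv_into Basis idx i"] by (auto simp: z_def abs_less_iff)
    qed
    then obtain t where t: "t \<in> {0..1}" "\<And>i. i < DIM('a) \<Longrightarrow> schoenberg_coord DIM('a) i t = z i"
      using schoenberg_surj[OF DIM_positive[where 'a='a], of z] by metis
    have "c t = y"
    proof (rule euclidean_eqI)
      fix b :: 'a assume b: "b \<in> Basis"
      have "idx b < DIM('a)" using idx b by (auto simp: bij_betw_def)
      moreover have "inv_into Basis idx (idx b) = b"
        using idx b by (intro inv_into_f_f) (auto simp: bij_betw_def)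
      ultimately show "c t \<bullet> b = y \<bullet> b" using b by (simp add: comp t(2) z_def field_simps)
    qed
    then show "\<exists>t\<in>{0..1}. c t = y" using t by auto
  qed
qed

text \<open>The first hitting time of y along the curve.\<close>

lemma borel_section_of_curve:
  fixes c :: "real \<Rightarrow> 'a::euclidean_space"
  assumes c: "continuous_on UNIV c" and surj: "\<And>y. norm y < 1 \<Longrightarrow> \<exists>t\<in>{0..1}. c t = y"
  obtains s where "s \<in> borel_measurable borel" "\<And>y. s y \<in> {0..1}" "\<And>y. norm y < 1 \<Longrightarrow> c (s y) = y"
proof -
  define T where "T y = {t \<in> {0..1}. c t = y}" for y
  define s where "s y = (if norm y < 1 then Inf (T y) else 0)" for y
  have closed_T: "closed (T y)" for y
  proof -
    have "T y = {0..1} \<inter> c -` {y}" by (auto simp: T_def)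
    then show ?thesis using continuous_closed_vimage[of "{y}" c] c
      by (auto intro!: closed_Int simp: continuous_on_eq_continuous_at)
  qed
  have bdd: "bdd_below (T y)" for y by (rule bdd_belowI[of _ 0]) (auto simp: T_def)
  have s_T: "s y \<in> T y" if "norm y < 1" for y
  proof -
    have "T y \<noteq> {}" using surj[OF that] by (auto simp: T_def)
    then show ?thesis using closed_contains_Inf[OF _ bdd closed_T, of y] that by (simp add: s_def)
  qed
  have s_le: "s y \<le> t" if "norm y < 1" "t \<in> T y" for y t
    using that cInf_lower[OF _ bdd] by (simp add: s_def)
  show ?thesis
  proof (rule that)
    show "s \<in> borel_measurable borel"
    proof (rule borel_measurableI_le)
      fix a :: real
      \<comment> \<open>Inside the ball a sublevel set is the image of a compact interval, hence
        closed; outside the ball the section has the value 0.\<close>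
      have "{y. s y \<le> a} = (if a < 0 then {} else {y. 1 \<le> norm y} \<union> ({y. norm y < 1} \<inter> c ` {0..min a 1}))" (is "_ = ?R")
      proof (intro set_eqI iffI)
        fix y assume "y \<in> {y. s y \<le> a}"
        then show "y \<in> ?R"
        proof (cases "norm y < 1")
          case True
          then have "s y \<in> {0..1}" "c (s y) = y" "s y \<le> a" using s_T[of y] \<open>y \<in> _\<close> by (auto simp: T_def)
          then show ?thesis using True by (auto intro!: image_eqI[of _ _ "s y"])
        qed (auto simp: s_def)
      next
        fix y assume y: "y \<in> ?R"
        then have a: "0 \<le> a" by (auto split: if_splits)
        show "y \<in> {y. s y \<le> a}"
        proof (cases "norm y < 1")
          case True
          then obtain t where "t \<in> {0..min a 1}" "y = c t" using y a by auto
          then show ?thesis using s_le[OF True, of t] by (auto simp: T_def)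
        qed (use a in \<open>auto simp: s_def\<close>)
      qed
      moreover have "closed (c ` {0..min a 1})"
        by (intro compact_imp_closed compact_continuous_image continuous_on_subset[OF c]) auto
      ultimately show "{y \<in> space borel. s y \<le> a} \<in> sets borel" by auto
    qed
    show "s y \<in> {0..1}" for y using s_T[of y] by (auto simp: s_def T_def)
    show "norm y < 1 \<Longrightarrow> c (s y) = y" for y using s_T[of y] by (auto simp: T_def)
  qed
qed

section \<open>Compactification by the unit ball\<close>

definition to_ball :: "'a::real_normed_vector \<Rightarrow> 'a" where
  "to_ball x = x /\<^sub>R (1 + norm x)"

definition from_ball :: "'a::real_normed_vector \<Rightarrow> 'a" where
  "from_ball y = y /\<^sub>R (1 - norm y)"

lemma norm_to_ball: "norm (to_ball x) = norm x / (1 + norm x)"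
  unfolding to_ball_def by (simp add: abs_of_nonneg add_nonneg_nonneg divide_inverse mult.commute)

lemma norm_to_ball_less: "norm (to_ball x) < 1"
proof -
  have "norm x < 1 * (1 + norm x)" "0 < 1 + norm x" by (auto simp: add_pos_nonneg)
  then show ?thesis unfolding norm_to_ball by (subst pos_divide_less_eq) auto
qed

lemma from_ball_to_ball: "from_ball (to_ball x) = x"
proof -
  have p: "1 + norm x \<noteq> 0" by (smt (verit) norm_ge_zero)
  have "1 - norm (to_ball x) = 1 / (1 + norm x)"
    unfolding norm_to_ball using p by (simp add: field_simps)
  then show ?thesis using p by (simp add: from_ball_def to_ball_def[of x])
qed

lemma norm_from_ball:
  assumes "norm y < 1"
  shows "norm (from_ball y) = norm y / (1 - norm y)"
  using assms unfolding from_ball_def by (simp add: divide_inverse mult.commute)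

text \<open>Infinity corresponds to the unit sphere, and decay of f there makes the extension by 0
  continuous across it.\<close>

lemma continuous_extension_from_ball:
  fixes f :: "'a::euclidean_space \<Rightarrow> real"
  assumes f: "continuous_on UNIV f" and lim: "(f \<longlongrightarrow> 0) at_infinity"
  shows "continuous_on UNIV (\<lambda>y. if norm y < 1 then f (from_ball y) else 0)"
proof -
  let ?F = "\<lambda>y. if norm y < 1 then f (from_ball y) else 0"
  have "isCont ?F y" for y
  proof (cases "norm y < 1")
    case True
    have op: "open {y :: 'a. norm y < 1}" by (intro open_Collect_less continuous_intros)
    have "continuous_on {y. norm y < 1} (\<lambda>y. f (from_ball y))"
      unfolding from_ball_def
      by (intro continuous_on_compose2[OF f] continuous_intros) auto
    then have "isCont (\<lambda>y. f (from_ball y)) y"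
      using op True by (simp add: continuous_on_eq_continuous_at)
    moreover have "eventually (\<lambda>y. norm y < 1) (nhds y)"
      using eventually_nhds_in_open[OF op, of y] True by simp
    then have "eventually (\<lambda>y. f (from_ball y) = ?F y) (nhds y)"
      by eventually_elim simp
    ultimately show ?thesis using isCont_cong by fast
  next
    case False
    have "(?F \<longlongrightarrow> 0) (at y)"
    proof (rule tendstoI)
      fix e :: real assume e: "0 < e"
      from lim have "eventually (\<lambda>x. dist (f x) 0 < e) at_infinity" using e by (rule tendstoD)
      then obtain R where R: "\<And>x. R \<le> norm x \<Longrightarrow> \<bar>f x\<bar> < e" by (auto simp: eventually_at_infinity)
      define S where "S = max R 0"
      have op: "open {y :: 'a. S / (1 + S) < norm y}" by (intro open_Collect_less continuous_intros)
      have "S / (1 + S) < 1" by (simp add: S_def field_simps)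
      then have "y \<in> {y :: 'a. S / (1 + S) < norm y}" using False by simp
      then have "eventually (\<lambda>y. S / (1 + S) < norm y) (nhds y)"
        using eventually_nhds_in_open[OF op] by (auto elim!: eventually_mono)
      then have "eventually (\<lambda>y. S / (1 + S) < norm y) (at y)"
        by (simp add: eventually_nhds_conv_at)
      then show "eventually (\<lambda>y. dist (?F y) 0 < e) (at y)"
      proof eventually_elim
        fix z :: 'a assume z: "S / (1 + S) < norm z"
        show "dist (?F z) 0 < e"
        proof (cases "norm z < 1")
          case True
          have "0 < 1 + S" by (simp add: S_def)
          then have "S * (1 - norm z) \<le> norm z" using z by (simp add: field_simps)
          then have "S \<le> norm (from_ball z)" using True by (simp add: norm_from_ball field_simps)
          then show ?thesis using R[of "from_ball z"] True by (simp add: S_def)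
        qed (use e in simp)
      qed
    qed
    then show ?thesis using False by (simp add: isCont_def)
  qed
  then show ?thesis by (simp add: continuous_on_eq_continuous_at)
qed

lemma bounded_vanishing_at_infinity:
  fixes f :: "'a::euclidean_space \<Rightarrow> real"
  assumes f: "continuous_on UNIV f" and lim: "(f \<longlongrightarrow> 0) at_infinity"
  obtains B where "0 \<le> B" "\<And>x. \<bar>f x\<bar> \<le> B"
proof -
  from lim have "eventually (\<lambda>x. dist (f x) 0 < 1) at_infinity" by (rule tendstoD) simp
  then obtain R where R: "\<And>x. R \<le> norm x \<Longrightarrow> \<bar>f x\<bar> < 1" by (auto simp: eventually_at_infinity)
  have "bounded (f ` cball 0 R)"
    by (intro compact_imp_bounded compact_continuous_image continuous_on_subset[OF f]) auto
  then obtain b where "\<forall>x\<in>cball 0 R. \<bar>f x\<bar> \<le> b" by (auto simp: bounded_iff)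
  then have b: "\<bar>f x\<bar> \<le> b" if "norm x \<le> R" for x using that by simp
  show ?thesis
  proof (rule that[of "max b 1"])
    show "\<bar>f x\<bar> \<le> max b 1" for x using b[of x] R[of x] by (cases "norm x \<le> R") auto
  qed auto
qed

text \<open>The measures are transported to the line by a Borel section of a continuous curve filling the
  ball, where Helly's theorem applies; mass that escapes to infinity ends up outside the open ball.\<close>

theorem vague_compactness:
  fixes M :: "nat \<Rightarrow> 'a::euclidean_space measure"
  assumes sets: "\<And>j. sets (M j) = sets borel" and mass: "\<And>j. emeasure (M j) UNIV \<le> ennreal C" and C: "0 < C"
  obtains \<phi> L where "strict_mono \<phi>" "sets L = sets (borel :: 'a measure)" "emeasure L UNIV \<le> ennreal C"
    "\<And>f. continuous_on UNIV f \<Longrightarrow> (\<And>x. 0 \<le> f x) \<Longrightarrow> (f \<longlongrightarrow> 0) at_infinity \<Longrightarrow>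
      (\<lambda>j. \<integral>\<^sup>+ x. ennreal (f x) \<partial>M (\<phi> j)) \<longlonglongrightarrow> (\<integral>\<^sup>+ x. ennreal (f x) \<partial>L)"
proof -
  obtain c :: "real \<Rightarrow> 'a" where c: "continuous_on UNIV c" and c0: "1 \<le> norm (c 0)"
    and surj: "\<And>y. norm y < 1 \<Longrightarrow> \<exists>t\<in>{0..1}. c t = y"
    using continuous_curve_onto_ball by blast
  obtain s where [measurable]: "s \<in> borel_measurable borel" and s01: "\<And>y. s y \<in> {0..1}"
    and cs: "\<And>y. norm y < 1 \<Longrightarrow> c (s y) = y"
    using borel_section_of_curve[OF c surj] by blast
  have [measurable]: "c \<in> borel_measurable borel" using c by (rule borel_measurable_continuous_onI)
  have [measurable]: "to_ball \<in> borel_measurable (borel :: 'a measure)" "from_ball \<in> borel_measurable (borel :: 'a measure)"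
    unfolding to_ball_def[abs_def] from_ball_def[abs_def] by measurable
  define e where "e x = s (to_ball x)" for x
  have [measurable]: "e \<in> borel_measurable borel" unfolding e_def by measurable
  have e01: "e x \<in> {0..1}" for x using s01 by (simp add: e_def)
  have ce: "c (e x) = to_ball x" for x unfolding e_def by (rule cs) (rule norm_to_ball_less)
  have sp: "space (M j) = UNIV" for j using sets_eq_imp_space_eq[OF sets[of j]] by simp
  have [measurable]: "e \<in> borel_measurable (M j)" for j
    using measurable_cong_sets[OF sets refl] \<open>e \<in> borel_measurable borel\<close> by blast
  define a where "a j = emeasure (M j) UNIV / ennreal C" for j
  have a1: "a j \<le> 1" for j
    using mass[of j] C by (simp add: a_def divide_le_posI_ennreal)
  \<comment> \<open>Helly's theorem is available for probability measures, so the missing mass is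
    placed at the parameter 0.\<close>
  define \<Lambda> where "\<Lambda> j = lincomb (1 / ennreal C) (distr (M j) borel e) (1 - a j) (return borel 0)" for j
  have em: "emeasure (\<Lambda> j) B = (1 / ennreal C) * emeasure (M j) (e -` B) + (1 - a j) * indicator B 0" if "B \<in> sets borel" for j B
    using that by (simp add: \<Lambda>_def emeasure_lincomb emeasure_distr sp)
  have one: "emeasure (\<Lambda> j) B = 1" if B: "B \<in> sets borel" "{0..1} \<subseteq> B" for j B
  proof -
    have "e -` B = UNIV" using e01 B(2) by blast
    moreover have "(0::real) \<in> B" using B(2) by auto
    ultimately have "emeasure (\<Lambda> j) B = a j + (1 - a j)"
      using B(1) by (simp add: em a_def divide_ennreal_def mult.commute)
    then show ?thesis using a1 by (simp add: add_diff_inverse_ennreal)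
  qed
  have rd: "real_distribution (\<Lambda> j)" for j
  proof -
    have "prob_space (\<Lambda> j)" by (rule prob_spaceI) (simp add: \<Lambda>_def one[unfolded \<Lambda>_def])
    then show ?thesis by (simp add: real_distribution_def real_distribution_axioms_def \<Lambda>_def)
  qed
  have "tight \<Lambda>"
    unfolding tight_def
  proof (intro conjI allI impI rd)
    fix \<epsilon> :: real assume "0 < \<epsilon>"
    have "measure (\<Lambda> j) {-1<..2} = 1" for j
    proof -
      have "{0..1} \<subseteq> {-1<..2::real}" by (auto intro: less_le_trans[of _ 0])
      then show ?thesis by (simp add: measure_def one)
    qed
    then show "\<exists>a b. a < b \<and> (\<forall>n. 1 - \<epsilon> < measure (\<Lambda> n) {a<..b})"
      using \<open>0 < \<epsilon>\<close> by (intro exI[of _ "-1"] exI[of _ 2]) auto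
  qed
  then obtain \<phi> \<Lambda>' where \<phi>: "strict_mono \<phi>" and rd': "real_distribution \<Lambda>'" and wc: "weak_conv_m (\<lambda>j. \<Lambda> (\<phi> j)) \<Lambda>'"
    using tight_imp_convergent_subsubsequence[of \<Lambda> "\<lambda>x. x"] by (auto simp: strict_mono_def comp_def)
  interpret L: real_distribution \<Lambda>' by (rule rd')
  \<comment> \<open>The limit on the line may charge parameters outside the range of the section;
    pushing it forward along the curve is enough, because every test function factors through
    \<open>c\<close>.\<close>
  define L where "L = distr (density \<Lambda>' (\<lambda>t. ennreal C * indicator {t. norm (c t) < 1} t)) borel (\<lambda>t. from_ball (c t))"
  show ?thesis
  proof (rule that)
    show "strict_mono \<phi>" by (rule \<phi>)
    show "sets L = sets borel" by (simp add: L_def)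
    have nnL: "(\<integral>\<^sup>+ x. f x \<partial>L) = ennreal C * (\<integral>\<^sup>+ t. indicator {t. norm (c t) < 1} t * f (from_ball (c t)) \<partial>\<Lambda>')"
      if [measurable]: "f \<in> borel_measurable borel" for f
      unfolding L_def
      by (subst nn_integral_distr, simp, simp, subst nn_integral_density) (auto simp: nn_integral_cmult mult.assoc)
    have "emeasure L UNIV = (\<integral>\<^sup>+ x. 1 \<partial>L)" by (simp add: L_def)
    also have "\<dots> \<le> ennreal C * (\<integral>\<^sup>+ t. 1 \<partial>\<Lambda>')"
      by (subst nnL, simp, intro mult_left_mono nn_integral_mono) (auto simp: indicator_def)
    also have "\<dots> = ennreal C" using L.emeasure_space_1 by simp
    finally show "emeasure L UNIV \<le> ennreal C" .
    fix f :: "'a \<Rightarrow> real"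
    assume f: "continuous_on UNIV f" "\<And>x. 0 \<le> f x" "(f \<longlongrightarrow> 0) at_infinity"
    have [measurable]: "f \<in> borel_measurable borel" using f(1) by (rule borel_measurable_continuous_onI)
    define F where "F y = (if norm y < 1 then f (from_ball y) else 0)" for y
    define \<Phi> where "\<Phi> t = F (c t)" for t
    have "continuous_on UNIV F" unfolding F_def[abs_def] by (rule continuous_extension_from_ball[OF f(1,3)])
    then have "continuous_on UNIV \<Phi>" unfolding \<Phi>_def[abs_def] using c by (rule continuous_on_compose2) auto
    then have cont: "isCont \<Phi> t" for t by (simp add: continuous_on_eq_continuous_at)
    have [measurable]: "\<Phi> \<in> borel_measurable borel"
      using \<open>continuous_on UNIV \<Phi>\<close> by (rule borel_measurable_continuous_onI)
    obtain B where B: "0 \<le> B" "\<And>x. \<bar>f x\<bar> \<le> B" using bounded_vanishing_at_infinity[OF f(1,3)] by blast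
    have \<Phi>B: "norm (\<Phi> t) \<le> B" for t using B by (simp add: \<Phi>_def F_def)
    have \<Phi>0: "0 \<le> \<Phi> t" for t using f(2) by (simp add: \<Phi>_def F_def)
    have nn: "(\<integral>\<^sup>+ t. ennreal (\<Phi> t) \<partial>P) = ennreal (\<integral>t. \<Phi> t \<partial>P)" if "real_distribution P" for P
    proof -
      interpret P: real_distribution P by fact
      have "integrable P \<Phi>" by (rule P.integrable_const_bound[of _ B]) (use \<Phi>B in auto)
      then show ?thesis by (intro nn_integral_eq_integral) (use \<Phi>0 in auto)
    qed
    have "(\<lambda>j. \<integral>t. \<Phi> t \<partial>\<Lambda> (\<phi> j)) \<longlonglongrightarrow> (\<integral>t. \<Phi> t \<partial>\<Lambda>')"
      by (rule weak_conv_imp_integral_bdd_continuous_conv[OF rd rd' wc cont \<Phi>B])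
    then have "(\<lambda>j. ennreal (\<integral>t. \<Phi> t \<partial>\<Lambda> (\<phi> j))) \<longlonglongrightarrow> ennreal (\<integral>t. \<Phi> t \<partial>\<Lambda>')"
      by (rule tendsto_ennrealI)
    then have "(\<lambda>j. \<integral>\<^sup>+ t. ennreal (\<Phi> t) \<partial>\<Lambda> (\<phi> j)) \<longlonglongrightarrow> (\<integral>\<^sup>+ t. ennreal (\<Phi> t) \<partial>\<Lambda>')"
      by (simp add: nn[OF rd] nn[OF rd'])
    then have lim: "(\<lambda>j. ennreal C * (\<integral>\<^sup>+ t. ennreal (\<Phi> t) \<partial>\<Lambda> (\<phi> j))) \<longlonglongrightarrow> ennreal C * (\<integral>\<^sup>+ t. ennreal (\<Phi> t) \<partial>\<Lambda>')"
      by (intro ennreal_tendsto_cmult) auto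
    have \<Phi>e: "\<Phi> (e x) = f x" for x
      by (simp add: \<Phi>_def ce F_def norm_to_ball_less from_ball_to_ball)
    \<comment> \<open>The parameter 0 lies outside the open ball, so the added mass is invisible to
      the test functions.\<close>
    have \<Phi>_0: "\<Phi> 0 = 0" using c0 by (simp add: \<Phi>_def F_def)
    have "ennreal C * (\<integral>\<^sup>+ t. ennreal (\<Phi> t) \<partial>\<Lambda> j) = (\<integral>\<^sup>+ x. ennreal (f x) \<partial>M j)" for j
    proof -
      have "(\<integral>\<^sup>+ t. ennreal (\<Phi> t) \<partial>\<Lambda> j) = (1 / ennreal C) * (\<integral>\<^sup>+ x. ennreal (f x) \<partial>M j)"
        unfolding \<Lambda>_def by (subst nn_integral_lincomb) (auto simp: nn_integral_distr nn_integral_return \<Phi>e \<Phi>_0)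
      moreover have "ennreal C * (1 / ennreal C) = 1"
        using C by (simp add: ennreal_times_divide)
      ultimately show ?thesis by (simp add: mult.assoc[symmetric])
    qed
    moreover have "ennreal C * (\<integral>\<^sup>+ t. ennreal (\<Phi> t) \<partial>\<Lambda>') = (\<integral>\<^sup>+ x. ennreal (f x) \<partial>L)"
      by (subst nnL) (auto intro!: arg_cong[where f="\<lambda>x. ennreal C * x"] nn_integral_cong simp: \<Phi>_def F_def indicator_def)
    ultimately show "(\<lambda>j. \<integral>\<^sup>+ x. ennreal (f x) \<partial>M (\<phi> j)) \<longlonglongrightarrow> (\<integral>\<^sup>+ x. ennreal (f x) \<partial>L)"
      using lim by simp
  qed
qed

section \<open>Measures of finite energy\<close>

text \<open>The decay rate of potentials at infinity: the kernel seen from x at a source in the unit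
  ball is at least this large.\<close>

definition riesz_weight :: "real \<Rightarrow> 'a::euclidean_space \<Rightarrow> real" where
  "riesz_weight \<alpha> x = (1 + norm x) powr (\<alpha> - real DIM('a))"

lemma riesz_weight_pos: "0 < riesz_weight \<alpha> x"
  by (simp add: riesz_weight_def) (smt (verit) norm_ge_zero)

lemma borel_measurable_riesz_weight [measurable]: "riesz_weight \<alpha> \<in> borel_measurable borel"
  unfolding riesz_weight_def[abs_def] by measurable

lemma riesz_weight_inverse: "inverse (riesz_weight \<alpha> (x::'a::euclidean_space)) = (1 + norm x) powr (real DIM('a) - \<alpha>)"
  by (simp add: riesz_weight_def powr_minus[symmetric])

lemma gauss_powr_tendsto_0:
  fixes a p t :: real
  assumes t: "0 < t"
  shows "((\<lambda>\<rho>. exp (- (\<rho> - a)\<^sup>2 / t) * (1 + \<rho>) powr p) \<longlongrightarrow> 0) at_top"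
  using t by real_asymp

lemma continuous_on_heat: "continuous_on S (heat t)"
  by (intro continuous_at_imp_continuous_on ballI isCont_heat)

text \<open>The reciprocal weight grows polynomially and loses to the Gaussian. This makes the heat
  kernel an admissible test function for vague limits of weighted measures.\<close>

lemma heat_div_weight:
  fixes z :: "'a::euclidean_space"
  assumes t: "0 < t"
  shows "continuous_on UNIV (\<lambda>y. heat t (z - y) / riesz_weight \<alpha> y)"
    and "((\<lambda>y. heat t (z - y) / riesz_weight \<alpha> y) \<longlongrightarrow> 0) at_infinity"
proof -
  define p where "p = real DIM('a) - \<alpha>"
  have eq: "heat t (z - y) / riesz_weight \<alpha> y = heat t (z - y) * (1 + norm y) powr p" for y
    using riesz_weight_inverse[of \<alpha> y] by (simp add: divide_inverse p_def)
  have p: "1 + norm y \<noteq> 0" for y :: 'a by (smt (verit) norm_ge_zero)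
  show "continuous_on UNIV (\<lambda>y. heat t (z - y) / riesz_weight \<alpha> y)"
    unfolding eq
  proof (rule continuous_on_mult)
    show "continuous_on UNIV (\<lambda>y. heat t (z - y))"
      by (rule continuous_on_compose2[OF continuous_on_heat[of UNIV t]]) (auto intro: continuous_intros)
    show "continuous_on UNIV (\<lambda>y::'a. (1 + norm y) powr p)"
      by (intro continuous_on_powr continuous_intros) (use p in auto)
  qed
  define C where "C = t powr (- (real DIM('a) / 2)) / gauss_mass TYPE('a)"
  have C: "0 \<le> C" using gauss_mass_pos[where 'a='a] by (simp add: C_def)
  have lim: "((\<lambda>y::'a. C * (exp (- (norm y - norm z)\<^sup>2 / t) * (1 + norm y) powr p)) \<longlongrightarrow> C * 0) at_infinity"
    by (intro tendsto_mult tendsto_const filterlim_compose[OF gauss_powr_tendsto_0[OF t] filterlim_norm_at_top])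
  show "((\<lambda>y. heat t (z - y) / riesz_weight \<alpha> y) \<longlongrightarrow> 0) at_infinity"
  proof (rule tendsto_sandwich)
    show "eventually (\<lambda>y. 0 \<le> heat t (z - y) / riesz_weight \<alpha> y) at_infinity"
      by (intro always_eventually allI) (simp add: eq)
    show "eventually (\<lambda>y. heat t (z - y) / riesz_weight \<alpha> y \<le> C * (exp (- (norm y - norm z)\<^sup>2 / t) * (1 + norm y) powr p)) at_infinity"
      unfolding eventually_at_infinity
    proof (intro exI[of _ "norm z"] allI impI)
      fix y :: 'a assume y: "norm z \<le> norm y"
      \<comment> \<open>Gives a bound in |y| alone, to which the one-dimensional limit
        applies.\<close>
      have "norm y - norm z \<le> norm (z - y)" by (metis norm_minus_commute norm_triangle_ineq2)
      then have "(norm y - norm z)\<^sup>2 \<le> (norm (z - y))\<^sup>2" using y by (intro power_mono) auto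
      then have "exp (- (norm (z - y))\<^sup>2 / t) \<le> exp (- (norm y - norm z)\<^sup>2 / t)"
        using t by (simp add: divide_right_mono)
      then have "C * (exp (- (norm (z - y))\<^sup>2 / t) * (1 + norm y) powr p) \<le> C * (exp (- (norm y - norm z)\<^sup>2 / t) * (1 + norm y) powr p)"
        by (intro mult_left_mono mult_right_mono C) auto
      then show "heat t (z - y) / riesz_weight \<alpha> y \<le> C * (exp (- (norm y - norm z)\<^sup>2 / t) * (1 + norm y) powr p)"
        unfolding eq by (simp add: heat_def C_def)
    qed
  qed (use lim in auto)
qed

lemma nn_integral_heat_flow_weight:
  assumes M: "sf_borel M" and t: "0 < t"
  shows "heat_flow t M z = (\<integral>\<^sup>+ y. ennreal (heat t (z - y) / riesz_weight \<alpha> y) \<partial>density M (\<lambda>y. ennreal (riesz_weight \<alpha> y)))"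
proof -
  have [measurable]: "(\<lambda>y. ennreal (riesz_weight \<alpha> y)) \<in> borel_measurable M"
    "(\<lambda>y. ennreal (heat t (z - y) / riesz_weight \<alpha> y)) \<in> borel_measurable M"
    by (auto intro!: sf_borel_measurable1[OF M])
  have "ennreal (heat t (z - y)) = ennreal (riesz_weight \<alpha> y) * ennreal (heat t (z - y) / riesz_weight \<alpha> y)" for y
    using riesz_weight_pos[of \<alpha> y] by (simp add: ennreal_mult'[symmetric])
  then show ?thesis by (simp add: heat_flow_def nn_integral_density)
qed

lemma heat_flow_finite_weight:
  assumes M: "sf_borel M" and t: "0 < t" and fin: "(\<integral>\<^sup>+ y. ennreal (riesz_weight \<alpha> y) \<partial>M) < \<infinity>"
  shows "heat_flow t M z < \<infinity>"
proof -
  obtain B where B: "0 \<le> B" "\<And>y. \<bar>heat t (z - y) / riesz_weight \<alpha> y\<bar> \<le> B"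
    using bounded_vanishing_at_infinity[OF heat_div_weight[OF t, of z \<alpha>]] by blast
  have [measurable]: "(\<lambda>y. ennreal (riesz_weight \<alpha> y)) \<in> borel_measurable M"
    by (auto intro!: sf_borel_measurable1[OF M])
  have "heat t (z - y) \<le> B * riesz_weight \<alpha> y" for y
    using B(2)[of y] riesz_weight_pos[of \<alpha> y] by (simp add: pos_divide_le_eq)
  then have "heat_flow t M z \<le> (\<integral>\<^sup>+ y. ennreal B * ennreal (riesz_weight \<alpha> y) \<partial>M)"
    unfolding heat_flow_def using B(1) by (intro nn_integral_mono) (simp add: ennreal_mult'[symmetric] ennreal_leI)
  also have "\<dots> < \<infinity>" using fin by (simp add: nn_integral_cmult ennreal_mult_less_top)
  finally show ?thesis .
qed

lemma energy_coneD:
  assumes "M \<in> energy_cone \<alpha>"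
  shows "radon M" "sf_borel M" "energy \<alpha> M < \<infinity>" "sets M = sets borel"
  using assms radon_sf_borel by (auto simp: energy_cone_def sf_borel_def)

lemma mutual_energy_lincomb_left:
  assumes M: "sf_borel M" and M': "sf_borel M'" and N: "sf_borel N" and L: "sf_borel (lincomb a M b M')"
  shows "mutual_energy \<alpha> (lincomb a M b M') N = a * mutual_energy \<alpha> M N + b * mutual_energy \<alpha> M' N"
proof -
  have "mutual_energy \<alpha> (lincomb a M b M') N = mutual_energy \<alpha> N (lincomb a M b M')"
    by (rule mutual_energy_commute[OF L N])
  also have "\<dots> = a * mutual_energy \<alpha> N M + b * mutual_energy \<alpha> N M'"
    unfolding mutual_energy_eq_potential[OF N M] mutual_energy_eq_potential[OF N M'] mutual_energy_eq_potential[OF N L]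
    by (rule nn_integral_lincomb[OF sf_borelD(2)[OF M] sf_borelD(2)[OF M'] borel_measurable_potential[OF N]])
  finally show ?thesis
    by (simp add: mutual_energy_commute[OF N M] mutual_energy_commute[OF N M'])
qed

lemma mutual_energy_lincomb_right:
  assumes M: "sf_borel M" and M': "sf_borel M'" and N: "sf_borel N" and L: "sf_borel (lincomb a M b M')"
  shows "mutual_energy \<alpha> N (lincomb a M b M') = a * mutual_energy \<alpha> N M + b * mutual_energy \<alpha> N M'"
  using mutual_energy_lincomb_left[OF assms]
  by (simp add: mutual_energy_commute[OF N M] mutual_energy_commute[OF N M'] mutual_energy_commute[OF N L])

definition heat_measure :: "real \<Rightarrow> 'a::euclidean_space measure" where
  "heat_measure c = density lborel (\<lambda>x. ennreal (heat c x))"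

lemma sf_borel_heat_measure [simp]: "sf_borel (heat_measure c)"
  unfolding heat_measure_def by (rule sf_borel_density_lborel) auto

lemma heat_flow_heat_measure: "heat_flow t (heat_measure c) x = heat_fun t (\<lambda>x. ennreal (heat c x)) x"
  unfolding heat_measure_def heat_fun_def by (rule heat_flow_density_lborel) measurable

text \<open>For measures of finite energy this is the squared norm of the difference. An infinite heat flow
  would be turned into \<open>0\<close> by \<^const>\<open>enn2real\<close>, but such measures have none.\<close>

definition heat_dist :: "real \<Rightarrow> 'a::euclidean_space measure \<Rightarrow> 'a measure \<Rightarrow> ennreal" where
  "heat_dist \<alpha> M N = riesz_const \<alpha> TYPE('a) *
    (\<integral>\<^sup>+ t. \<integral>\<^sup>+ z. ennreal ((enn2real (heat_flow (t / 2) M z) - enn2real (heat_flow (t / 2) N z))\<^sup>2) \<partial>lborel \<partial>riesz_time \<alpha>)"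

section \<open>Recovery of a measure from its heat flows at small times\<close>

lemma heat_fun_tendsto:
  fixes f :: "'a::euclidean_space \<Rightarrow> real"
  assumes f: "continuous_on UNIV f" "\<And>x. 0 \<le> f x" "\<And>x. f x \<le> B" and s: "\<And>j. 0 < s j" "s \<longlonglongrightarrow> 0"
  shows "(\<lambda>j. heat_fun (s j) (\<lambda>x. ennreal (f x)) x) \<longlonglongrightarrow> ennreal (f x)"
proof -
  interpret H: prob_space "density lborel (\<lambda>y::'a. ennreal (heat 1 y))" by (rule prob_space_heat_1)
  let ?H = "density lborel (\<lambda>y::'a. ennreal (heat 1 y))"
  have [measurable]: "f \<in> borel_measurable borel" using f(1) by (rule borel_measurable_continuous_onI)
  have "(\<lambda>j. \<integral>\<^sup>+ y. ennreal (f (x + sqrt (s j) *\<^sub>R y)) \<partial>?H) \<longlonglongrightarrow> (\<integral>\<^sup>+ y. ennreal (f x) \<partial>?H)"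
  proof (rule nn_integral_dominated_convergence[where w="\<lambda>_. ennreal B"])
    show "(\<integral>\<^sup>+ y. ennreal B \<partial>?H) < \<infinity>" using H.emeasure_space_1 by simp
    show "AE y in ?H. ennreal (f (x + sqrt (s j) *\<^sub>R y)) \<le> ennreal B" for j
      using f(3) by (intro AE_I2 ennreal_leI)
    show "AE y in ?H. (\<lambda>j. ennreal (f (x + sqrt (s j) *\<^sub>R y))) \<longlonglongrightarrow> ennreal (f x)"
    proof (rule AE_I2)
      fix y :: 'a
      have "(\<lambda>j. x + sqrt (s j) *\<^sub>R y) \<longlonglongrightarrow> x + sqrt 0 *\<^sub>R y"
        by (intro tendsto_intros s)
      then show "(\<lambda>j. ennreal (f (x + sqrt (s j) *\<^sub>R y))) \<longlonglongrightarrow> ennreal (f x)"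
        using f(1) by (intro tendsto_ennrealI isCont_tendsto_compose[of x f]) (auto simp: continuous_on_eq_continuous_at)
    qed
  qed auto
  then show ?thesis
    using s H.emeasure_space_1 by (simp add: heat_fun_eq_integral)
qed

text \<open>The heat operator is symmetric, so equal flows give equal integrals of the smoothed test
  function. Smoothing up to time 1 keeps it below a multiple of \<open>heat 2\<close>, which
  dominates the limit at time 0.\<close>

lemma nn_integral_eq_of_heat_flow_eq:
  fixes f :: "'a::euclidean_space \<Rightarrow> real"
  assumes M: "sf_borel M" and N: "sf_borel N" and fin: "heat_flow 2 M 0 < \<infinity>" "heat_flow 2 N 0 < \<infinity>"
    and s: "\<And>j. 0 < s j" "\<And>j. s j \<le> 1" "s \<longlonglongrightarrow> 0" and eq: "\<And>j. AE z in lborel. heat_flow (s j) M z = heat_flow (s j) N z"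
    and f: "continuous_on UNIV f" "\<And>x. 0 \<le> f x" "\<And>x. f x \<le> heat 1 x"
  shows "(\<integral>\<^sup>+ x. ennreal (f x) \<partial>M) = (\<integral>\<^sup>+ x. ennreal (f x) \<partial>N)"
proof -
  have [measurable]: "f \<in> borel_measurable borel" using f(1) by (rule borel_measurable_continuous_onI)
  let ?f = "\<lambda>x. ennreal (f x)"
  have bound: "f x \<le> heat 1 (0 :: 'a)" for x
    using f(3)[of x] gauss_mass_pos[where 'a='a] by (auto simp: heat_def elim!: order_trans intro!: divide_right_mono)
  have lim: "(\<lambda>j. \<integral>\<^sup>+ x. heat_fun (s j) ?f x \<partial>L) \<longlonglongrightarrow> (\<integral>\<^sup>+ x. ?f x \<partial>L)"
    if L: "sf_borel L" and finL: "heat_flow 2 L 0 < \<infinity>" for L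
  proof (rule nn_integral_dominated_convergence[where w="\<lambda>x. ennreal (2 powr (real DIM('a) / 2)) * ennreal (heat 2 x)"])
    have m: "(\<lambda>x. ennreal (heat 2 x)) \<in> borel_measurable L"
      by (rule sf_borel_measurable1[OF L]) measurable
    have "(\<integral>\<^sup>+ x. ennreal (heat 2 x) \<partial>L) = heat_flow 2 L 0"
      unfolding heat_flow_def by (simp add: heat_cong_norm[OF norm_minus_cancel])
    then show "(\<integral>\<^sup>+ x. ennreal (2 powr (real DIM('a) / 2)) * ennreal (heat 2 x) \<partial>L) < \<infinity>"
      using finL by (simp add: nn_integral_cmult[OF m] ennreal_mult_less_top)
    show "AE x in L. heat_fun (s j) ?f x \<le> ennreal (2 powr (real DIM('a) / 2)) * ennreal (heat 2 x)" for j
    proof (rule AE_I2)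
      fix x
      have "heat_fun (s j) ?f x \<le> heat_fun (s j) (\<lambda>x. ennreal (heat 1 x)) x"
        by (intro heat_fun_mono ennreal_leI f(3))
      also have "\<dots> = ennreal (heat (s j + 1) x)" by (rule heat_fun_heat) (use s in auto)
      also have "\<dots> \<le> ennreal (2 powr (real DIM('a) / 2) * heat 2 x)"
        using s(1,2)[of j] by (intro ennreal_leI heat_1_plus_bounds) auto
      finally show "heat_fun (s j) ?f x \<le> ennreal (2 powr (real DIM('a) / 2)) * ennreal (heat 2 x)"
        by (simp add: ennreal_mult')
    qed
    show "AE x in L. (\<lambda>j. heat_fun (s j) ?f x) \<longlonglongrightarrow> ?f x"
      by (intro AE_I2 heat_fun_tendsto[OF f(1,2) bound s(1,3)])
    show "(\<lambda>x. heat_fun (s j) ?f x) \<in> borel_measurable L" for j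
      by (rule sf_borel_measurable1[OF L]) measurable
    show "?f \<in> borel_measurable L" "(\<lambda>x. ennreal (2 powr (real DIM('a) / 2)) * ennreal (heat 2 x)) \<in> borel_measurable L"
      by (rule sf_borel_measurable1[OF L], measurable)+
  qed
  have "(\<integral>\<^sup>+ x. heat_fun (s j) ?f x \<partial>M) = (\<integral>\<^sup>+ x. heat_fun (s j) ?f x \<partial>N)" for j
    unfolding nn_integral_heat_fun_measure[OF M] nn_integral_heat_fun_measure[OF N]
    by (simp add: nn_integral_heat_fun_measure[OF M] nn_integral_heat_fun_measure[OF N],
        rule nn_integral_cong_AE, use eq[of j] in eventually_elim) simp
  then show ?thesis using lim[OF M fin(1)] lim[OF N fin(2)] LIMSEQ_unique by force
qed

text \<open>Weighting with the Gaussian yields finite measures, which agree once they agree on the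
  intersection-stable generator of closed sets.\<close>

lemma measure_eq_of_heat_flow_eq:
  fixes M N :: "'a::euclidean_space measure"
  assumes M: "sf_borel M" and N: "sf_borel N" and fin: "heat_flow 1 M 0 < \<infinity>" "heat_flow 2 M 0 < \<infinity>" "heat_flow 2 N 0 < \<infinity>"
    and s: "\<And>j. 0 < s j" "\<And>j. s j \<le> 1" "s \<longlonglongrightarrow> 0" and eq: "\<And>j. AE z in lborel. heat_flow (s j) M z = heat_flow (s j) N z"
  shows "M = N"
proof -
  let ?h = "\<lambda>x::'a. ennreal (heat 1 x)"
  have h[measurable]: "?h \<in> borel_measurable M" "?h \<in> borel_measurable N"
    by (auto intro!: sf_borel_measurable1[OF M] sf_borel_measurable1[OF N])
  note test = nn_integral_eq_of_heat_flow_eq[OF M N fin(2,3) s eq]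
  have test_h: "(\<integral>\<^sup>+ x. ?h x \<partial>M) = (\<integral>\<^sup>+ x. ?h x \<partial>N)"
    by (rule test) (auto intro: continuous_on_heat)
  have "(\<integral>\<^sup>+ x. ?h x \<partial>M) = heat_flow 1 M 0"
    unfolding heat_flow_def by (simp add: heat_cong_norm[OF norm_minus_cancel])
  then have h_fin: "(\<integral>\<^sup>+ x. ?h x \<partial>M) < \<infinity>" using fin(1) by simp
  have closed_eq: "(\<integral>\<^sup>+ x. ?h x * indicator C x \<partial>M) = (\<integral>\<^sup>+ x. ?h x * indicator C x \<partial>N)" if C: "closed C" for C
  proof (cases "C = {}")
    case False
    \<comment> \<open>Continuous functions decreasing to the indicator of C, times the Gaussian that
      keeps them below the admissible bound.\<close>
    define g where "g k x = max 0 (1 - real k * infdist x C) * heat 1 x" for k and x :: 'a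
    have g_cont: "continuous_on UNIV (g k)" for k
      unfolding g_def[abs_def]
      by (intro continuous_intros) (auto intro: continuous_on_heat)
    have g_le: "g k x \<le> heat 1 x" for k x
      unfolding g_def using infdist_nonneg[of x C] by (intro mult_left_le_one_le) auto
    have [measurable]: "g k \<in> borel_measurable borel" for k
      using g_cont by (rule borel_measurable_continuous_onI)
    have g_lim: "(\<lambda>k. ennreal (g k x)) \<longlonglongrightarrow> ?h x * indicator C x" for x
    proof (cases "x \<in> C")
      case True
      then show ?thesis by (simp add: g_def)
    next
      case x: False
      have d: "0 < infdist x C" using infdist_pos_not_in_closed[OF C False x] .
      obtain k0 :: nat where k0: "1 / infdist x C < real k0" using reals_Archimedean2 by blast
      have "eventually (\<lambda>k. g k x = 0) sequentially"
        using eventually_ge_at_top[of k0]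
      proof eventually_elim
        fix k assume "k0 \<le> k"
        then have "1 / infdist x C \<le> real k" using k0 by simp
        then have "1 \<le> real k * infdist x C" using d by (simp add: field_simps)
        then show "g k x = 0" by (simp add: g_def)
      qed
      then have "eventually (\<lambda>k. ennreal (g k x) = ?h x * indicator C x) sequentially"
        by eventually_elim (simp add: x)
      then show ?thesis by (rule tendsto_eventually)
    qed
    have lim: "(\<lambda>k. \<integral>\<^sup>+ x. ennreal (g k x) \<partial>L) \<longlonglongrightarrow> (\<integral>\<^sup>+ x. ?h x * indicator C x \<partial>L)"
      if L: "sf_borel L" and finL: "(\<integral>\<^sup>+ x. ?h x \<partial>L) < \<infinity>" for L
    proof (rule nn_integral_dominated_convergence[where w="?h"])
      show "AE x in L. ennreal (g k x) \<le> ?h x" for k by (intro AE_I2 ennreal_leI g_le)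
      show "AE x in L. (\<lambda>k. ennreal (g k x)) \<longlonglongrightarrow> ?h x * indicator C x" by (intro AE_I2 g_lim)
      show "(\<lambda>x. ennreal (g k x)) \<in> borel_measurable L" for k
        by (rule sf_borel_measurable1[OF L]) measurable
      have [measurable]: "C \<in> sets borel" using C by simp
      show "?h \<in> borel_measurable L" "(\<lambda>x. ?h x * indicator C x) \<in> borel_measurable L"
        by (rule sf_borel_measurable1[OF L], measurable)+
    qed (rule finL)
    have "(\<integral>\<^sup>+ x. ennreal (g k x) \<partial>M) = (\<integral>\<^sup>+ x. ennreal (g k x) \<partial>N)" for k
      by (rule test[OF g_cont]) (auto simp: g_le, simp add: g_def)
    then show ?thesis using lim[OF M h_fin] lim[OF N] h_fin test_h LIMSEQ_unique by force
  qed simp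
  have sb: "sets (borel :: 'a measure) = sigma_sets UNIV (Collect closed)"
    by (subst borel_eq_closed) (rule sets_measure_of, simp)
  have dens: "density M ?h = density N ?h"
  proof (rule measure_eqI_generator_eq[where E="Collect closed" and \<Omega>=UNIV and A="\<lambda>_. UNIV"])
    show "Int_stable (Collect closed :: 'a set set)" by (auto simp: Int_stable_def)
    show "sets (density M ?h) = sigma_sets UNIV (Collect closed)" "sets (density N ?h) = sigma_sets UNIV (Collect closed)"
      using sf_borelD(2)[OF M] sf_borelD(2)[OF N] by (simp_all only: sets_density sb)
    fix X :: "'a set" assume "X \<in> Collect closed"
    then have X: "closed X" "X \<in> sets M" "X \<in> sets N"
      using sf_borelD(2)[OF M] sf_borelD(2)[OF N] by auto
    show "emeasure (density M ?h) X = emeasure (density N ?h) X"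
      unfolding emeasure_density[OF h(1) X(2)] emeasure_density[OF h(2) X(3)] by (rule closed_eq[OF X(1)])
  next
    show "emeasure (density M ?h) UNIV \<noteq> \<infinity>"
      using h_fin emeasure_density[OF h(1), of UNIV] sf_borelD(2)[OF M] by simp
  qed auto
  \<comment> \<open>The Gaussian is positive everywhere, so the density can be divided out.\<close>
  have recover: "emeasure L B = (\<integral>\<^sup>+ x. ennreal (1 / heat 1 x) * indicator B x \<partial>density L ?h)"
    if L: "sf_borel L" and B: "B \<in> sets borel" for L B
  proof -
    note [measurable] = B
    have hL: "?h \<in> borel_measurable L" "(\<lambda>x. ennreal (1 / heat 1 x) * indicator B x) \<in> borel_measurable L"
      by (rule sf_borel_measurable1[OF L], measurable)+
    have "?h x * (ennreal (1 / heat 1 x) * indicator B x) = indicator B x" for x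
      using heat_pos[of 1 x] by (simp add: mult.assoc[symmetric] ennreal_mult'[symmetric])
    then have "(\<integral>\<^sup>+ x. ennreal (1 / heat 1 x) * indicator B x \<partial>density L ?h) = (\<integral>\<^sup>+ x. indicator B x \<partial>L)"
      by (subst nn_integral_density[OF hL]) simp
    then show ?thesis using B sf_borelD(2)[OF L] by simp
  qed
  show ?thesis
  proof (rule measure_eqI)
    show "sets M = sets N" using sf_borelD(2)[OF M] sf_borelD(2)[OF N] by simp
    fix B assume "B \<in> sets M"
    then have "B \<in> sets borel" using sf_borelD(2)[OF M] by simp
    then show "emeasure M B = emeasure N B" using recover[OF M] recover[OF N] dens by simp
  qed
qed

section \<open>Integrability of the weight, polarisation and strict positivity\<close>

context riesz begin

lemma energy_heat_measure: "0 < c \<Longrightarrow> energy \<alpha> (heat_measure c :: 'a measure) < \<infinity>"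
proof -
  assume c: "0 < c"
  have "energy \<alpha> (heat_measure c :: 'a measure) = (\<integral>\<^sup>+ x. potential \<alpha> (heat_measure c) x \<partial>(heat_measure c :: 'a measure))"
    unfolding energy_def by (rule mutual_energy_eq_potential) auto
  also have "\<dots> = (\<integral>\<^sup>+ x. riesz_const \<alpha> TYPE('a) * heat_fun_mix (riesz_time \<alpha>) (\<lambda>x::'a. ennreal (heat c x)) x \<partial>heat_measure c)"
    by (simp add: potential_eq_heat_flow heat_flow_heat_measure heat_fun_mix_def)
  also have "\<dots> = riesz_const \<alpha> TYPE('a) * (\<integral>\<^sup>+ x. heat_fun_mix (riesz_time \<alpha>) (\<lambda>x::'a. ennreal (heat c x)) x * ennreal (heat c x) \<partial>lborel)"
    unfolding heat_measure_def using borel_measurable_heat_fun_mix[OF sf_borel_riesz_time, of "\<lambda>x::'a. ennreal (heat c x)"]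
    by (subst nn_integral_density) (auto simp: nn_integral_cmult[symmetric] mult_ac)
  also have "\<dots> < \<infinity>"
    using nn_integral_K_heat_1[OF c] riesz_const_pos by (simp add: ennreal_mult_less_top)
  finally show ?thesis .
qed

lemma two_mutual_energy_le:
  assumes M: "sf_borel (M::'a measure)" and N: "sf_borel N"
  shows "2 * mutual_energy \<alpha> M N \<le> energy \<alpha> M + energy \<alpha> N"
proof -
  note [measurable] = borel_measurable_heat_flow[OF M] borel_measurable_heat_flow[OF N]
  have "2 * mutual_energy \<alpha> M N = riesz_const \<alpha> TYPE('a) *
    (\<integral>\<^sup>+ t. \<integral>\<^sup>+ z. 2 * (heat_flow (t / 2) M z * heat_flow (t / 2) N z) \<partial>lborel \<partial>riesz_time \<alpha>)"
    unfolding mutual_energy_heat_flow[OF M N] by (simp add: nn_integral_cmult mult_ac)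
  also have "\<dots> \<le> riesz_const \<alpha> TYPE('a) *
    (\<integral>\<^sup>+ t. \<integral>\<^sup>+ z. heat_flow (t / 2) M z * heat_flow (t / 2) M z + heat_flow (t / 2) N z * heat_flow (t / 2) N z \<partial>lborel \<partial>riesz_time \<alpha>)"
    by (intro mult_left_mono nn_integral_mono two_mult_le_squares_ennreal) auto
  also have "\<dots> = energy \<alpha> M + energy \<alpha> N"
    unfolding energy_def mutual_energy_heat_flow[OF M M] mutual_energy_heat_flow[OF N N]
    by (simp add: nn_integral_add distrib_left)
  finally show ?thesis .
qed

lemma mutual_energy_finite:
  assumes "sf_borel (M::'a measure)" "sf_borel N" "energy \<alpha> M < \<infinity>" "energy \<alpha> N < \<infinity>"
  shows "mutual_energy \<alpha> M N < \<infinity>"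
proof -
  have "2 * mutual_energy \<alpha> M N < \<infinity>"
    using two_mutual_energy_le[OF assms(1,2)] assms(3,4) by (auto intro: le_less_trans)
  then show ?thesis by (auto simp: ennreal_mult_less_top)
qed

lemma cball_borel [measurable]: "cball (c::'a) r \<in> sets borel" "ball (c::'a) r \<in> sets borel"
  by auto

definition weight_const :: ennreal where
  "weight_const = (\<integral>\<^sup>+ y. ennreal (heat 1 (y::'a)) * indicator (cball 0 1) y \<partial>lborel)"

lemma weight_const: "0 < weight_const"
proof -
  have "weight_const \<noteq> 0"
  proof
    assume "weight_const = 0"
    then have "AE y in lborel. ennreal (heat 1 (y::'a)) * indicator (cball 0 1) y = 0"
      unfolding weight_const_def by (subst (asm) nn_integral_0_iff_AE) auto
    then have "AE y in lborel. (y::'a) \<notin> ball 0 1"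
    proof eventually_elim
      fix y :: 'a assume "ennreal (heat 1 (y::'a)) * indicator (cball 0 1) y = 0"
      then show "y \<notin> ball 0 1" using heat_pos[of 1 y] by (auto simp: indicator_def split: if_splits)
    qed
    then have "emeasure lborel (ball (0::'a) 1) = 0"
      by (subst (asm) AE_iff_measurable[of "ball 0 1"]) auto
    then show False using unit_ball_vol_pos[of "real DIM('a)"] by (simp add: emeasure_ball)
  qed
  then show ?thesis by (simp add: zero_less_iff_neq_zero)
qed

text \<open>For |y| <= 1 the distance from x to y is at most 1 + |x| and the kernel decreases with
  distance; \<open>weight_const\<close> is the Gaussian mass of the unit ball.\<close>

lemma potential_heat_measure_ge:
  "weight_const * ennreal (riesz_weight \<alpha> (x::'a)) \<le> potential \<alpha> (heat_measure 1) x"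
proof -
  have "weight_const * ennreal (riesz_weight \<alpha> (x::'a)) = (\<integral>\<^sup>+ y. ennreal (heat 1 (y::'a)) * (indicator (cball 0 1) y * ennreal (riesz_weight \<alpha> x)) \<partial>lborel)"
    unfolding weight_const_def by (subst nn_integral_multc[symmetric]) (simp_all add: mult.assoc)
  also have "\<dots> \<le> (\<integral>\<^sup>+ y. ennreal (heat 1 (y::'a)) * riesz_kernel \<alpha> x y \<partial>lborel)"
  proof (intro nn_integral_mono mult_left_mono)
    fix y :: 'a
    show "indicator (cball 0 1) y * ennreal (riesz_weight \<alpha> x) \<le> riesz_kernel \<alpha> x y"
    proof (cases "x = y \<or> y \<notin> cball 0 1")
      case False
      then have "norm (x - y) \<le> 1 + norm x" using norm_triangle_ineq4[of x y] by simp
      then have "riesz_weight \<alpha> x \<le> norm (x - y) powr (\<alpha> - real DIM('a))"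
        unfolding riesz_weight_def using False alpha_le dim3 by (intro powr_mono2') auto
      then show ?thesis using False by (simp add: riesz_kernel_def ennreal_leI)
    qed (auto simp: riesz_kernel_def)
  qed simp
  also have "\<dots> = potential \<alpha> (heat_measure 1) x"
  proof -
    have [measurable]: "riesz_kernel \<alpha> x \<in> borel_measurable borel"
      unfolding riesz_kernel_def[abs_def] by measurable
    show ?thesis unfolding potential_def heat_measure_def by (subst nn_integral_density) auto
  qed
  finally show ?thesis .
qed

text \<open>The weight is below the potential of a Gaussian of finite energy, so its integral is
  controlled by a mutual energy. The explicit bound makes the estimate uniform along a minimising
  sequence.\<close>

lemma nn_integral_weight_le:
  assumes M: "sf_borel (M::'a measure)"
  shows "2 * (weight_const * (\<integral>\<^sup>+ x. ennreal (riesz_weight \<alpha> x) \<partial>M)) \<le> energy \<alpha> (heat_measure 1 :: 'a measure) + energy \<alpha> M"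
proof -
  have [measurable]: "(\<lambda>y. ennreal (riesz_weight \<alpha> y)) \<in> borel_measurable M"
    by (auto intro!: sf_borel_measurable1[OF M])
  have "weight_const * (\<integral>\<^sup>+ x. ennreal (riesz_weight \<alpha> x) \<partial>M) \<le> (\<integral>\<^sup>+ x. potential \<alpha> (heat_measure 1) x \<partial>M)"
    by (subst nn_integral_cmult[symmetric]) (auto intro!: nn_integral_mono potential_heat_measure_ge)
  also have "\<dots> = mutual_energy \<alpha> (heat_measure 1) M"
    by (rule mutual_energy_eq_potential[symmetric]) (use M in auto)
  finally have "2 * (weight_const * (\<integral>\<^sup>+ x. ennreal (riesz_weight \<alpha> x) \<partial>M)) \<le> 2 * mutual_energy \<alpha> (heat_measure 1) M"
    by (intro mult_left_mono) auto
  also have "\<dots> \<le> energy \<alpha> (heat_measure 1 :: 'a measure) + energy \<alpha> M"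
    by (rule two_mutual_energy_le) (use M in auto)
  finally show ?thesis .
qed

lemma nn_integral_weight_finite:
  assumes M: "sf_borel (M::'a measure)" and fin: "energy \<alpha> M < \<infinity>"
  shows "(\<integral>\<^sup>+ x. ennreal (riesz_weight \<alpha> x) \<partial>M) < \<infinity>"
proof -
  have "2 * (weight_const * (\<integral>\<^sup>+ x. ennreal (riesz_weight \<alpha> x) \<partial>M)) < \<infinity>"
    using nn_integral_weight_le[OF M] energy_heat_measure[of 1] fin by (auto intro: le_less_trans)
  then show ?thesis using weight_const by (auto simp: ennreal_mult_less_top)
qed

lemma heat_flow_finite:
  assumes M: "sf_borel (M::'a measure)" and fin: "energy \<alpha> M < \<infinity>" and t: "0 < t"
  shows "heat_flow t M z < \<infinity>"
  by (rule heat_flow_finite_weight[OF M t nn_integral_weight_finite[OF M fin]])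

text \<open>The polarisation identity, from a^2 + b^2 = 2ab + (a - b)^2 pointwise; finite heat flows
  justify the conversion to reals.\<close>

lemma energy_add_eq:
  assumes M: "sf_borel (M::'a measure)" and N: "sf_borel N" and fin: "energy \<alpha> M < \<infinity>" "energy \<alpha> N < \<infinity>"
  shows "energy \<alpha> M + energy \<alpha> N = 2 * mutual_energy \<alpha> M N + heat_dist \<alpha> M N"
proof -
  note [measurable] = borel_measurable_heat_flow[OF M] borel_measurable_heat_flow[OF N]
  have sq: "x * x + y * y = 2 * (x * y) + ennreal ((enn2real x - enn2real y)\<^sup>2)" if fin_xy: "x < \<infinity>" "y < \<infinity>" for x y :: ennreal
  proof -
    obtain a b where ab: "x = ennreal a" "y = ennreal b" "0 \<le> a" "0 \<le> b"
      using fin_xy by (cases x; cases y) auto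
    have "a * a + b * b = 2 * (a * b) + (a - b)\<^sup>2" by (simp add: power2_eq_square algebra_simps)
    then have "ennreal (a * a + b * b) = ennreal (2 * (a * b) + (a - b)\<^sup>2)" by simp
    then show ?thesis using ab by (simp add: ennreal_mult' ennreal_plus)
  qed
  have "energy \<alpha> M + energy \<alpha> N = riesz_const \<alpha> TYPE('a) *
    (\<integral>\<^sup>+ t. \<integral>\<^sup>+ z. heat_flow (t / 2) M z * heat_flow (t / 2) M z + heat_flow (t / 2) N z * heat_flow (t / 2) N z \<partial>lborel \<partial>riesz_time \<alpha>)"
    unfolding energy_def mutual_energy_heat_flow[OF M M] mutual_energy_heat_flow[OF N N]
    by (simp add: nn_integral_add distrib_left)
  also have "\<dots> = riesz_const \<alpha> TYPE('a) *
    (\<integral>\<^sup>+ t. \<integral>\<^sup>+ z. 2 * (heat_flow (t / 2) M z * heat_flow (t / 2) N z) +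
      ennreal ((enn2real (heat_flow (t / 2) M z) - enn2real (heat_flow (t / 2) N z))\<^sup>2) \<partial>lborel \<partial>riesz_time \<alpha>)"
    by (intro arg_cong[where f="\<lambda>x. _ * x"] nn_integral_riesz_time_cong nn_integral_cong sq heat_flow_finite M N fin) auto
  also have "\<dots> = 2 * mutual_energy \<alpha> M N + heat_dist \<alpha> M N"
    unfolding mutual_energy_heat_flow[OF M N] heat_dist_def
    by (simp add: nn_integral_add nn_integral_cmult distrib_left mult_ac)
  finally show ?thesis .
qed

text \<open>A vanishing distance makes the flows agree almost everywhere at almost every time; a
  sequence of such times tending to 0 then determines the measure.\<close>

lemma heat_dist_0_imp_eq:
  assumes M: "sf_borel (M::'a measure)" and N: "sf_borel N" and fin: "energy \<alpha> M < \<infinity>" "energy \<alpha> N < \<infinity>"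
    and 0: "heat_dist \<alpha> M N = 0"
  shows "M = N"
proof -
  note [measurable] = borel_measurable_heat_flow[OF M] borel_measurable_heat_flow[OF N]
  have "AE t in riesz_time \<alpha>. (\<integral>\<^sup>+ z. ennreal ((enn2real (heat_flow (t / 2) M z) - enn2real (heat_flow (t / 2) N z))\<^sup>2) \<partial>lborel) = 0"
    using 0 riesz_const_pos unfolding heat_dist_def by (subst (asm) mult_eq_0_iff, subst (asm) nn_integral_0_iff_AE) auto
  then have ae: "AE t in riesz_time \<alpha>. AE z in lborel. heat_flow (t / 2) M z = heat_flow (t / 2) N z"
    using AE_riesz_time
  proof eventually_elim
    fix t :: real
    assume t: "0 < t" and "(\<integral>\<^sup>+ z. ennreal ((enn2real (heat_flow (t / 2) M z) - enn2real (heat_flow (t / 2) N z))\<^sup>2) \<partial>lborel) = 0"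
    then have "AE z in lborel. ennreal ((enn2real (heat_flow (t / 2) M z) - enn2real (heat_flow (t / 2) N z))\<^sup>2) = 0"
      by (subst (asm) nn_integral_0_iff_AE) auto
    then show "AE z in lborel. heat_flow (t / 2) M z = heat_flow (t / 2) N z"
    proof eventually_elim
      fix z assume "ennreal ((enn2real (heat_flow (t / 2) M z) - enn2real (heat_flow (t / 2) N z))\<^sup>2) = 0"
      then have "enn2real (heat_flow (t / 2) M z) = enn2real (heat_flow (t / 2) N z)" by (simp add: ennreal_eq_0_iff)
      moreover have "heat_flow (t / 2) M z < top" "heat_flow (t / 2) N z < top"
        using heat_flow_finite[OF M fin(1), of "t / 2" z] heat_flow_finite[OF N fin(2), of "t / 2" z] t by auto
      ultimately show "heat_flow (t / 2) M z = heat_flow (t / 2) N z"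
        by (metis ennreal_enn2real)
    qed
  qed
  \<comment> \<open>Good times exist below every bound, because \<open>riesz_time\<close> charges
    every interval at 0; the interval reaches 2 \<epsilon> since flows are taken at t/2.\<close>
  have ex: "\<exists>s>0. s \<le> \<epsilon> \<and> (AE z in lborel. heat_flow s M z = heat_flow s N z)" if \<epsilon>: "0 < \<epsilon>" for \<epsilon>
  proof (rule ccontr)
    assume neg: "\<not> ?thesis"
    from ae have "AE t in riesz_time \<alpha>. t \<notin> {0<..2 * \<epsilon>}"
    proof eventually_elim
      fix t :: real assume *: "AE z in lborel. heat_flow (t / 2) M z = heat_flow (t / 2) N z"
      show "t \<notin> {0<..2 * \<epsilon>}"
      proof
        assume "t \<in> {0<..2 * \<epsilon>}"
        then have "0 < t / 2 \<and> t / 2 \<le> \<epsilon>" by auto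
        with * neg show False by blast
      qed
    qed
    then have "(\<integral>\<^sup>+ t. indicator {..2 * \<epsilon>} t \<partial>riesz_time \<alpha>) = 0"
      using AE_riesz_time[of \<alpha>] by (subst nn_integral_0_iff_AE) (auto elim!: eventually_rev_mp simp: indicator_def)
    then show False
      using riesz_time_mass[OF alpha_pos, of "2 * \<epsilon>"] \<epsilon> by (simp add: riesz_time_mass_def)
  qed
  define s where "s j = (SOME s. 0 < s \<and> s \<le> inverse (real (Suc j)) \<and> (AE z in lborel. heat_flow s M z = heat_flow s N z))" for j
  have s: "0 < s j" "s j \<le> inverse (real (Suc j))" "AE z in lborel. heat_flow (s j) M z = heat_flow (s j) N z" for j
    using someI_ex[OF ex[of "inverse (real (Suc j))"]] unfolding s_def by auto
  show ?thesis
  proof (rule measure_eq_of_heat_flow_eq[OF M N _ _ _ _ _ _ s(3)])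
    show "s j \<le> 1" for j using s(2)[of j] by (rule order_trans) (simp add: field_simps)
    show "s \<longlonglongrightarrow> 0"
    proof (rule real_tendsto_sandwich[OF _ _ tendsto_const LIMSEQ_inverse_real_of_nat])
      show "eventually (\<lambda>j. 0 \<le> s j) sequentially"
        by (intro always_eventually allI less_imp_le s(1))
      show "eventually (\<lambda>j. s j \<le> inverse (real (Suc j))) sequentially"
        by (intro always_eventually allI s(2))
    qed
  qed (auto intro!: heat_flow_finite M N fin s(1) simp flip: infinity_ennreal_def)
qed

end

section \<open>Existence of the projection\<close>

lemma carried_by_borel:
  assumes "sets \<nu> = sets borel" "Q \<in> sets borel"
  shows "carried_by \<nu> Q \<longleftrightarrow> emeasure \<nu> (- Q) = 0"
proof -
  have Q: "Q \<in> sets \<nu>" "- Q \<in> sets \<nu>" using assms by auto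
  then have "Q \<in> sets (completion \<nu>)" by simp
  moreover have "- Q \<in> null_sets (completion \<nu>) \<longleftrightarrow> - Q \<in> null_sets \<nu>"
    using Q(2) by (rule null_sets_completion_iff)
  ultimately show ?thesis using Q by (auto simp: carried_by_def null_sets_def)
qed

lemma energy_cone_on_iff:
  assumes "Q \<in> sets borel"
  shows "\<nu> \<in> energy_cone_on \<alpha> Q \<longleftrightarrow> \<nu> \<in> energy_cone \<alpha> \<and> emeasure \<nu> (- Q) = 0"
  using carried_by_borel[OF _ assms, of \<nu>] by (auto simp: energy_cone_on_def dest: energy_coneD)

lemma nn_integral_null_measure [simp]: "(\<integral>\<^sup>+ x. f x \<partial>null_measure M) = 0"
  by (subst nn_integral_cong_AE[of f "\<lambda>_. 0"]) (auto intro!: AE_I[where N="space M"])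

lemma null_measure_energy_cone: "null_measure borel \<in> energy_cone \<alpha>"
proof -
  have "radon (null_measure (borel :: 'a measure))" by (simp add: radon_def)
  then show ?thesis
    using radon_sf_borel[of "null_measure (borel :: 'a measure)"]
    by (simp add: energy_cone_def energy_def mutual_energy_eq_potential)
qed

section \<open>Minimising sequences and their vague limits\<close>

context riesz begin

text \<open>Only finite heat flows of N are assumed, so the estimate can establish that a vague
  limit has finite energy.\<close>

lemma energy_le_heat_dist:
  assumes M: "sf_borel (M::'a measure)" and N: "sf_borel N"
    and fin: "\<And>t z. 0 < t \<Longrightarrow> heat_flow t M z < \<infinity>" "\<And>t z. 0 < t \<Longrightarrow> heat_flow t N z < \<infinity>"
  shows "energy \<alpha> N \<le> 2 * energy \<alpha> M + 2 * heat_dist \<alpha> M N"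
proof -
  note [measurable] = borel_measurable_heat_flow[OF M] borel_measurable_heat_flow[OF N]
  have sq: "y * y \<le> 2 * (x * x) + 2 * ennreal ((enn2real x - enn2real y)\<^sup>2)" if fin_xy: "x < \<infinity>" "y < \<infinity>" for x y :: ennreal
  proof -
    obtain a b where ab: "x = ennreal a" "y = ennreal b" "0 \<le> a" "0 \<le> b"
      using fin_xy by (cases x; cases y) auto
    \<comment> \<open>This square is exactly 2 a^2 + 2 (a - b)^2 - b^2.\<close>
    have "0 \<le> (2 * a - b)\<^sup>2" by simp
    then have "b * b \<le> 2 * (a * a) + 2 * (a - b)\<^sup>2" by (simp add: power2_eq_square algebra_simps)
    then have "ennreal (b * b) \<le> ennreal (2 * (a * a) + 2 * (a - b)\<^sup>2)" by (rule ennreal_leI)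
    then show ?thesis using ab by (simp add: ennreal_mult' ennreal_plus)
  qed
  have "energy \<alpha> N = riesz_const \<alpha> TYPE('a) *
    (\<integral>\<^sup>+ t. \<integral>\<^sup>+ z. heat_flow (t / 2) N z * heat_flow (t / 2) N z \<partial>lborel \<partial>riesz_time \<alpha>)"
    unfolding energy_def by (rule mutual_energy_heat_flow[OF N N])
  also have "\<dots> \<le> riesz_const \<alpha> TYPE('a) *
    (\<integral>\<^sup>+ t. \<integral>\<^sup>+ z. 2 * (heat_flow (t / 2) M z * heat_flow (t / 2) M z) +
      2 * ennreal ((enn2real (heat_flow (t / 2) M z) - enn2real (heat_flow (t / 2) N z))\<^sup>2) \<partial>lborel \<partial>riesz_time \<alpha>)"
    by (intro mult_left_mono nn_integral_riesz_time_mono nn_integral_mono sq fin) auto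
  also have "\<dots> = 2 * energy \<alpha> M + 2 * heat_dist \<alpha> M N"
    unfolding energy_def mutual_energy_heat_flow[OF M M] heat_dist_def
    by (simp add: nn_integral_add nn_integral_cmult distrib_left mult_ac)
  finally show ?thesis .
qed

lemma heat_dist_null: "M \<in> energy_cone \<alpha> \<Longrightarrow> heat_dist \<alpha> M (null_measure borel) = energy \<alpha> (M :: 'a measure)"
proof -
  assume M: "M \<in> energy_cone \<alpha>"
  note M = energy_coneD[OF M] and N = energy_coneD[OF null_measure_energy_cone[of \<alpha>, where 'a='a]]
  have "mutual_energy \<alpha> M (null_measure borel) = 0"
    unfolding mutual_energy_eq_potential[OF M(2) N(2)] by simp
  moreover have "energy \<alpha> (null_measure (borel :: 'a measure)) = 0"
    unfolding energy_def mutual_energy_eq_potential[OF N(2) N(2)] by simp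
  ultimately show ?thesis using energy_add_eq[OF M(2) N(2) M(3) N(3)] by simp
qed

lemma riesz_weight_le_1: "riesz_weight \<alpha> (x::'a) \<le> 1"
proof -
  have "(1 + norm x) powr (\<alpha> - real DIM('a)) \<le> (1 + norm x) powr 0"
    using alpha_le dim3 by (intro powr_mono) auto
  moreover have "1 + norm x \<noteq> 0" by (smt (verit) norm_ge_zero)
  ultimately show ?thesis by (simp add: riesz_weight_def)
qed

lemma heat_1_tendsto_0:
  fixes g :: "'a \<Rightarrow> real"
  assumes "\<And>x. 0 \<le> g x" "\<And>x. g x \<le> 1"
  shows "((\<lambda>x. g x * heat 1 x) \<longlongrightarrow> 0) at_infinity"
proof (rule tendsto_sandwich[OF _ _ tendsto_const heat_div_weight(2)[of 1 "0::'a" \<alpha>]])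
  show "eventually (\<lambda>x. 0 \<le> g x * heat 1 x) at_infinity"
    using assms by (intro always_eventually allI) simp
  show "eventually (\<lambda>x. g x * heat 1 x \<le> heat 1 (0 - x) / riesz_weight \<alpha> x) at_infinity"
  proof (intro always_eventually allI)
    fix x :: 'a
    have "g x * heat 1 x \<le> heat 1 x" using assms by (intro mult_left_le_one_le) auto
    also have "\<dots> = heat 1 (0 - x)" by (simp add: heat_cong_norm[OF norm_minus_cancel])
    also have "\<dots> \<le> heat 1 (0 - x) / riesz_weight \<alpha> x"
      using riesz_weight_le_1[of x] riesz_weight_pos[of \<alpha> x] by (simp add: pos_le_divide_eq mult_left_le)
    finally show "g x * heat 1 x \<le> heat 1 (0 - x) / riesz_weight \<alpha> x" .
  qed
qed simp

text \<open>The weighted measures have bounded mass, so a subsequence converges; flows converge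
  pointwise, the distance is lower semicontinuous by Fatou, and a closed carrier passes to the
  limit.\<close>

theorem heat_dist_minimizer:
  assumes A: "closed (A :: 'a set)" and \<mu>: "\<mu> \<in> energy_cone \<alpha>"
  obtains \<nu> where "\<nu> \<in> energy_cone_on \<alpha> A" "\<And>\<rho>. \<rho> \<in> energy_cone_on \<alpha> A \<Longrightarrow> heat_dist \<alpha> \<mu> \<nu> \<le> heat_dist \<alpha> \<mu> \<rho>"
proof -
  have A_borel: "A \<in> sets borel" using A by simp
  note on_iff = energy_cone_on_iff[OF A_borel]
  define d where "d = (INF \<rho> \<in> energy_cone_on \<alpha> A. heat_dist \<alpha> \<mu> \<rho>)"
  have E\<mu>: "energy \<alpha> \<mu> < \<infinity>" using energy_coneD(3)[OF \<mu>] .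
  have "null_measure borel \<in> energy_cone_on \<alpha> A"
    by (simp add: on_iff null_measure_energy_cone)
  then have "d \<le> energy \<alpha> \<mu>"
    unfolding d_def by (rule INF_lower2) (simp add: heat_dist_null[OF \<mu>])
  then have d_fin: "d < \<infinity>" using E\<mu> by (rule le_less_trans)
  have "\<exists>\<rho>\<in>energy_cone_on \<alpha> A. heat_dist \<alpha> \<mu> \<rho> < d + ennreal (inverse (real (Suc j)))" for j
  proof -
    have "d < d + ennreal (inverse (real (Suc j)))"
      using d_fin by (cases d) (auto simp: ennreal_plus[symmetric] ennreal_less_iff simp del: ennreal_plus)
    then show ?thesis by (subst (asm) (1) d_def) (simp add: INF_less_iff)
  qed
  then obtain N where N: "\<And>j. N j \<in> energy_cone_on \<alpha> A"
    and N_lt: "\<And>j. heat_dist \<alpha> \<mu> (N j) < d + ennreal (inverse (real (Suc j)))" by metis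
  have N_cone: "N j \<in> energy_cone \<alpha>" and N_null: "emeasure (N j) (- A) = 0" for j
    using N[of j] by (auto simp: on_iff)
  note NS = energy_coneD[OF N_cone]
  have N_flow: "0 < t \<Longrightarrow> heat_flow t (N j) z < \<infinity>" for j t z
    by (rule heat_flow_finite[OF NS(2,3)])
  have \<mu>_flow: "0 < t \<Longrightarrow> heat_flow t \<mu> z < \<infinity>" for t z
    by (rule heat_flow_finite[OF energy_coneD(2,3)[OF \<mu>]])
  \<comment> \<open>Since every distance to \<mu> in the sequence is at most d + 1, this bounds the
    right side of \<open>nn_integral_weight_le\<close> uniformly in j.\<close>
  define K where "K = energy \<alpha> (heat_measure 1 :: 'a measure) + (2 * energy \<alpha> \<mu> + 2 * (d + 1))"
  have K: "K < \<infinity>" using energy_heat_measure[of 1] E\<mu> d_fin by (simp add: K_def ennreal_mult_less_top)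
  have E_le: "energy \<alpha> (heat_measure 1 :: 'a measure) + energy \<alpha> (N j) \<le> K" for j
  proof -
    have "energy \<alpha> (N j) \<le> 2 * energy \<alpha> \<mu> + 2 * heat_dist \<alpha> \<mu> (N j)"
      by (intro energy_le_heat_dist energy_coneD(2)[OF \<mu>] NS \<mu>_flow N_flow)
    also have "heat_dist \<alpha> \<mu> (N j) \<le> d + 1"
    proof -
      have "ennreal (inverse (real (Suc j))) \<le> ennreal 1" by (intro ennreal_leI) (simp add: field_simps)
      then have "d + ennreal (inverse (real (Suc j))) \<le> d + 1" by (simp add: add_left_mono)
      then show ?thesis using N_lt[of j] by (meson less_imp_le order_trans)
    qed
    finally show ?thesis unfolding K_def by (simp add: add_left_mono mult_left_mono)
  qed
  define C0 where "C0 = K / (2 * weight_const)"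
  have "C0 < \<infinity>"
    using K weight_const by (auto simp: C0_def ennreal_divide_eq_top_iff less_top[symmetric])
  then obtain C1 where C1: "C0 = ennreal C1" "0 \<le> C1" by (cases C0) auto
  \<comment> \<open>The added 1 ensures the positivity that \<open>vague_compactness\<close> asks
    for.\<close>
  define C where "C = C1 + 1"
  have wc_fin: "weight_const < \<infinity>"
  proof -
    have "weight_const \<le> (\<integral>\<^sup>+ y. ennreal (heat 1 (0 - y :: 'a)) \<partial>lborel)"
      unfolding weight_const_def by (intro nn_integral_mono) (auto simp: indicator_def heat_cong_norm[OF norm_minus_cancel])
    also have "\<dots> = 1" by (rule nn_integral_heat) simp
    finally show ?thesis by (auto intro: le_less_trans)
  qed
  let ?w = "\<lambda>x::'a. ennreal (riesz_weight \<alpha> x)"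
  have w_meas: "?w \<in> borel_measurable (N j)" for j
    by (rule sf_borel_measurable1[OF NS(2)]) measurable
  have mass: "emeasure (density (N j) ?w) UNIV \<le> ennreal C" for j
  proof -
    have "2 * (weight_const * (\<integral>\<^sup>+ x. ?w x \<partial>N j)) \<le> K"
      using nn_integral_weight_le[OF NS(2)[of j]] E_le by (rule order_trans)
    then have "(2 * weight_const) * (\<integral>\<^sup>+ x. ?w x \<partial>N j) \<le> K" by (simp add: mult.assoc)
    moreover have "(2 * weight_const) * C0 = K"
      unfolding C0_def using weight_const wc_fin
      by (subst ennreal_times_divide, subst mult.commute, subst mult_divide_eq_ennreal) (auto simp: ennreal_mult_eq_top_iff less_top)
    moreover have "2 * weight_const \<noteq> 0" "2 * weight_const \<noteq> top"
      using weight_const wc_fin by (auto simp: ennreal_mult_eq_top_iff)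
    ultimately have "(\<integral>\<^sup>+ x. ?w x \<partial>N j) \<le> C0"
      by (metis ennreal_mult_le_mult_iff)
    moreover have "emeasure (density (N j) ?w) UNIV = (\<integral>\<^sup>+ x. ?w x \<partial>N j)"
      using emeasure_density[OF w_meas[of j], of UNIV] NS(4)[of j] by simp
    moreover have "C0 \<le> ennreal C" unfolding C1(1) C_def by (rule ennreal_leI) simp
    ultimately show ?thesis by (metis order_trans)
  qed
  obtain \<phi> L where \<phi>: "strict_mono \<phi>" and L: "sets L = sets (borel :: 'a measure)" and L_mass: "emeasure L UNIV \<le> ennreal C"
    and L_lim: "\<And>f. continuous_on UNIV f \<Longrightarrow> (\<And>x. 0 \<le> f x) \<Longrightarrow> (f \<longlongrightarrow> 0) at_infinity \<Longrightarrow>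
      (\<lambda>j. \<integral>\<^sup>+ x. ennreal (f x) \<partial>density (N (\<phi> j)) ?w) \<longlonglongrightarrow> (\<integral>\<^sup>+ x. ennreal (f x) \<partial>L)"
    using vague_compactness[of "\<lambda>j. density (N j) ?w" C] mass NS(4) C1 by (auto simp: C_def)
  have L_sp: "space L = UNIV" using sets_eq_imp_space_eq[OF L] by simp
  have L_meas: "f \<in> borel_measurable borel \<Longrightarrow> f \<in> borel_measurable L" for f :: "'a \<Rightarrow> ennreal"
    using measurable_cong_sets[OF L refl] by blast
  \<comment> \<open>The weight is divided out again; it is bounded below on compact sets, so the
    result is a Radon measure.\<close>
  define \<nu> where "\<nu> = density L (\<lambda>x. ennreal (1 / riesz_weight \<alpha> x))"
  have \<nu>_sets: "sets \<nu> = sets borel" by (simp add: \<nu>_def L)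
  have \<nu>_int: "(\<integral>\<^sup>+ x. f x \<partial>\<nu>) = (\<integral>\<^sup>+ x. ennreal (1 / riesz_weight \<alpha> x) * f x \<partial>L)" if "f \<in> borel_measurable borel" for f
    unfolding \<nu>_def by (rule nn_integral_density) (auto intro!: L_meas that)
  have \<nu>_radon: "radon \<nu>"
    unfolding radon_def
  proof (intro conjI \<nu>_sets allI impI)
    fix S :: "'a set" assume S: "compact S"
    then obtain R where R: "\<And>x. x \<in> S \<Longrightarrow> norm x \<le> R" using compact_imp_bounded by (meson bounded_iff)
    have S_borel: "S \<in> sets borel" using S by (simp add: compact_imp_closed)
    have "emeasure \<nu> S = (\<integral>\<^sup>+ x. ennreal (1 / riesz_weight \<alpha> x) * indicator S x \<partial>L)"
      using S_borel \<nu>_sets \<nu>_int[of "indicator S"] by simp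
    also have "\<dots> \<le> (\<integral>\<^sup>+ x. ennreal ((1 + R) powr (real DIM('a) - \<alpha>)) \<partial>L)"
    proof (intro nn_integral_mono)
      fix x :: 'a
      show "ennreal (1 / riesz_weight \<alpha> x) * indicator S x \<le> ennreal ((1 + R) powr (real DIM('a) - \<alpha>))"
      proof (cases "x \<in> S")
        case True
        have "1 / riesz_weight \<alpha> x = (1 + norm x) powr (real DIM('a) - \<alpha>)"
          using riesz_weight_inverse[of \<alpha> x] by (simp add: divide_inverse)
        also have "\<dots> \<le> (1 + R) powr (real DIM('a) - \<alpha>)"
          using R[OF True] alpha_le dim3 by (intro powr_mono2) auto
        finally show ?thesis using True by (simp add: ennreal_leI)
      qed simp
    qed
    also have "\<dots> < \<infinity>"
      using L_mass L_sp by (auto simp: ennreal_mult_less_top intro: le_less_trans)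
    finally show "emeasure \<nu> S < \<infinity>" .
  qed
  note \<nu>_sf = radon_sf_borel[OF \<nu>_radon]
  have flow_eq: "heat_flow t \<nu> z = (\<integral>\<^sup>+ y. ennreal (heat t (z - y) / riesz_weight \<alpha> y) \<partial>L)" for t z
  proof -
    have "ennreal (1 / riesz_weight \<alpha> y) * ennreal (heat t (z - y)) = ennreal (heat t (z - y) / riesz_weight \<alpha> y)" for y
      using riesz_weight_pos[of \<alpha> y] by (simp add: ennreal_mult'[symmetric])
    then show ?thesis unfolding heat_flow_def by (subst \<nu>_int) auto
  qed
  have flow_fin: "heat_flow t \<nu> z < \<infinity>" if t: "0 < t" for t z
  proof -
    obtain B where B: "0 \<le> B" "\<And>y. \<bar>heat t (z - y) / riesz_weight \<alpha> y\<bar> \<le> B"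
      using bounded_vanishing_at_infinity[OF heat_div_weight[OF t, of z \<alpha>]] by blast
    have "heat_flow t \<nu> z \<le> (\<integral>\<^sup>+ y. ennreal B \<partial>L)"
      unfolding flow_eq by (intro nn_integral_mono ennreal_leI order_trans[OF abs_ge_self B(2)])
    also have "\<dots> < \<infinity>"
      using L_mass L_sp by (auto simp: ennreal_mult_less_top intro: le_less_trans)
    finally show ?thesis .
  qed
  have flow_lim: "(\<lambda>j. heat_flow t (N (\<phi> j)) z) \<longlonglongrightarrow> heat_flow t \<nu> z" if t: "0 < t" for t z
    unfolding flow_eq nn_integral_heat_flow_weight[OF NS(2) t, of _ z \<alpha>]
  proof (rule L_lim)
    show "0 \<le> heat t (z - x) / riesz_weight \<alpha> x" for x using riesz_weight_pos[of \<alpha> x] by simp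
  qed (use heat_div_weight[OF t, of z \<alpha>] in auto)
  have dist_le: "heat_dist \<alpha> \<mu> \<nu> \<le> d"
  proof -
    let ?D = "\<lambda>\<rho> t z. ennreal ((enn2real (heat_flow (t / 2) \<mu> z) - enn2real (heat_flow (t / 2) \<rho> z))\<^sup>2)"
    have [measurable]: "(\<lambda>(t, z). ?D \<rho> t z) \<in> borel_measurable (borel \<Otimes>\<^sub>M borel)" if "sf_borel \<rho>" for \<rho>
    proof -
      note [measurable] = borel_measurable_heat_flow[OF that] borel_measurable_heat_flow[OF energy_coneD(2)[OF \<mu>]]
      show ?thesis by measurable
    qed
    \<comment> \<open>Finiteness of the limiting flow is what allows passing to real values in the
      limit.\<close>
    have pt: "?D \<nu> t z = liminf (\<lambda>j. ?D (N (\<phi> j)) t z)" if t: "0 < t" for t z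
    proof -
      have "(\<lambda>j. enn2real (heat_flow (t / 2) (N (\<phi> j)) z)) \<longlonglongrightarrow> enn2real (heat_flow (t / 2) \<nu> z)"
        using flow_lim[of "t / 2" z] flow_fin[of "t / 2" z] t by (intro tendsto_enn2real) (auto simp: less_top)
      then have "(\<lambda>j. ?D (N (\<phi> j)) t z) \<longlonglongrightarrow> ?D \<nu> t z"
        by (intro tendsto_ennrealI tendsto_power tendsto_diff tendsto_const)
      then show ?thesis by (intro lim_imp_Liminf[symmetric]) auto
    qed
    have "(\<integral>\<^sup>+ t. \<integral>\<^sup>+ z. ?D \<nu> t z \<partial>lborel \<partial>riesz_time \<alpha>) = (\<integral>\<^sup>+ t. \<integral>\<^sup>+ z. liminf (\<lambda>j. ?D (N (\<phi> j)) t z) \<partial>lborel \<partial>riesz_time \<alpha>)"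
      by (intro nn_integral_riesz_time_cong nn_integral_cong pt)
    also have "\<dots> \<le> (\<integral>\<^sup>+ t. liminf (\<lambda>j. \<integral>\<^sup>+ z. ?D (N (\<phi> j)) t z \<partial>lborel) \<partial>riesz_time \<alpha>)"
    proof (intro nn_integral_mono nn_integral_liminf)
      fix t and j
      note [measurable] = borel_measurable_heat_flow[OF NS(2)] borel_measurable_heat_flow[OF energy_coneD(2)[OF \<mu>]]
      show "(\<lambda>z. ?D (N (\<phi> j)) t z) \<in> borel_measurable lborel" by measurable
    qed
    also have "\<dots> \<le> liminf (\<lambda>j. \<integral>\<^sup>+ t. \<integral>\<^sup>+ z. ?D (N (\<phi> j)) t z \<partial>lborel \<partial>riesz_time \<alpha>)"
    proof (rule nn_integral_liminf)
      fix j
      have "(\<lambda>t. \<integral>\<^sup>+ z. ?D (N (\<phi> j)) t z \<partial>lborel) \<in> borel_measurable borel"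
        by (rule sf_borel_borel_measurable_nn_integral) (use NS(2) in auto)
      then show "(\<lambda>t. \<integral>\<^sup>+ z. ?D (N (\<phi> j)) t z \<partial>lborel) \<in> borel_measurable (riesz_time \<alpha>)" by simp
    qed
    finally have F: "(\<integral>\<^sup>+ t. \<integral>\<^sup>+ z. ?D \<nu> t z \<partial>lborel \<partial>riesz_time \<alpha>) \<le> liminf (\<lambda>j. \<integral>\<^sup>+ t. \<integral>\<^sup>+ z. ?D (N (\<phi> j)) t z \<partial>lborel \<partial>riesz_time \<alpha>)" .
    show ?thesis
    proof (rule ennreal_le_epsilon)
      fix \<epsilon> :: real assume \<epsilon>: "0 < \<epsilon>"
      have c: "riesz_const \<alpha> TYPE('a) \<noteq> 0" "riesz_const \<alpha> TYPE('a) \<noteq> top" using riesz_const_pos by auto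
      define b where "b = (d + ennreal \<epsilon>) / riesz_const \<alpha> TYPE('a)"
      have b: "riesz_const \<alpha> TYPE('a) * b = d + ennreal \<epsilon>"
        unfolding b_def using c by (subst ennreal_times_divide, subst mult.commute, subst mult_divide_eq_ennreal) auto
      have "eventually (\<lambda>j. inverse (real (Suc j)) < \<epsilon>) sequentially"
        using LIMSEQ_inverse_real_of_nat \<epsilon> by (simp add: order_tendsto_iff)
      then have "eventually (\<lambda>j. inverse (real (Suc (\<phi> j))) < \<epsilon>) sequentially"
        using filterlim_subseq[OF \<phi>] by (auto simp: filterlim_iff)
      then have "eventually (\<lambda>j. (\<integral>\<^sup>+ t. \<integral>\<^sup>+ z. ?D (N (\<phi> j)) t z \<partial>lborel \<partial>riesz_time \<alpha>) \<le> b) sequentially"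
      proof eventually_elim
        fix j assume "inverse (real (Suc (\<phi> j))) < \<epsilon>"
        then have "d + ennreal (inverse (real (Suc (\<phi> j)))) \<le> d + ennreal \<epsilon>" by (intro add_left_mono ennreal_leI) auto
        then have "heat_dist \<alpha> \<mu> (N (\<phi> j)) \<le> riesz_const \<alpha> TYPE('a) * b"
          using N_lt[of "\<phi> j"] b by (simp add: order_trans[OF less_imp_le])
        then show "(\<integral>\<^sup>+ t. \<integral>\<^sup>+ z. ?D (N (\<phi> j)) t z \<partial>lborel \<partial>riesz_time \<alpha>) \<le> b"
          unfolding heat_dist_def using c by (simp add: ennreal_mult_le_mult_iff)
      qed
      then have "liminf (\<lambda>j. \<integral>\<^sup>+ t. \<integral>\<^sup>+ z. ?D (N (\<phi> j)) t z \<partial>lborel \<partial>riesz_time \<alpha>) \<le> b"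
        by (intro Liminf_le) auto
      with F have "heat_dist \<alpha> \<mu> \<nu> \<le> riesz_const \<alpha> TYPE('a) * b"
        unfolding heat_dist_def by (intro mult_left_mono) auto
      then show "heat_dist \<alpha> \<mu> \<nu> \<le> d + ennreal \<epsilon>" by (simp add: b)
    qed
  qed
  have "energy \<alpha> \<nu> \<le> 2 * energy \<alpha> \<mu> + 2 * heat_dist \<alpha> \<mu> \<nu>"
    by (intro energy_le_heat_dist energy_coneD(2)[OF \<mu>] \<nu>_sf \<mu>_flow flow_fin)
  also have "\<dots> < \<infinity>" using E\<mu> dist_le d_fin by (auto simp: ennreal_mult_less_top intro: le_less_trans)
  finally have "\<nu> \<in> energy_cone \<alpha>" using \<nu>_radon by (simp add: energy_cone_def)
  moreover have "emeasure \<nu> (- A) = 0"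
  proof -
    \<comment> \<open>Vanishes exactly on A. The empty set needs its own case, since
      \<open>infdist\<close> to it is 0 by convention.\<close>
    define g where "g x = (if A = {} then 1 else min 1 (infdist x A))" for x
    have g: "0 \<le> g x" "g x \<le> 1" for x by (auto simp: g_def infdist_nonneg)
    have g0: "g x = 0 \<longleftrightarrow> x \<in> A" for x
      using in_closed_iff_infdist_zero[OF A, of x] infdist_nonneg[of x A] by (auto simp: g_def min_def)
    have g_cont: "continuous_on UNIV g"
      unfolding g_def[abs_def] by (cases "A = {}") (auto intro!: continuous_intros)
    have gm: "(\<lambda>x. ennreal (g x * heat 1 x)) \<in> borel_measurable borel"
      using borel_measurable_continuous_onI[OF g_cont] by measurable
    have z: "(\<integral>\<^sup>+ x. ennreal (g x * heat 1 x) \<partial>density (N j) ?w) = 0" for j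
    proof -
      have ae: "AE x in N j. x \<in> A"
        using N_null[of j] NS(4)[of j] A_borel by (intro AE_I[where N="- A"]) auto
      have m: "(\<lambda>x. ennreal (g x * heat 1 x)) \<in> borel_measurable (N j)" by (rule sf_borel_measurable1[OF NS(2) gm])
      have "(\<integral>\<^sup>+ x. ennreal (g x * heat 1 x) \<partial>density (N j) ?w) = (\<integral>\<^sup>+ x. ?w x * ennreal (g x * heat 1 x) \<partial>N j)"
        by (rule nn_integral_density[OF w_meas m])
      also have "\<dots> = (\<integral>\<^sup>+ x. 0 \<partial>N j)"
        by (rule nn_integral_cong_AE, use ae in eventually_elim) (simp add: g0[THEN iffD2])
      finally show ?thesis by simp
    qed
    have "(\<lambda>j. \<integral>\<^sup>+ x. ennreal (g x * heat 1 x) \<partial>density (N (\<phi> j)) ?w) \<longlonglongrightarrow> (\<integral>\<^sup>+ x. ennreal (g x * heat 1 x) \<partial>L)"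
      by (rule L_lim) (use g in \<open>auto intro!: continuous_on_mult g_cont continuous_on_heat heat_1_tendsto_0\<close>)
    then have "(\<integral>\<^sup>+ x. ennreal (g x * heat 1 x) \<partial>L) = 0"
      unfolding z by (rule LIMSEQ_unique[OF tendsto_const, symmetric])
    then have "AE x in L. ennreal (g x * heat 1 x) = 0"
      using L_meas[OF gm] by (subst (asm) nn_integral_0_iff_AE) auto
    then have "AE x in L. x \<in> A"
    proof eventually_elim
      fix x assume "ennreal (g x * heat 1 x) = 0"
      then have "g x * heat 1 x \<le> 0" by (simp add: ennreal_eq_0_iff)
      then have "g x = 0" using heat_pos[of 1 x] g(1)[of x] by (simp add: mult_le_0_iff)
      then show "x \<in> A" by (simp add: g0)
    qed
    then have "(\<integral>\<^sup>+ x. indicator (- A) x \<partial>\<nu>) = (\<integral>\<^sup>+ x. 0 \<partial>L)"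
      using A_borel by (subst \<nu>_int, simp) (rule nn_integral_cong_AE, auto elim!: eventually_mono)
    then show ?thesis using A_borel \<nu>_sets by simp
  qed
  ultimately have "\<nu> \<in> energy_cone_on \<alpha> A" by (simp add: on_iff)
  moreover have "heat_dist \<alpha> \<mu> \<nu> \<le> heat_dist \<alpha> \<mu> \<rho>" if "\<rho> \<in> energy_cone_on \<alpha> A" for \<rho>
    using dist_le unfolding d_def by (rule order_trans) (rule INF_lower[OF that])
  ultimately show ?thesis by (rule that)
qed

end

section \<open>Hahn--Jordan decomposition and the energy norm\<close>

lemma emeasure_bounded_finite:
  assumes "radon p" "bounded C"
  shows "emeasure p C < \<infinity>"
proof -
  have s: "sets p = sets borel" using assms by (simp add: radon_def)
  have "emeasure p C \<le> emeasure p (closure C)"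
    by (rule emeasure_mono) (auto simp: s closure_subset)
  also have "\<dots> < \<infinity>" using assms by (simp add: radon_def compact_closure)
  finally show ?thesis .
qed

text \<open>Both measures are absolutely continuous with respect to their sum. Densities that are
  finite everywhere make their difference unambiguous.\<close>

lemma radon_common_density:
  assumes p: "radon p" and q: "radon q"
  obtains \<rho> f g where "sf_borel \<rho>" "f \<in> borel_measurable borel" "g \<in> borel_measurable borel"
    "\<And>x. f x < (\<infinity>::ennreal)" "\<And>x. g x < (\<infinity>::ennreal)" "p = density \<rho> f" "q = density \<rho> g"
proof -
  define \<rho> where "\<rho> = lincomb 1 p 1 q"
  have \<rho>: "sf_borel \<rho>" unfolding \<rho>_def by (intro radon_sf_borel radon_lincomb p q) auto
  interpret \<rho>: sigma_finite_measure \<rho> using \<rho> by (rule sf_borelD)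
  have sp: "sets p = sets borel" "sets q = sets borel" using p q by (auto simp: radon_def)
  have "\<exists>f. f \<in> borel_measurable borel \<and> (\<forall>x. f x < \<infinity>) \<and> m = density \<rho> f"
    if m: "sf_borel m" and le: "\<And>B. B \<in> sets borel \<Longrightarrow> emeasure m B \<le> emeasure \<rho> B" for m
  proof -
    have "absolutely_continuous \<rho> m"
    proof -
      have "B \<in> null_sets m" if "B \<in> null_sets \<rho>" for B
      proof -
        have "B \<in> sets borel" "emeasure \<rho> B = 0" using that sf_borelD(2)[OF \<rho>] by (auto simp: null_sets_def)
        then show ?thesis using le[of B] sf_borelD(2)[OF m] by (auto simp: null_sets_def)
      qed
      then show ?thesis by (auto simp: absolutely_continuous_def)
    qed
    then obtain h where h: "h \<in> borel_measurable \<rho>" "density \<rho> h = m"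
      using \<rho>.Radon_Nikodym[of m] sf_borelD(2)[OF m] sf_borelD(2)[OF \<rho>] by auto
    have hb: "h \<in> borel_measurable borel" using h(1) measurable_cong_sets[OF sf_borelD(2)[OF \<rho>] refl] by blast
    have fin: "AE x in \<rho>. h x \<noteq> \<infinity>"
      using \<rho>.sigma_finite_iff_density_finite[OF h(1)] h(2) sf_borelD(1)[OF m] by simp
    \<comment> \<open>The Radon-Nikodym density is finite almost everywhere; its infinite values are
      replaced by 0 on a null set.\<close>
    define h' where "h' x = (if h x = \<infinity> then 0 else h x)" for x
    have h'b: "h' \<in> borel_measurable borel" unfolding h'_def using hb by measurable
    have "density \<rho> h' = density \<rho> h"
      by (rule density_cong) (use h(1) sf_borel_measurable1[OF \<rho> h'b] fin in \<open>auto simp: h'_def elim!: eventually_mono\<close>)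
    then show ?thesis using h(2) h'b by (intro exI[of _ h']) (auto simp: h'_def less_top[symmetric])
  qed
  then have ex: "\<exists>f. f \<in> borel_measurable borel \<and> (\<forall>x. f x < \<infinity>) \<and> m = density \<rho> f"
    if "sf_borel m" "\<And>B. B \<in> sets borel \<Longrightarrow> emeasure m B \<le> emeasure \<rho> B" for m
    using that by blast
  obtain f where "f \<in> borel_measurable borel" "\<And>x. f x < \<infinity>" "p = density \<rho> f"
    using ex[OF radon_sf_borel[OF p]] sp by (auto simp: \<rho>_def emeasure_lincomb)
  moreover obtain g where "g \<in> borel_measurable borel" "\<And>x. g x < \<infinity>" "q = density \<rho> g"
    using ex[OF radon_sf_borel[OF q]] sp by (auto simp: \<rho>_def emeasure_lincomb)
  ultimately show ?thesis using \<rho> by (intro that)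
qed

text \<open>Truncated subtraction of the densities is the positive part of f - g, and the supremum
  is approached on the Hahn set where g < f.\<close>

lemma pos_var_charge_diff:
  assumes \<rho>: "sf_borel \<rho>" and f: "f \<in> borel_measurable borel" "\<And>x. f x < (\<infinity>::ennreal)"
    and g: "g \<in> borel_measurable borel" "\<And>x. g x < (\<infinity>::ennreal)"
    and p: "radon p" "p = density \<rho> f" and q: "radon q" "q = density \<rho> g"
  shows "pos_var (charge p - charge q) = density \<rho> (\<lambda>x. f x - g x)"
proof -
  have fm: "f \<in> borel_measurable \<rho>" "g \<in> borel_measurable \<rho>" using \<rho> f(1) g(1) by (auto intro: sf_borel_measurable1)
  define P where "P = density \<rho> (\<lambda>x. f x - g x)"
  have P_sets: "sets P = sets borel" "space P = UNIV" using sf_borelD[OF \<rho>] by (auto simp: P_def)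
  have em: "emeasure (density \<rho> h) C = (\<integral>\<^sup>+ x. h x * indicator C x \<partial>\<rho>)" if "h \<in> borel_measurable borel" "C \<in> sets borel" for h C
    using that sf_borelD(2)[OF \<rho>] by (intro emeasure_density sf_borel_measurable1[OF \<rho>]) auto
  have dm: "(\<lambda>x. f x - g x) \<in> borel_measurable borel" using f(1) g(1) by measurable
  have fin: "emeasure p C < \<infinity>" "emeasure q C < \<infinity>" if "bounded C" for C
    using emeasure_bounded_finite p(1) q(1) that by auto
  have real_le: "ennreal (measure p C - measure q C) \<le> e" if "bounded C" "emeasure p C \<le> e + emeasure q C" for C e
  proof (cases e)
    case (real r)
    have "emeasure p C = ennreal (measure p C)" "emeasure q C = ennreal (measure q C)"
      using fin[OF that(1)] by (simp_all add: emeasure_eq_ennreal_measure less_top[symmetric])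
    then have "ennreal (measure p C) \<le> ennreal (r + measure q C)"
      using that(2) real by (simp add: ennreal_plus[symmetric] del: ennreal_plus)
    then have "measure p C \<le> r + measure q C" using real by (simp add: ennreal_le_iff del: ennreal_plus)
    then show ?thesis using real by (simp add: ennreal_leI)
  qed simp
  have real_eq: "e = ennreal (measure p C - measure q C)" if "bounded C" "emeasure p C = e + emeasure q C" for C e
  proof (cases e)
    case (real r)
    have "emeasure p C = ennreal (measure p C)" "emeasure q C = ennreal (measure q C)"
      using fin[OF that(1)] by (simp_all add: emeasure_eq_ennreal_measure less_top[symmetric])
    then have "ennreal (measure p C) = ennreal (r + measure q C)"
      using that(2) real by (simp add: ennreal_plus[symmetric] del: ennreal_plus)
    then have "measure p C = r + measure q C" using real by (simp add: ennreal_inj del: ennreal_plus)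
    then show ?thesis using real by simp
  next
    case top
    then show ?thesis using that(2) fin(1)[OF that(1)] by simp
  qed
  have eq: "(SUP C \<in> {C \<in> sets borel. bounded C \<and> C \<subseteq> B}. ennreal ((charge p - charge q) C)) = emeasure P B"
    if B: "B \<in> sets borel" for B
  proof (rule antisym)
    show "(SUP C \<in> {C \<in> sets borel. bounded C \<and> C \<subseteq> B}. ennreal ((charge p - charge q) C)) \<le> emeasure P B"
    proof (rule SUP_least)
      fix C :: "'a set" assume C: "C \<in> {C \<in> sets borel. bounded C \<and> C \<subseteq> B}"
      have "emeasure p C = (\<integral>\<^sup>+ x. f x * indicator C x \<partial>\<rho>)" unfolding p(2) using C f by (intro em) auto
      also have "\<dots> \<le> (\<integral>\<^sup>+ x. (f x - g x) * indicator C x + g x * indicator C x \<partial>\<rho>)"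
      proof (intro nn_integral_mono)
        fix x
        have "f x \<le> (f x - g x) + g x"
          by (cases "g x \<le> f x") (simp_all add: diff_add_cancel_ennreal add_increasing)
        then show "f x * indicator C x \<le> (f x - g x) * indicator C x + g x * indicator C x"
          by (auto simp: indicator_def)
      qed
      also have "\<dots> = (\<integral>\<^sup>+ x. (f x - g x) * indicator C x \<partial>\<rho>) + (\<integral>\<^sup>+ x. g x * indicator C x \<partial>\<rho>)"
        using C f g by (intro nn_integral_add sf_borel_measurable1[OF \<rho>]) auto
      also have "\<dots> = emeasure P C + emeasure q C"
        unfolding P_def q(2) using C g dm by (subst (1 2) em) auto
      finally have "ennreal (measure p C - measure q C) \<le> emeasure P C"
        using C by (intro real_le) auto
      also have "\<dots> \<le> emeasure P B" using C B P_sets by (intro emeasure_mono) auto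
      finally show "ennreal ((charge p - charge q) C) \<le> emeasure P B"
        using C by (simp add: charge_def)
    qed
    have z: "f x - g x = 0" if "f x \<le> g x" for x
    proof -
      obtain r s where "f x = ennreal r" "g x = ennreal s" "0 \<le> r" "0 \<le> s"
        using f(2)[of x] g(2)[of x] by (cases "f x"; cases "g x") auto
      then show ?thesis using that by (simp add: ennreal_minus ennreal_neg)
    qed
    define D where "D = {x. g x < f x}"
    have D: "D \<in> sets borel" unfolding D_def using f(1) g(1) by measurable
    \<comment> \<open>Cut by balls because a charge is evaluated on bounded sets only; the balls
      then exhaust the space.\<close>
    define C where "C k = B \<inter> D \<inter> cball 0 (real k)" for k :: nat
    have C: "C k \<in> {C \<in> sets borel. bounded C \<and> C \<subseteq> B}" for k
      using B D by (auto simp: C_def intro: bounded_subset[OF bounded_cball])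
    have PC: "emeasure P (B \<inter> cball 0 (real k)) = ennreal ((charge p - charge q) (C k))" for k
    proof -
      have "emeasure P (B \<inter> cball 0 (real k)) = (\<integral>\<^sup>+ x. (f x - g x) * indicator (B \<inter> cball 0 (real k)) x \<partial>\<rho>)"
        unfolding P_def using B dm by (intro em) auto
      also have "\<dots> = (\<integral>\<^sup>+ x. (f x - g x) * indicator (C k) x \<partial>\<rho>)"
        by (intro nn_integral_cong) (auto simp: C_def D_def indicator_def not_less z)
      finally have 1: "emeasure P (B \<inter> cball 0 (real k)) = \<dots>" .
      have "emeasure p (C k) = (\<integral>\<^sup>+ x. f x * indicator (C k) x \<partial>\<rho>)" unfolding p(2) using C f by (intro em) auto
      also have "\<dots> = (\<integral>\<^sup>+ x. (f x - g x) * indicator (C k) x + g x * indicator (C k) x \<partial>\<rho>)"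
        by (intro nn_integral_cong) (auto simp: C_def D_def indicator_def diff_add_cancel_ennreal)
      also have "\<dots> = (\<integral>\<^sup>+ x. (f x - g x) * indicator (C k) x \<partial>\<rho>) + (\<integral>\<^sup>+ x. g x * indicator (C k) x \<partial>\<rho>)"
      proof -
        note [measurable] = f(1) g(1)
        have [measurable]: "C k \<in> sets borel" using C by blast
        show ?thesis by (intro nn_integral_add sf_borel_measurable1[OF \<rho>]) measurable
      qed
      also have "(\<integral>\<^sup>+ x. g x * indicator (C k) x \<partial>\<rho>) = emeasure q (C k)"
        unfolding q(2) using C g by (intro em[symmetric]) auto
      finally have "(\<integral>\<^sup>+ x. (f x - g x) * indicator (C k) x \<partial>\<rho>) = ennreal (measure p (C k) - measure q (C k))"
        using C by (intro real_eq) auto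
      then show ?thesis using C 1 by (simp add: charge_def)
    qed
    have "(\<Union>k. B \<inter> cball 0 (real k)) = B"
      using real_arch_simple by auto
    then have "emeasure P B = (SUP k. emeasure P (B \<inter> cball 0 (real k)))"
      using B P_sets by (subst SUP_emeasure_incseq) (auto simp: incseq_def)
    also have "\<dots> \<le> (SUP C \<in> {C \<in> sets borel. bounded C \<and> C \<subseteq> B}. ennreal ((charge p - charge q) C))"
      unfolding PC by (intro SUP_least SUP_upper C)
    finally show "emeasure P B \<le> (SUP C \<in> {C \<in> sets borel. bounded C \<and> C \<subseteq> B}. ennreal ((charge p - charge q) C))" .
  qed
  have "pos_var (charge p - charge q) = measure_of (space P) (sets P) (emeasure P)"
    unfolding pos_var_def P_sets
  proof (rule measure_of_eq)
    fix B :: "'a set" assume "B \<in> sigma_sets UNIV (sets borel)"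
    then have "B \<in> sets borel" using sets.sigma_sets_eq[of "borel :: 'a measure"] by simp
    then show "(SUP C \<in> {C \<in> sets borel. bounded C \<and> C \<subseteq> B}. ennreal ((charge p - charge q) C)) = emeasure P B"
      by (rule eq)
  qed simp
  then show ?thesis by (simp only: measure_of_of_measure P_def)
qed

lemma energy_density_mono:
  assumes \<rho>: "sf_borel \<rho>" and f: "f \<in> borel_measurable borel" "h \<in> borel_measurable borel"
    and le: "\<And>x. h x \<le> f x" and p: "radon (density \<rho> f)"
  shows "radon (density \<rho> h)" "energy \<alpha> (density \<rho> h) \<le> energy \<alpha> (density \<rho> f)"
proof -
  have fm: "f \<in> borel_measurable \<rho>" "h \<in> borel_measurable \<rho>" using \<rho> f by (auto intro: sf_borel_measurable1)
  have s: "sets \<rho> = sets borel" by (rule sf_borelD[OF \<rho>])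
  have int_le: "(\<integral>\<^sup>+ x. k x \<partial>density \<rho> h) \<le> (\<integral>\<^sup>+ x. k x \<partial>density \<rho> f)" if k: "k \<in> borel_measurable borel" for k
    using sf_borel_measurable1[OF \<rho> k] fm le by (simp add: nn_integral_density nn_integral_mono mult_right_mono)
  show r: "radon (density \<rho> h)"
    unfolding radon_def
  proof (intro conjI allI impI)
    show "sets (density \<rho> h) = sets borel" by (simp add: s)
    fix K :: "'a set" assume K: "compact K"
    then have "K \<in> sets borel" by (simp add: compact_imp_closed)
    then have "emeasure (density \<rho> h) K \<le> emeasure (density \<rho> f) K"
      using int_le[of "indicator K"] s by simp
    also have "\<dots> < \<infinity>" using p K by (simp add: radon_def)
    finally show "emeasure (density \<rho> h) K < \<infinity>" .
  qed
  have km: "riesz_kernel \<alpha> x \<in> borel_measurable borel" for x :: 'a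
    unfolding riesz_kernel_def[abs_def] by measurable
  have "energy \<alpha> (density \<rho> h) = (\<integral>\<^sup>+ x. potential \<alpha> (density \<rho> h) x \<partial>density \<rho> h)"
    unfolding energy_def by (intro mutual_energy_eq_potential radon_sf_borel r)
  also have "\<dots> \<le> (\<integral>\<^sup>+ x. potential \<alpha> (density \<rho> f) x \<partial>density \<rho> h)"
    unfolding potential_def by (intro nn_integral_mono int_le km)
  also have "\<dots> \<le> (\<integral>\<^sup>+ x. potential \<alpha> (density \<rho> f) x \<partial>density \<rho> f)"
    by (intro int_le borel_measurable_potential radon_sf_borel p)
  also have "\<dots> = energy \<alpha> (density \<rho> f)"
    unfolding energy_def by (intro mutual_energy_eq_potential[symmetric] radon_sf_borel p)
  finally show "energy \<alpha> (density \<rho> h) \<le> energy \<alpha> (density \<rho> f)" .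
qed

context riesz begin

text \<open>Connects the encoded norm with \<open>heat_dist\<close>: the Hahn-Jordan parts have
  smaller densities than p and q, hence finite energy, and their polarisation identity is the
  squared norm.\<close>

lemma charge_diff_energy:
  fixes p q :: "'a measure"
  assumes p: "p \<in> energy_cone \<alpha>" and q: "q \<in> energy_cone \<alpha>"
  shows "charge p - charge q \<in> energy_space \<alpha>"
    and "energy_norm \<alpha> (charge p - charge q) = sqrt (enn2real (heat_dist \<alpha> p q))"
proof -
  note P = energy_coneD[OF p] and Q = energy_coneD[OF q]
  obtain \<rho> f g where \<rho>: "sf_borel \<rho>" and f: "f \<in> borel_measurable borel" "\<And>x. f x < (\<infinity>::ennreal)"
    and g: "g \<in> borel_measurable borel" "\<And>x. g x < (\<infinity>::ennreal)" and pq: "p = density \<rho> f" "q = density \<rho> g"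
    using radon_common_density[OF P(1) Q(1)] by metis
  define a where "a = density \<rho> (\<lambda>x. f x - g x)"
  define b where "b = density \<rho> (\<lambda>x. g x - f x)"
  have pos: "pos_var (charge p - charge q) = a"
    unfolding a_def by (rule pos_var_charge_diff[OF \<rho> f g P(1) pq(1) Q(1) pq(2)])
  have neg: "neg_var (charge p - charge q) = b"
  proof -
    have "- (charge p - charge q) = charge q - charge p" by (rule ext) simp
    then show ?thesis
      unfolding b_def neg_var_def by (simp only:) (rule pos_var_charge_diff[OF \<rho> g f Q(1) pq(2) P(1) pq(1)])
  qed
  have fg_m: "(\<lambda>x. f x - g x) \<in> borel_measurable borel" "(\<lambda>x. g x - f x) \<in> borel_measurable borel"
    using f(1) g(1) by measurable
  have a: "radon a" "energy \<alpha> a \<le> energy \<alpha> p"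
    unfolding a_def pq(1) using energy_density_mono[OF \<rho> f(1) fg_m(1)] P(1) pq(1) by (auto simp: diff_le_self_ennreal)
  have b: "radon b" "energy \<alpha> b \<le> energy \<alpha> q"
    unfolding b_def pq(2) using energy_density_mono[OF \<rho> g(1) fg_m(2)] Q(1) pq(2) by (auto simp: diff_le_self_ennreal)
  have a_fin: "energy \<alpha> a < \<infinity>" using a(2) P(3) by (rule le_less_trans)
  have b_fin: "energy \<alpha> b < \<infinity>" using b(2) Q(3) by (rule le_less_trans)
  note a_sf = radon_sf_borel[OF a(1)] and b_sf = radon_sf_borel[OF b(1)]
  have ab_fin: "mutual_energy \<alpha> a b < \<infinity>" by (rule mutual_energy_finite[OF a_sf b_sf a_fin b_fin])
  show "charge p - charge q \<in> energy_space \<alpha>"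
    unfolding energy_space_def signed_radon_def mem_Collect_eq pos neg using P(1) Q(1) a_fin b_fin ab_fin by blast
  \<comment> \<open>Since f + (g - f) = g + (f - g) with truncated differences, p + b = q + a; thus
    p - q and a - b have the same heat flow.\<close>
  have flow: "heat_flow t p z + heat_flow t b z = heat_flow t q z + heat_flow t a z" for t z
  proof -
    have m: "(\<lambda>y. ennreal (heat t (z - y))) \<in> borel_measurable \<rho>"
      "f \<in> borel_measurable \<rho>" "g \<in> borel_measurable \<rho>" "(\<lambda>x. f x - g x) \<in> borel_measurable \<rho>" "(\<lambda>x. g x - f x) \<in> borel_measurable \<rho>"
      using f(1) g(1) fg_m by (auto intro!: sf_borel_measurable1[OF \<rho>])
    have e: "f x + (g x - f x) = g x + (f x - g x)" for x
    proof -
      obtain r s where rs: "f x = ennreal r" "g x = ennreal s" "0 \<le> r" "0 \<le> s"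
        using f(2)[of x] g(2)[of x] by (cases "f x"; cases "g x") auto
      then show ?thesis
        by (cases "r \<le> s") (simp_all add: ennreal_minus ennreal_neg ennreal_plus[symmetric] del: ennreal_plus)
    qed
    have "heat_flow t p z + heat_flow t b z = (\<integral>\<^sup>+ y. (f y + (g y - f y)) * ennreal (heat t (z - y)) \<partial>\<rho>)"
      unfolding heat_flow_def pq(1) b_def nn_integral_density[OF m(2,1)] nn_integral_density[OF m(5,1)] distrib_right
      by (rule nn_integral_add[symmetric]) (intro borel_measurable_times_ennreal m)+
    also have "\<dots> = (\<integral>\<^sup>+ y. (g y + (f y - g y)) * ennreal (heat t (z - y)) \<partial>\<rho>)" by (simp only: e)
    also have "\<dots> = heat_flow t q z + heat_flow t a z"
      unfolding heat_flow_def pq(2) a_def nn_integral_density[OF m(3,1)] nn_integral_density[OF m(4,1)] distrib_right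
      by (rule nn_integral_add) (intro borel_measurable_times_ennreal m)+
    finally show ?thesis .
  qed
  have "enn2real (heat_flow t p z) - enn2real (heat_flow t q z) = enn2real (heat_flow t a z) - enn2real (heat_flow t b z)"
    if t: "0 < t" for t z
  proof -
    have fin: "heat_flow t p z < top" "heat_flow t q z < top" "heat_flow t a z < top" "heat_flow t b z < top"
      using heat_flow_finite[OF P(2,3) t, of z] heat_flow_finite[OF Q(2,3) t, of z]
        heat_flow_finite[OF a_sf a_fin t, of z] heat_flow_finite[OF b_sf b_fin t, of z] by auto
    then have "enn2real (heat_flow t p z) + enn2real (heat_flow t b z) = enn2real (heat_flow t q z) + enn2real (heat_flow t a z)"
      using flow[of t z] by (metis enn2real_plus)
    then show ?thesis by simp
  qed
  then have "heat_dist \<alpha> p q = heat_dist \<alpha> a b"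
    unfolding heat_dist_def
    by (intro arg_cong[where f="\<lambda>x. riesz_const \<alpha> TYPE('a) * x"] nn_integral_riesz_time_cong nn_integral_cong) simp
  moreover have "energy_inner \<alpha> (charge p - charge q) (charge p - charge q) = enn2real (heat_dist \<alpha> a b)"
  proof -
    have eq: "energy \<alpha> a + energy \<alpha> b = 2 * mutual_energy \<alpha> a b + heat_dist \<alpha> a b"
      by (rule energy_add_eq[OF a_sf b_sf a_fin b_fin])
    have d_fin: "heat_dist \<alpha> a b < top"
    proof -
      have "heat_dist \<alpha> a b \<le> energy \<alpha> a + energy \<alpha> b" unfolding eq by (simp add: add_increasing)
      also have "\<dots> < top" using a_fin b_fin by simp
      finally show ?thesis .
    qed
    have "enn2real (energy \<alpha> a) + enn2real (energy \<alpha> b) = 2 * enn2real (mutual_energy \<alpha> a b) + enn2real (heat_dist \<alpha> a b)"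
      using arg_cong[OF eq, of enn2real] a_fin b_fin ab_fin d_fin
      by (simp add: enn2real_plus enn2real_mult ennreal_mult_less_top)
    then show ?thesis
      unfolding energy_inner_def pos neg mutual_energy_commute[OF b_sf a_sf] by (simp add: energy_def)
  qed
  ultimately show "energy_norm \<alpha> (charge p - charge q) = sqrt (enn2real (heat_dist \<alpha> p q))"
    by (simp add: energy_norm_def)
qed

lemma charge_energy_space:
  assumes "p \<in> energy_cone \<alpha>"
  shows "charge (p :: 'a measure) \<in> energy_space \<alpha>"
proof -
  have "charge p - charge (null_measure borel) = charge p"
    by (rule ext) (simp add: charge_def)
  then show ?thesis
    using charge_diff_energy(1)[OF assms null_measure_energy_cone] by simp
qed

end

section \<open>Inner capacity and balayage\<close>

text \<open>All competitors have finite energy, so the infimum is infinite exactly when there is no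
  competitor.\<close>

lemma inner_capacity_eq_0_iff:
  "inner_capacity \<alpha> Q = 0 \<longleftrightarrow> (\<forall>\<nu>\<in>energy_cone_on \<alpha> Q. emeasure \<nu> UNIV \<noteq> 1)"
proof
  assume "inner_capacity \<alpha> Q = 0"
  then have top: "(INF \<nu> \<in> {\<nu> \<in> energy_cone_on \<alpha> Q. emeasure \<nu> UNIV = 1}. energy \<alpha> \<nu>) = top"
    by (simp add: inner_capacity_def divide_ennreal_def)
  show "\<forall>\<nu>\<in>energy_cone_on \<alpha> Q. emeasure \<nu> UNIV \<noteq> 1"
  proof (intro ballI notI)
    fix \<nu> assume \<nu>: "\<nu> \<in> energy_cone_on \<alpha> Q" "emeasure \<nu> UNIV = 1"
    then have "top \<le> energy \<alpha> \<nu>" unfolding top[symmetric] by (intro INF_lower) auto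
    moreover have "energy \<alpha> \<nu> < \<infinity>" using \<nu> by (auto simp: energy_cone_on_def dest: energy_coneD)
    ultimately show False by (simp add: top_unique)
  qed
next
  assume "\<forall>\<nu>\<in>energy_cone_on \<alpha> Q. emeasure \<nu> UNIV \<noteq> 1"
  then have e: "{\<nu> \<in> energy_cone_on \<alpha> Q. emeasure \<nu> UNIV = 1} = {}" by auto
  show "inner_capacity \<alpha> Q = 0" unfolding inner_capacity_def e by (simp add: divide_ennreal_def)
qed

text \<open>Otherwise the normalised restriction of \<nu> to a bounded part of Q of positive measure
  would be a unit measure of finite energy carried by Q.\<close>

lemma emeasure_eq_0_of_inner_capacity:
  assumes \<nu>: "\<nu> \<in> energy_cone \<alpha>" and Q: "Q \<in> sets borel" and cap: "inner_capacity \<alpha> Q = 0"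
  shows "emeasure \<nu> Q = 0"
proof -
  note N = energy_coneD[OF \<nu>]
  have "emeasure \<nu> (Q \<inter> cball 0 (real k)) = 0" for k
  proof (rule ccontr)
    \<comment> \<open>The ball makes the mass finite, so that it can be normalised to 1.\<close>
    define S where "S = Q \<inter> cball 0 (real k)"
    have S [measurable]: "S \<in> sets borel" using Q by (simp add: S_def)
    assume "emeasure \<nu> (Q \<inter> cball 0 (real k)) \<noteq> 0"
    then have m0: "emeasure \<nu> S \<noteq> 0" by (simp add: S_def)
    have m_fin: "emeasure \<nu> S < \<infinity>"
      by (rule emeasure_bounded_finite[OF N(1)]) (auto simp: S_def intro: bounded_subset[OF bounded_cball])
    define c where "c = 1 / emeasure \<nu> S"
    have c_fin: "c < \<infinity>" using m0 by (auto simp: c_def divide_ennreal_def less_top[symmetric])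
    define \<tau> where "\<tau> = density \<nu> (\<lambda>x. c * indicator S x)"
    have sm: "(\<lambda>x. c * indicator S x) \<in> borel_measurable \<nu>"
      using S by (intro sf_borel_measurable1[OF N(2)]) measurable
    have \<tau>_sets: "sets \<tau> = sets borel" by (simp add: \<tau>_def N(4))
    have int: "(\<integral>\<^sup>+ x. f x \<partial>\<tau>) \<le> c * (\<integral>\<^sup>+ x. f x \<partial>\<nu>)" if f: "f \<in> borel_measurable borel" for f
    proof -
      have fm: "f \<in> borel_measurable \<nu>" by (rule sf_borel_measurable1[OF N(2) f])
      have "(\<integral>\<^sup>+ x. f x \<partial>\<tau>) = (\<integral>\<^sup>+ x. c * indicator S x * f x \<partial>\<nu>)"
        unfolding \<tau>_def by (rule nn_integral_density[OF sm fm])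
      also have "\<dots> \<le> (\<integral>\<^sup>+ x. c * f x \<partial>\<nu>)"
        by (intro nn_integral_mono) (auto simp: indicator_def)
      also have "\<dots> = c * (\<integral>\<^sup>+ x. f x \<partial>\<nu>)" using fm by (rule nn_integral_cmult)
      finally show ?thesis .
    qed
    have em: "emeasure \<tau> B = c * emeasure \<nu> (S \<inter> B)" if "B \<in> sets borel" for B
    proof -
      have "emeasure \<tau> B = (\<integral>\<^sup>+ x. c * indicator S x * indicator B x \<partial>\<nu>)"
        unfolding \<tau>_def using that N(4) by (intro emeasure_density[OF sm]) auto
      also have "\<dots> = (\<integral>\<^sup>+ x. c * indicator (S \<inter> B) x \<partial>\<nu>)"
        by (intro nn_integral_cong) (auto simp: indicator_def)
      also have "\<dots> = c * emeasure \<nu> (S \<inter> B)"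
        using S that N(4) by (intro nn_integral_cmult_indicator) auto
      finally show ?thesis .
    qed
    have \<tau>_radon: "radon \<tau>"
      unfolding radon_def
    proof (intro conjI \<tau>_sets allI impI)
      fix K :: "'a set" assume K: "compact K"
      then have "emeasure \<tau> K = c * emeasure \<nu> (S \<inter> K)" by (intro em) (simp add: compact_imp_closed)
      also have "\<dots> \<le> c * emeasure \<nu> S"
        using S N(4) by (intro mult_left_mono emeasure_mono) auto
      also have "\<dots> < \<infinity>" using c_fin m_fin by (simp add: ennreal_mult_less_top)
      finally show "emeasure \<tau> K < \<infinity>" .
    qed
    note \<tau>_sf = radon_sf_borel[OF \<tau>_radon]
    have km: "riesz_kernel \<alpha> x \<in> borel_measurable borel" for x :: 'a
      unfolding riesz_kernel_def[abs_def] by measurable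
    have pot: "potential \<alpha> \<tau> x \<le> c * potential \<alpha> \<nu> x" for x
      unfolding potential_def by (rule int[OF km])
    have "energy \<alpha> \<tau> = (\<integral>\<^sup>+ x. potential \<alpha> \<tau> x \<partial>\<tau>)"
      unfolding energy_def by (rule mutual_energy_eq_potential[OF \<tau>_sf \<tau>_sf])
    also have "\<dots> \<le> (\<integral>\<^sup>+ x. c * potential \<alpha> \<nu> x \<partial>\<tau>)" by (intro nn_integral_mono pot)
    also have "\<dots> \<le> c * (\<integral>\<^sup>+ x. c * potential \<alpha> \<nu> x \<partial>\<nu>)"
      using borel_measurable_potential[OF N(2), of \<alpha>] by (intro int) measurable
    also have "\<dots> = c * (c * energy \<alpha> \<nu>)"
      unfolding energy_def mutual_energy_eq_potential[OF N(2) N(2)]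
      by (simp add: nn_integral_cmult sf_borel_measurable1[OF N(2) borel_measurable_potential[OF N(2)]])
    also have "\<dots> < \<infinity>" using c_fin N(3) by (simp add: ennreal_mult_less_top)
    finally have "\<tau> \<in> energy_cone \<alpha>" using \<tau>_radon by (simp add: energy_cone_def)
    moreover have "emeasure \<tau> (- Q) = 0"
    proof -
      have "S \<inter> - Q = {}" by (auto simp: S_def)
      then show ?thesis using Q by (subst em) auto
    qed
    ultimately have "\<tau> \<in> energy_cone_on \<alpha> Q" by (simp add: energy_cone_on_iff[OF Q])
    moreover have "emeasure \<tau> UNIV = 1"
      using m0 m_fin by (subst em) (auto simp: c_def ennreal_divide_times ennreal_divide_self)
    ultimately show False using cap by (auto simp: inner_capacity_eq_0_iff)
  qed
  then have "emeasure \<nu> (\<Union>k. Q \<inter> cball 0 (real k)) = 0"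
    using Q N(4) by (intro emeasure_UN_eq_0) auto
  moreover have "(\<Union>k. Q \<inter> cball 0 (real k)) = Q" using real_arch_simple by auto
  ultimately show ?thesis by simp
qed

lemma AE_eq_of_nn_integral_le:
  assumes f: "f \<in> borel_measurable M" "g \<in> borel_measurable M" and le: "AE x in M. f x \<le> g x"
    and int: "(\<integral>\<^sup>+ x. g x \<partial>M) \<le> (\<integral>\<^sup>+ x. f x \<partial>M)" and fin: "(\<integral>\<^sup>+ x. f x \<partial>M) < \<infinity>"
  shows "AE x in M. f x = g x"
proof -
  have "(\<integral>\<^sup>+ x. g x - f x \<partial>M) = (\<integral>\<^sup>+ x. g x \<partial>M) - (\<integral>\<^sup>+ x. f x \<partial>M)"
    using f fin le by (intro nn_integral_diff) auto
  also have "\<dots> = 0" using int le_less_trans[OF int fin] by (simp add: diff_eq_0_iff_ennreal)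
  finally have "AE x in M. g x - f x = 0"
    using f by (subst (asm) nn_integral_0_iff_AE) auto
  moreover have "AE x in M. g x \<noteq> \<infinity>"
    using f int fin by (intro nn_integral_PInf_AE) (auto simp: top_unique)
  ultimately show ?thesis using le
  proof eventually_elim
    fix x assume "g x - f x = 0" "g x \<noteq> \<infinity>" "f x \<le> g x"
    then show "f x = g x" by (metis add.left_neutral diff_add_cancel_ennreal)
  qed
qed

text \<open>The first-order condition at a minimum, for one-sided variations with small
  parameters.\<close>

lemma real_nonneg_of_quadratic:
  fixes x c :: real
  assumes c: "0 \<le> c" and q: "\<And>s. 0 < s \<Longrightarrow> s \<le> 1 \<Longrightarrow> 0 \<le> 2 * s * x + s\<^sup>2 * c"
  shows "0 \<le> x"
proof (rule ccontr)
  assume "\<not> 0 \<le> x"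
  then have x: "x < 0" by simp
  \<comment> \<open>Small enough that s c <= -x, so that the quadratic term cannot compensate 2 s
    x.\<close>
  define s where "s = - x / (c - x)"
  have s: "0 < s" "s \<le> 1" using x c by (auto simp: s_def field_simps)
  have "s * c \<le> - x" using x c by (simp add: s_def field_simps mult_nonneg_nonneg)
  then have "s * (2 * x + s * c) < 0" using s(1) x by (intro mult_pos_neg) auto
  then show False using q[OF s] by (simp add: power2_eq_square algebra_simps)
qed

section \<open>Variation of the minimiser and the balayage measure\<close>

context riesz begin

definition real_energy :: "'a measure \<Rightarrow> 'a measure \<Rightarrow> real" where
  "real_energy M N = enn2real (mutual_energy \<alpha> M N)"

lemma mutual_energy_eq_real_energy:
  assumes "M \<in> energy_cone \<alpha>" "N \<in> energy_cone \<alpha>"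
  shows "mutual_energy \<alpha> M N = ennreal (real_energy M N)"
  using mutual_energy_finite[of M N] energy_coneD[OF assms(1)] energy_coneD[OF assms(2)]
  by (simp add: real_energy_def less_top)

lemma real_energy_nonneg [simp]: "0 \<le> real_energy M N" by (simp add: real_energy_def)

lemma real_energy_commute:
  assumes "M \<in> energy_cone \<alpha>" "N \<in> energy_cone \<alpha>"
  shows "real_energy M N = real_energy N M"
  using mutual_energy_commute[OF energy_coneD(2)[OF assms(1)] energy_coneD(2)[OF assms(2)]] by (simp add: real_energy_def)

lemma heat_dist_eq_real_energy:
  assumes M: "M \<in> energy_cone \<alpha>" and N: "N \<in> energy_cone \<alpha>"
  shows "heat_dist \<alpha> M N = ennreal (real_energy M M - 2 * real_energy M N + real_energy N N)" "0 \<le> real_energy M M - 2 * real_energy M N + real_energy N N"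
proof -
  have eq: "ennreal (real_energy M M) + ennreal (real_energy N N) = 2 * ennreal (real_energy M N) + heat_dist \<alpha> M N"
    using energy_add_eq[OF energy_coneD(2)[OF M] energy_coneD(2)[OF N] energy_coneD(3)[OF M] energy_coneD(3)[OF N]]
    by (simp add: mutual_energy_eq_real_energy M N energy_def)
  then have "heat_dist \<alpha> M N \<noteq> top" by (metis ennreal_add_eq_top ennreal_neq_top)
  then obtain d where d: "heat_dist \<alpha> M N = ennreal d" "0 \<le> d" by (cases "heat_dist \<alpha> M N") auto
  have "ennreal (real_energy M M + real_energy N N) = ennreal (2 * real_energy M N + d)"
    using eq d by (simp add: ennreal_plus ennreal_mult')
  then have "real_energy M M + real_energy N N = 2 * real_energy M N + d" using d by (subst (asm) ennreal_inj) auto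
  then show "heat_dist \<alpha> M N = ennreal (real_energy M M - 2 * real_energy M N + real_energy N N)" "0 \<le> real_energy M M - 2 * real_energy M N + real_energy N N"
    using d by (auto simp: algebra_simps)
qed

lemma lincomb_cone:
  assumes M: "M \<in> energy_cone \<alpha>" and N: "N \<in> energy_cone \<alpha>" and a: "0 \<le> a" and b: "0 \<le> b"
  shows "lincomb (ennreal a) M (ennreal b) N \<in> energy_cone \<alpha>"
    and "L \<in> energy_cone \<alpha> \<Longrightarrow> real_energy (lincomb (ennreal a) M (ennreal b) N) L = a * real_energy M L + b * real_energy N L"
proof -
  note M' = energy_coneD[OF M] and N' = energy_coneD[OF N]
  have r: "radon (lincomb (ennreal a) M (ennreal b) N)" by (intro radon_lincomb M' N') auto
  note sf = radon_sf_borel[OF r]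
  have me: "mutual_energy \<alpha> (lincomb (ennreal a) M (ennreal b) N) L = ennreal a * mutual_energy \<alpha> M L + ennreal b * mutual_energy \<alpha> N L"
    if "sf_borel L" for L
    by (rule mutual_energy_lincomb_left[OF M'(2) N'(2) that sf])
  have me': "mutual_energy \<alpha> L (lincomb (ennreal a) M (ennreal b) N) = ennreal a * mutual_energy \<alpha> L M + ennreal b * mutual_energy \<alpha> L N"
    if "sf_borel L" for L
    by (rule mutual_energy_lincomb_right[OF M'(2) N'(2) that sf])
  show "lincomb (ennreal a) M (ennreal b) N \<in> energy_cone \<alpha>"
  proof -
    have "energy \<alpha> (lincomb (ennreal a) M (ennreal b) N)
      = ennreal a * (ennreal a * ennreal (real_energy M M) + ennreal b * ennreal (real_energy M N))
        + ennreal b * (ennreal a * ennreal (real_energy N M) + ennreal b * ennreal (real_energy N N))"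
      unfolding energy_def me[OF sf] me'[OF M'(2)] me'[OF N'(2)] mutual_energy_eq_real_energy[OF M M] mutual_energy_eq_real_energy[OF M N] mutual_energy_eq_real_energy[OF N M] mutual_energy_eq_real_energy[OF N N] ..
    also have "\<dots> < \<infinity>" by (simp add: ennreal_mult_less_top)
    finally show ?thesis using r by (simp add: energy_cone_def)
  qed
  assume L: "L \<in> energy_cone \<alpha>"
  have "real_energy (lincomb (ennreal a) M (ennreal b) N) L = enn2real (ennreal (a * real_energy M L + b * real_energy N L))"
    unfolding real_energy_def[of "lincomb _ _ _ _"] me[OF energy_coneD(2)[OF L]]
    using a b by (simp add: mutual_energy_eq_real_energy[OF M L] mutual_energy_eq_real_energy[OF N L] ennreal_plus ennreal_mult')
  then show "real_energy (lincomb (ennreal a) M (ennreal b) N) L = a * real_energy M L + b * real_energy N L"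
    using a b by (simp del: ennreal_plus)
qed

text \<open>Competitors \<nu> + s \<sigma> give the first inequality and (1 - s) \<nu> the second;
  both stay in the cone for 0 < s <= 1.\<close>

lemma minimizer_variation:
  assumes A: "A \<in> sets borel" and \<mu>: "\<mu> \<in> energy_cone \<alpha>" and \<nu>: "\<nu> \<in> energy_cone_on \<alpha> A"
    and min: "\<And>\<rho>. \<rho> \<in> energy_cone_on \<alpha> A \<Longrightarrow> heat_dist \<alpha> \<mu> \<nu> \<le> heat_dist \<alpha> \<mu> \<rho>"
    and \<sigma>: "\<sigma> \<in> energy_cone_on \<alpha> A"
  shows "real_energy \<mu> \<sigma> \<le> real_energy \<nu> \<sigma>" "real_energy \<nu> \<nu> \<le> real_energy \<mu> \<nu>"
proof -
  have \<nu>c: "\<nu> \<in> energy_cone \<alpha>" "emeasure \<nu> (- A) = 0" and \<sigma>c: "\<sigma> \<in> energy_cone \<alpha>" "emeasure \<sigma> (- A) = 0"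
    using \<nu> \<sigma> by (auto simp: energy_cone_on_iff[OF A])
  have key: "- 2 * real_energy \<mu> \<nu> + real_energy \<nu> \<nu> \<le> - 2 * (a * real_energy \<mu> \<nu> + b * real_energy \<mu> \<sigma>) + (a * (a * real_energy \<nu> \<nu> + b * real_energy \<nu> \<sigma>) + b * (a * real_energy \<nu> \<sigma> + b * real_energy \<sigma> \<sigma>))"
    if ab: "0 \<le> a" "0 \<le> b" for a b
  proof -
    let ?l = "lincomb (ennreal a) \<nu> (ennreal b) \<sigma>"
    have lc: "?l \<in> energy_cone \<alpha>" by (rule lincomb_cone[OF \<nu>c(1) \<sigma>c(1) ab])
    have "emeasure ?l (- A) = 0"
      using A \<nu>c(2) \<sigma>c(2) energy_coneD(4)[OF \<nu>c(1)] energy_coneD(4)[OF \<sigma>c(1)] by (simp add: emeasure_lincomb)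
    then have "?l \<in> energy_cone_on \<alpha> A" using lc by (simp add: energy_cone_on_iff[OF A])
    then have "heat_dist \<alpha> \<mu> \<nu> \<le> heat_dist \<alpha> \<mu> ?l" by (rule min)
    then have le: "real_energy \<mu> \<mu> - 2 * real_energy \<mu> \<nu> + real_energy \<nu> \<nu> \<le> real_energy \<mu> \<mu> - 2 * real_energy \<mu> ?l + real_energy ?l ?l"
      using heat_dist_eq_real_energy[OF \<mu> \<nu>c(1)] heat_dist_eq_real_energy[OF \<mu> lc] by (simp add: ennreal_le_iff)
    have lin: "real_energy ?l L = a * real_energy \<nu> L + b * real_energy \<sigma> L" if "L \<in> energy_cone \<alpha>" for L
      by (rule lincomb_cone(2)[OF \<nu>c(1) \<sigma>c(1) ab that])
    have "real_energy \<mu> ?l = a * real_energy \<mu> \<nu> + b * real_energy \<mu> \<sigma>"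
      using lin[OF \<mu>] real_energy_commute \<mu> lc \<nu>c(1) \<sigma>c(1) by metis
    moreover have "real_energy ?l ?l = a * (a * real_energy \<nu> \<nu> + b * real_energy \<nu> \<sigma>) + b * (a * real_energy \<nu> \<sigma> + b * real_energy \<sigma> \<sigma>)"
    proof -
      have "real_energy \<nu> ?l = a * real_energy \<nu> \<nu> + b * real_energy \<nu> \<sigma>" "real_energy \<sigma> ?l = a * real_energy \<nu> \<sigma> + b * real_energy \<sigma> \<sigma>"
        using lin[OF \<nu>c(1)] lin[OF \<sigma>c(1)] real_energy_commute lc \<nu>c(1) \<sigma>c(1) by metis+
      then show ?thesis using lin[OF lc] by simp
    qed
    ultimately show ?thesis using le by simp
  qed
  have "0 \<le> real_energy \<nu> \<sigma> - real_energy \<mu> \<sigma>"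
  proof (rule real_nonneg_of_quadratic[of "real_energy \<sigma> \<sigma>"])
    fix s :: real assume "0 < s"
    then show "0 \<le> 2 * s * (real_energy \<nu> \<sigma> - real_energy \<mu> \<sigma>) + s\<^sup>2 * real_energy \<sigma> \<sigma>"
      using key[of 1 s] by (simp add: power2_eq_square algebra_simps)
  qed simp
  then show "real_energy \<mu> \<sigma> \<le> real_energy \<nu> \<sigma>" by simp
  have "0 \<le> real_energy \<mu> \<nu> - real_energy \<nu> \<nu>"
  proof (rule real_nonneg_of_quadratic[of "real_energy \<nu> \<nu>"])
    fix s :: real assume "0 < s" "s \<le> 1"
    then show "0 \<le> 2 * s * (real_energy \<mu> \<nu> - real_energy \<nu> \<nu>) + s\<^sup>2 * real_energy \<nu> \<nu>"
      using key[of "1 - s" 0] by (simp add: power2_eq_square algebra_simps)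
  qed simp
  then show "real_energy \<nu> \<nu> \<le> real_energy \<mu> \<nu>" by simp
qed

lemma nn_integral_potential:
  assumes "M \<in> energy_cone \<alpha>" "N \<in> energy_cone \<alpha>"
  shows "(\<integral>\<^sup>+ x. potential \<alpha> M x \<partial>N) = ennreal (real_energy M N)"
  using mutual_energy_eq_potential[OF energy_coneD(2)[OF assms(1)] energy_coneD(2)[OF assms(2)], of \<alpha>]
  by (simp add: mutual_energy_eq_real_energy[OF assms])

lemma measurable_potential_cone:
  assumes "M \<in> energy_cone \<alpha>" "N \<in> energy_cone \<alpha>"
  shows "potential \<alpha> M \<in> borel_measurable N"
  by (intro sf_borel_measurable1[OF energy_coneD(2)[OF assms(2)]] borel_measurable_potential energy_coneD(2)[OF assms(1)])

text \<open>The factor \<open>riesz_const\<close> cancels, and the integrability conditions of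
  \<open>heat_mix_domination\<close> are the energy of M and its mutual energy with a
  Gaussian.\<close>

lemma potential_domination:
  fixes M N :: "'a measure"
  assumes M: "M \<in> energy_cone \<alpha>" and N: "N \<in> energy_cone \<alpha>"
    and le: "AE x in M. potential \<alpha> M x \<le> potential \<alpha> N x"
  shows "potential \<alpha> M x \<le> potential \<alpha> N x"
proof -
  note M' = energy_coneD[OF M] and N' = energy_coneD[OF N]
  have c: "riesz_const \<alpha> TYPE('a) \<noteq> 0" "riesz_const \<alpha> TYPE('a) \<noteq> top" using riesz_const_pos by auto
  have P: "potential \<alpha> L x = riesz_const \<alpha> TYPE('a) * heat_mix (riesz_time \<alpha>) L x" if "sf_borel L" for L :: "'a measure" and x
    unfolding heat_mix_def by (rule potential_eq_heat_flow[OF that])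
  have iff: "potential \<alpha> M x \<le> potential \<alpha> N x \<longleftrightarrow> heat_mix (riesz_time \<alpha>) M x \<le> heat_mix (riesz_time \<alpha>) N x" for x
    unfolding P[OF M'(2)] P[OF N'(2)] using c by (simp add: ennreal_mult_le_mult_iff)
  have fin: "(\<integral>\<^sup>+ x. heat_mix (riesz_time \<alpha>) M x \<partial>L) < \<infinity>" if L: "sf_borel L" "energy \<alpha> L < \<infinity>" for L :: "'a measure"
  proof -
    have m: "heat_mix (riesz_time \<alpha>) M \<in> borel_measurable L"
      by (intro sf_borel_measurable1[OF L(1)] borel_measurable_heat_mix M'(2)) simp
    have "riesz_const \<alpha> TYPE('a) * (\<integral>\<^sup>+ x. heat_mix (riesz_time \<alpha>) M x \<partial>L) = mutual_energy \<alpha> M L"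
      unfolding mutual_energy_eq_potential[OF M'(2) L(1)] P[OF M'(2)] by (rule nn_integral_cmult[OF m, symmetric])
    also have "\<dots> < \<infinity>" by (rule mutual_energy_finite[OF M'(2) L(1) M'(3) L(2)])
    finally show ?thesis using c by (auto simp: ennreal_mult_less_top)
  qed
  have "heat_mix (riesz_time \<alpha>) M x \<le> heat_mix (riesz_time \<alpha>) N x"
  proof (rule heat_mix_domination[OF M'(2) N'(2) fin[OF M'(2,3)]])
    have "(\<integral>\<^sup>+ x. heat_mix (riesz_time \<alpha>) M x * ennreal (heat 2 x) \<partial>lborel) = (\<integral>\<^sup>+ x. heat_mix (riesz_time \<alpha>) M x \<partial>heat_measure 2)"
      unfolding heat_measure_def using borel_measurable_heat_mix[OF sf_borel_riesz_time M'(2)]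
      by (subst nn_integral_density) (auto simp: mult.commute)
    also have "\<dots> < \<infinity>" by (rule fin) (auto intro: energy_heat_measure[unfolded infinity_ennreal_def])
    finally show "(\<integral>\<^sup>+ x. heat_mix (riesz_time \<alpha>) M x * ennreal (heat 2 x) \<partial>lborel) < \<infinity>" .
    show "AE x in M. heat_mix (riesz_time \<alpha>) M x \<le> heat_mix (riesz_time \<alpha>) N x" using le by (simp add: iff)
  qed
  then show ?thesis by (simp add: iff)
qed

text \<open>The hypothesis says that the squared distance of M and N is at most 0.\<close>

lemma cone_eqI:
  fixes M N :: "'a measure"
  assumes M: "M \<in> energy_cone \<alpha>" and N: "N \<in> energy_cone \<alpha>" and le: "real_energy M M + real_energy N N \<le> 2 * real_energy M N"
  shows "M = N"
proof (rule heat_dist_0_imp_eq)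
  show "heat_dist \<alpha> M N = 0" using heat_dist_eq_real_energy[OF M N] le by simp
qed (use energy_coneD[OF M] energy_coneD[OF N] in auto)

theorem balayage:
  assumes A: "closed (A :: 'a set)" and \<mu>: "\<mu> \<in> energy_cone \<alpha>"
  shows "\<exists>\<mu>A \<in> energy_cone_on \<alpha> A.
      nearly_everywhere_on \<alpha> A (\<lambda>x. potential \<alpha> \<mu>A x = potential \<alpha> \<mu> x)
    \<and> (\<forall>x. potential \<alpha> \<mu>A x \<le> potential \<alpha> \<mu> x)
    \<and> orthogonal_projection_onto \<alpha> (charge ` energy_cone_on \<alpha> A) (charge \<mu>) (charge \<mu>A)
    \<and> (\<forall>\<nu> \<in> energy_cone_on \<alpha> A.
         nearly_everywhere_on \<alpha> A (\<lambda>x. potential \<alpha> \<nu> x = potential \<alpha> \<mu> x) \<longrightarrow> \<nu> = \<mu>A)"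
proof -
  have Ab: "A \<in> sets borel" using A by simp
  note on_iff = energy_cone_on_iff[OF Ab]
  obtain \<nu> where \<nu>: "\<nu> \<in> energy_cone_on \<alpha> A"
    and min: "\<And>\<rho>. \<rho> \<in> energy_cone_on \<alpha> A \<Longrightarrow> heat_dist \<alpha> \<mu> \<nu> \<le> heat_dist \<alpha> \<mu> \<rho>"
    using heat_dist_minimizer[OF A \<mu>] by metis
  have \<nu>c: "\<nu> \<in> energy_cone \<alpha>" using \<nu> by (simp add: on_iff)
  have var: "real_energy \<mu> \<sigma> \<le> real_energy \<nu> \<sigma>" if "\<sigma> \<in> energy_cone_on \<alpha> A" for \<sigma>
    by (rule minimizer_variation[OF Ab \<mu> \<nu> min that])
  have var': "real_energy \<nu> \<nu> \<le> real_energy \<mu> \<nu>" by (rule minimizer_variation[OF Ab \<mu> \<nu> min \<nu>])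
  have bm: "potential \<alpha> \<mu> \<in> borel_measurable borel" "potential \<alpha> \<rho> \<in> borel_measurable borel"
    if "\<rho> \<in> energy_cone \<alpha>" for \<rho>
    using borel_measurable_potential energy_coneD(2) \<mu> that by blast+
  have ae_A: "AE x in \<rho>. x \<in> A" if "\<rho> \<in> energy_cone_on \<alpha> A" for \<rho>
    using that energy_coneD(4)[of \<rho> \<alpha>] Ab by (intro AE_I[where N="- A"]) (auto simp: on_iff)
  have ae_ne: "AE x in \<rho>. P x"
    if "\<rho> \<in> energy_cone_on \<alpha> A" "nearly_everywhere_on \<alpha> A P" "{x \<in> A. \<not> P x} \<in> sets borel" for \<rho> P
  proof -
    have "emeasure \<rho> {x \<in> A. \<not> P x} = 0"
      by (rule emeasure_eq_0_of_inner_capacity) (use that in \<open>auto simp: nearly_everywhere_on_def on_iff\<close>)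
    then have "AE x in \<rho>. x \<notin> {x \<in> A. \<not> P x}"
      using that energy_coneD(4)[of \<rho> \<alpha>] by (intro AE_I[where N="{x \<in> A. \<not> P x}"]) (auto simp: on_iff)
    then show ?thesis using ae_A[OF that(1)] by eventually_elim auto
  qed
  \<comment> \<open>A unit measure \<tau> on the exceptional set would have strictly smaller
    potential of \<nu> than of \<mu> almost everywhere, yet the variation gives the reverse
    inequality between the finite integrals.\<close>
  have ge_ne: "nearly_everywhere_on \<alpha> A (\<lambda>x. potential \<alpha> \<mu> x \<le> potential \<alpha> \<nu> x)"
    unfolding nearly_everywhere_on_def inner_capacity_eq_0_iff
  proof (intro ballI notI)
    let ?Q = "{x \<in> A. \<not> potential \<alpha> \<mu> x \<le> potential \<alpha> \<nu> x}"
    have Q: "?Q \<in> sets borel"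
    proof -
      have "?Q = A \<inter> {x \<in> space borel. potential \<alpha> \<nu> x < potential \<alpha> \<mu> x}" by auto
      also have "\<dots> \<in> sets borel" using Ab bm[OF \<nu>c] by (intro sets.Int borel_measurable_less) auto
      finally show ?thesis .
    qed
    fix \<tau> assume \<tau>: "\<tau> \<in> energy_cone_on \<alpha> ?Q" and one: "emeasure \<tau> UNIV = 1"
    have \<tau>c: "\<tau> \<in> energy_cone \<alpha>" "emeasure \<tau> (- ?Q) = 0" using \<tau> by (auto simp: energy_cone_on_iff[OF Q])
    note T = energy_coneD[OF \<tau>c(1)]
    have "emeasure \<tau> (- A) \<le> emeasure \<tau> (- ?Q)" using Q T(4) by (intro emeasure_mono) auto
    then have \<tau>A: "\<tau> \<in> energy_cone_on \<alpha> A" using \<tau>c by (simp add: on_iff)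
    have ae: "AE x in \<tau>. x \<in> ?Q" using \<tau>c(2) Q T(4) by (intro AE_I[where N="- ?Q"]) auto
    have "AE x in \<tau>. potential \<alpha> \<nu> x = potential \<alpha> \<mu> x"
    proof (rule AE_eq_of_nn_integral_le)
      show "AE x in \<tau>. potential \<alpha> \<nu> x \<le> potential \<alpha> \<mu> x" using ae by eventually_elim auto
      show "(\<integral>\<^sup>+ x. potential \<alpha> \<mu> x \<partial>\<tau>) \<le> (\<integral>\<^sup>+ x. potential \<alpha> \<nu> x \<partial>\<tau>)"
        using var[OF \<tau>A] by (simp add: nn_integral_potential \<mu> \<nu>c \<tau>c(1) ennreal_leI)
    qed (use measurable_potential_cone \<mu> \<nu>c \<tau>c(1) in \<open>auto simp: nn_integral_potential\<close>)
    with ae have "AE x in \<tau>. False" by eventually_elim auto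
    then have "emeasure \<tau> (space \<tau>) = 0" by (simp add: AE_iff_null null_sets_def)
    then show False using one sf_borelD(3)[OF T(2)] by simp
  qed
  have Q1: "{x \<in> A. \<not> potential \<alpha> \<mu> x \<le> potential \<alpha> \<nu> x} \<in> sets borel"
  proof -
    have "{x \<in> A. \<not> potential \<alpha> \<mu> x \<le> potential \<alpha> \<nu> x} = A \<inter> {x \<in> space borel. potential \<alpha> \<nu> x < potential \<alpha> \<mu> x}" by auto
    also have "\<dots> \<in> sets borel" using Ab bm[OF \<nu>c] by (intro sets.Int borel_measurable_less) auto
    finally show ?thesis .
  qed
  \<comment> \<open>A set of zero capacity is \<nu>-null, so U^\<mu> <= U^\<nu> holds \<nu>-almost
    everywhere; the radial variation reverses the integrals.\<close>
  have "AE x in \<nu>. potential \<alpha> \<mu> x = potential \<alpha> \<nu> x"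
  proof (rule AE_eq_of_nn_integral_le)
    show "AE x in \<nu>. potential \<alpha> \<mu> x \<le> potential \<alpha> \<nu> x" by (rule ae_ne[OF \<nu> ge_ne Q1])
    show "(\<integral>\<^sup>+ x. potential \<alpha> \<nu> x \<partial>\<nu>) \<le> (\<integral>\<^sup>+ x. potential \<alpha> \<mu> x \<partial>\<nu>)"
      using var' by (simp add: nn_integral_potential \<mu> \<nu>c ennreal_leI)
  qed (use measurable_potential_cone \<mu> \<nu>c in \<open>auto simp: nn_integral_potential\<close>)
  then have "AE x in \<nu>. potential \<alpha> \<nu> x \<le> potential \<alpha> \<mu> x" by eventually_elim simp
  then have le: "potential \<alpha> \<nu> x \<le> potential \<alpha> \<mu> x" for x by (rule potential_domination[OF \<nu>c \<mu>])
  have eq_ne: "nearly_everywhere_on \<alpha> A (\<lambda>x. potential \<alpha> \<nu> x = potential \<alpha> \<mu> x)"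
  proof -
    have "{x \<in> A. potential \<alpha> \<nu> x \<noteq> potential \<alpha> \<mu> x} = {x \<in> A. \<not> potential \<alpha> \<mu> x \<le> potential \<alpha> \<nu> x}"
      using le by (auto simp: antisym)
    then show ?thesis using ge_ne by (simp add: nearly_everywhere_on_def)
  qed
  have unique: "\<rho> = \<nu>" if \<rho>: "\<rho> \<in> energy_cone_on \<alpha> A" and ne: "nearly_everywhere_on \<alpha> A (\<lambda>x. potential \<alpha> \<rho> x = potential \<alpha> \<mu> x)" for \<rho>
  proof -
    have \<rho>c: "\<rho> \<in> energy_cone \<alpha>" using \<rho> by (simp add: on_iff)
    have Q: "{x \<in> A. \<not> potential \<alpha> \<kappa> x = potential \<alpha> \<mu> x} \<in> sets borel" if "\<kappa> \<in> energy_cone \<alpha>" for \<kappa>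
    proof -
      have "{x \<in> A. \<not> potential \<alpha> \<kappa> x = potential \<alpha> \<mu> x} = A \<inter> {x \<in> space borel. potential \<alpha> \<kappa> x \<noteq> potential \<alpha> \<mu> x}" by auto
      also have "\<dots> \<in> sets borel" using Ab bm[OF that] by (intro sets.Int borel_measurable_neq) auto
      finally show ?thesis .
    qed
    \<comment> \<open>Measures in the cone do not charge the two exceptional sets, so \<rho> and
      \<nu> have equal mutual energy with each of them; testing with \<rho> and with \<nu> gives
      distance 0.\<close>
    have eq: "real_energy \<rho> \<sigma> = real_energy \<nu> \<sigma>" if \<sigma>: "\<sigma> \<in> energy_cone_on \<alpha> A" for \<sigma>
    proof -
      have \<sigma>c: "\<sigma> \<in> energy_cone \<alpha>" using \<sigma> by (simp add: on_iff)
      have "AE x in \<sigma>. potential \<alpha> \<rho> x = potential \<alpha> \<mu> x" "AE x in \<sigma>. potential \<alpha> \<nu> x = potential \<alpha> \<mu> x"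
        using ae_ne[OF \<sigma> ne Q[OF \<rho>c]] ae_ne[OF \<sigma> eq_ne Q[OF \<nu>c]] by auto
      then have "AE x in \<sigma>. potential \<alpha> \<rho> x = potential \<alpha> \<nu> x" by eventually_elim simp
      then have "(\<integral>\<^sup>+ x. potential \<alpha> \<rho> x \<partial>\<sigma>) = (\<integral>\<^sup>+ x. potential \<alpha> \<nu> x \<partial>\<sigma>)" by (rule nn_integral_cong_AE)
      then show ?thesis by (simp add: nn_integral_potential \<rho>c \<nu>c \<sigma>c)
    qed
    show ?thesis
      by (rule cone_eqI[OF \<rho>c \<nu>c]) (use eq[OF \<rho>] eq[OF \<nu>] real_energy_commute[OF \<rho>c \<nu>c] in simp)
  qed
  have norm_le: "energy_norm \<alpha> (charge \<mu> - charge \<kappa>) \<le> energy_norm \<alpha> (charge \<mu> - charge \<rho>) \<longleftrightarrow> heat_dist \<alpha> \<mu> \<kappa> \<le> heat_dist \<alpha> \<mu> \<rho>"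
    if "\<kappa> \<in> energy_cone \<alpha>" "\<rho> \<in> energy_cone \<alpha>" for \<kappa> \<rho>
    unfolding charge_diff_energy(2)[OF \<mu> that(1)] charge_diff_energy(2)[OF \<mu> that(2)]
    using heat_dist_eq_real_energy[OF \<mu> that(1)] heat_dist_eq_real_energy[OF \<mu> that(2)] by (simp add: ennreal_le_iff)
  have "orthogonal_projection_onto \<alpha> (charge ` energy_cone_on \<alpha> A) (charge \<mu>) (charge \<nu>)"
    unfolding orthogonal_projection_onto_def
  proof (intro conjI ballI impI)
    show "charge ` energy_cone_on \<alpha> A \<subseteq> energy_space \<alpha>" using charge_energy_space by (auto simp: on_iff)
    show "charge \<mu> \<in> energy_space \<alpha>" by (rule charge_energy_space[OF \<mu>])
    show "charge \<nu> \<in> charge ` energy_cone_on \<alpha> A" using \<nu> by simp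
    fix \<rho>' assume "\<rho>' \<in> charge ` energy_cone_on \<alpha> A"
    then obtain \<rho> where \<rho>: "\<rho> \<in> energy_cone_on \<alpha> A" "\<rho>' = charge \<rho>" by auto
    then show "energy_norm \<alpha> (charge \<mu> - charge \<nu>) \<le> energy_norm \<alpha> (charge \<mu> - \<rho>')"
      using min[OF \<rho>(1)] norm_le[OF \<nu>c, of \<rho>] by (simp add: on_iff)
  next
    fix \<kappa>' assume "\<kappa>' \<in> charge ` energy_cone_on \<alpha> A"
      and min': "\<forall>\<rho>\<in>charge ` energy_cone_on \<alpha> A. energy_norm \<alpha> (charge \<mu> - \<kappa>') \<le> energy_norm \<alpha> (charge \<mu> - \<rho>)"
    then obtain \<kappa> where \<kappa>: "\<kappa> \<in> energy_cone_on \<alpha> A" "\<kappa>' = charge \<kappa>" by auto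
    have \<kappa>c: "\<kappa> \<in> energy_cone \<alpha>" using \<kappa> by (simp add: on_iff)
    have \<kappa>_min: "heat_dist \<alpha> \<mu> \<kappa> \<le> heat_dist \<alpha> \<mu> \<rho>" if "\<rho> \<in> energy_cone_on \<alpha> A" for \<rho>
      using min' \<kappa>(2) that norm_le[OF \<kappa>c, of \<rho>] by (auto simp: on_iff)
    \<comment> \<open>The variational inequalities of both minimisers, each tested with the other,
      sum to E(\<kappa>) + E(\<nu>) <= 2 E(\<kappa>, \<nu>).\<close>
    have "real_energy \<mu> \<nu> \<le> real_energy \<kappa> \<nu>" "real_energy \<kappa> \<kappa> \<le> real_energy \<mu> \<kappa>"
      using minimizer_variation[OF Ab \<mu> \<kappa>(1) \<kappa>_min \<nu>] by auto
    then have "\<kappa> = \<nu>"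
      using var[OF \<kappa>(1)] var' real_energy_commute[OF \<kappa>c \<nu>c] by (intro cone_eqI[OF \<kappa>c \<nu>c]) simp
    then show "\<kappa>' = charge \<nu>" using \<kappa> by simp
  qed
  then show ?thesis using \<nu> eq_ne le unique by blast
qed

end

theorem theorem3p1:
  fixes \<alpha> :: real and A :: "'a::euclidean_space set" and \<mu> :: "'a measure"
  assumes "DIM('a) \<ge> 3"
    and "0 < \<alpha>" and "\<alpha> \<le> 2"
    and "closed A" and "A \<noteq> UNIV"
    and "inner_capacity \<alpha> A > 0"
    and "\<mu> \<in> energy_cone \<alpha>"
  shows "\<exists>\<mu>A \<in> energy_cone_on \<alpha> A.
      nearly_everywhere_on \<alpha> A (\<lambda>x. potential \<alpha> \<mu>A x = potential \<alpha> \<mu> x)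
    \<and> (\<forall>x. potential \<alpha> \<mu>A x \<le> potential \<alpha> \<mu> x)
    \<and> orthogonal_projection_onto \<alpha> (charge ` energy_cone_on \<alpha> A) (charge \<mu>) (charge \<mu>A)
    \<and> (\<forall>\<nu> \<in> energy_cone_on \<alpha> A.
         nearly_everywhere_on \<alpha> A (\<lambda>x. potential \<alpha> \<nu> x = potential \<alpha> \<mu> x) \<longrightarrow> \<nu> = \<mu>A)"
proof -
  interpret riesz \<alpha> "TYPE('a)" by (rule riesz.intro) (use assms in auto)
  show ?thesis by (rule balayage) (use assms in auto)
qed

end
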